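(* Let $n\ge 2$, let $U\in \mathcal{F}^a_n$ be a point of the PBW degenerate flag variety lying outside the open cell $\imath(\mathbb{A}^N)$, and let $\varphi:\mathfrak{G}(n)\to \mathcal{F}^a_n$ be the projection from the graph closure. Regard $U$ as a subrepresentation $N\subset P\oplus I$, i.e. as a point of the quiver Grassmannian $\mathrm{Gr}_{\dim P}(P\oplus I)$, with $N\simeq N_P\oplus N_I$, $N_P\subset P$, $N_I\subset I$. Then the fiber $\varphi^{-1}(U)$ is isomorphic to the projectivization $\mathbb{P}(\mathrm{Hom}_Q(P/N_P,N_I))$.
   Context: Everything is over $\mathbb{C}$. $L$ is an $n$-dimensional vector space with basis $\ell_1,\dots,\ell_n$; $\mathrm{pr}_i:L\to L$ is the projection along the $i$-th basis vector ($\mathrm{pr}_i\ell_i=0$, $\mathrm{pr}_i\ell_j=\ell_j$ for $j\ne i$). $L_d^-=\mathrm{span}\{\ell_1,\dots,\ell_d\}$, $L_d^+=\mathrm{span}\{\ell_{d+1},\dots,\ell_n\}$. The PBW degenerate flag variety $\mathcal{F}^a_n\subset\prod_{d=1}^{n-1}\mathrm{Gr}(d,L)$ consists of collections $(U_d)_{d=1}^{n-1}$, $\dim U_d=d$, with $\mathrm{pr}_{d+1}U_d\subset U_{d+1}$ for $d=1,\dots,n-2$. Let $N=n(n-1)/2$. Let $\mathfrak{n}_-^a$ be the space of strictly lower triangular $n\times n$ matrices (dimension $N$), identified with $\mathbb{A}^N$. For $f=\sum_{i>j}f_{i,j}E_{i,j}\in\mathfrak{n}_-^a$ let $f_d:L_d^-\to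 L_d^+$ be given by the entries of $f$ in the first $d$ columns and last $n-d$ rows. The open cell is parametrized by $\imath:\mathbb{A}^N\to\mathcal{F}^a_n$, $\imath(f)=(\mathrm{span}\{\ell_a+f_d\ell_a:\ 1\le a\le d\})_{d=1}^{n-1}$. Let $V=\mathbb{C}v\oplus\mathfrak{n}_-^a$; $\mathbb{A}^N$ is embedded in $\mathbb{P}(V)$ by $f\mapsto[v+f]$. The graph closure is $\mathfrak{G}(n)=\overline{\{(x,\imath(x)):x\in\mathbb{A}^N\}}\subset\mathbb{P}(V)\times\mathcal{F}^a_n$, and $\varphi:\mathfrak{G}(n)\to\mathcal{F}^a_n$ is the second projection. $Q$ is the equioriented quiver $1\to2\to\dots\to n-1$ of type $A_{n-1}$. For $1\le a\le b\le n-1$, $M_{a,b}$ is the indecomposable $Q$-module with one-dimensional spaces at vertices $a,\dots,b$ (and zero elsewhere). $P_a=M_{a,n-1}$, $I_b=M_{1,b}$, $P=\bigoplus_{a=1}^{n-1}P_a$, $I=\bigoplus_{b=1}^{n-1}I_b$, so $\dim P=(1,2,\dots,n-1)$. $\mathrm{Gr}_{\dim P}(P\oplus I)$ is the quiver Grassmannian of subrepresentations of dimension vector $\dim P$. It is identified with $\mathcal{F}^a_n$: at each vertex $d$ the space of $P\oplus I$ is $L$, with $P$ giving $L_d^-$ (the summand $P_a$, $a\le d$, corresponds to $\ell_a$) and $I$ giving $L_d^+$ (the summand $I_b$, $b\ge d$, corresponds to $\ell_{b+1}$), and the map from vertex $d$ to $d+1$ is $\mathrm{pr}_{d+1}$.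 For a subrepresentation $N\subset P\oplus I$ of dimension $\dim P$ one takes $N_I=N\cap I$ and $N_P$ the image of $N$ under the projection $P\oplus I\to P$; it is known that $N\simeq N_P\oplus N_I$. *)

theory Defs
  imports "HOL-Analysis.Abstract_Topology" "HOL-Library.Function_Algebras" "HOL-Library.FuncSet"
begin

section \<open>Complex vector spaces\<close>

definition fscale :: "complex \<Rightarrow> ('i \<Rightarrow> complex) \<Rightarrow> 'i \<Rightarrow> complex" where
  "fscale c x = (\<lambda>i. c * x i)"

global_interpretation cfun: vector_space "fscale :: complex \<Rightarrow> ('i \<Rightarrow> complex) \<Rightarrow> 'i \<Rightarrow> complex"
  by unfold_locales (auto simp: fscale_def algebra_simps)

text \<open>Quotient spaces and spaces of homomorphisms are not subspaces of a fixed vector space type,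
  so vector spaces are also treated as explicit structures.\<close>

record 'v vspace =
  car :: "'v set"
  vzero :: 'v
  vadd :: "'v \<Rightarrow> 'v \<Rightarrow> 'v"
  vscl :: "complex \<Rightarrow> 'v \<Rightarrow> 'v"

definition fspace :: "('i \<Rightarrow> complex) set \<Rightarrow> ('i \<Rightarrow> complex) vspace" where
  "fspace S = \<lparr>car = S, vzero = 0, vadd = (+), vscl = fscale\<rparr>"

definition linear_form :: "'v vspace \<Rightarrow> ('v \<Rightarrow> complex) \<Rightarrow> bool" where
  "linear_form W g \<longleftrightarrow>
     (\<forall>x\<in>car W. \<forall>y\<in>car W. g (vadd W x y) = g x + g y) \<and>
     (\<forall>c. \<forall>x\<in>car W. g (vscl W c x) = c * g x)"


section \<open>Algebraic varieties\<close>

inductive_set polyfun :: "('c \<Rightarrow> complex) set \<Rightarrow> ('c \<Rightarrow> complex) set" for G where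
  const: "(\<lambda>_. a) \<in> polyfun G"
| coord: "g \<in> G \<Longrightarrow> g \<in> polyfun G"
| add: "p \<in> polyfun G \<Longrightarrow> q \<in> polyfun G \<Longrightarrow> (\<lambda>c. p c + q c) \<in> polyfun G"
| mult: "p \<in> polyfun G \<Longrightarrow> q \<in> polyfun G \<Longrightarrow> (\<lambda>c. p c * q c) \<in> polyfun G"

text \<open>Projective spaces, Grassmannians and their products are presented by homogeneous
  coordinates: \<open>cover\<close> is the set of admissible coordinate vectors (an open subset of an affine
  space on which \<open>coords\<close> generates the polynomial functions), and \<open>quo\<close> sends a coordinate vector
  to the point it represents. For \<open>P(W)\<close> this is \<open>W - {0} \<rightarrow> P(W)\<close>; for \<open>Gr(d,L)\<close> it is
  the map sending a \<open>d\<close>-frame in \<open>L\<close> to its span. These maps are principal bundles (for \<open>GL_1\<close> and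
  \<open>GL_d\<close>) and have local sections in the Zariski topology. Hence a subset of the quotient is
  Zariski open iff its preimage in \<open>cover\<close> is, and a function on a subvariety of the quotient is
  regular iff its pullback to \<open>cover\<close> is. This is used as the definition.\<close>

record ('c, 'x) coord_space =
  cover :: "'c set"
  coords :: "('c \<Rightarrow> complex) set"
  quo :: "'c \<Rightarrow> 'x"

definition points :: "('c, 'x) coord_space \<Rightarrow> 'x set" where
  "points A = quo A ` cover A"

definition zariski_open :: "('c, 'x) coord_space \<Rightarrow> 'x set \<Rightarrow> bool" where
  "zariski_open A T \<longleftrightarrow> T \<subseteq> points A \<and>
     (\<exists>S \<subseteq> polyfun (coords A). \<forall>c\<in>cover A. quo A c \<in> T \<longleftrightarrow> (\<exists>p\<in>S. p c \<noteq> 0))"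

definition zariski :: "('c, 'x) coord_space \<Rightarrow> 'x topology" where
  "zariski A = topology (zariski_open A)"

lemma istopology_zariski_open: "istopology (zariski_open A)"
  unfolding istopology_def
proof (intro conjI allI impI)
  fix S T assume S: "zariski_open A S" and T: "zariski_open A T"
  obtain S' where S': "S' \<subseteq> polyfun (coords A)"
      "\<forall>c\<in>cover A. quo A c \<in> S \<longleftrightarrow> (\<exists>p\<in>S'. p c \<noteq> 0)"
    using S unfolding zariski_open_def by (elim conjE exE)
  obtain T' where T': "T' \<subseteq> polyfun (coords A)"
      "\<forall>c\<in>cover A. quo A c \<in> T \<longleftrightarrow> (\<exists>p\<in>T'. p c \<noteq> 0)"
    using T unfolding zariski_open_def by (elim conjE exE)
  let ?R = "(\<lambda>(p, q) c. p c * q c) ` (S' \<times> T')"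
  have "?R \<subseteq> polyfun (coords A)"
  proof
    fix h assume "h \<in> ?R"
    then obtain p q where "p \<in> S'" "q \<in> T'" "h = (\<lambda>c. p c * q c)" by auto
    then show "h \<in> polyfun (coords A)"
      using S'(1) T'(1) by (simp add: polyfun.mult subset_iff)
  qed
  moreover have "\<forall>c\<in>cover A. quo A c \<in> S \<inter> T \<longleftrightarrow> (\<exists>p\<in>?R. p c \<noteq> 0)"
    using S'(2) T'(2) by simp
  moreover have "S \<inter> T \<subseteq> points A"
    using S unfolding zariski_open_def by (simp add: le_infI1)
  ultimately show "zariski_open A (S \<inter> T)"
    unfolding zariski_open_def by (intro conjI exI[of _ ?R])
next
  fix K assume K: "\<forall>T\<in>K. zariski_open A T"
  then have "\<forall>T\<in>K. \<exists>S. S \<subseteq> polyfun (coords A) \<and>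
      (\<forall>c\<in>cover A. quo A c \<in> T \<longleftrightarrow> (\<exists>p\<in>S. p c \<noteq> 0))"
    unfolding zariski_open_def by simp
  then obtain F where F: "\<forall>T\<in>K. F T \<subseteq> polyfun (coords A) \<and>
      (\<forall>c\<in>cover A. quo A c \<in> T \<longleftrightarrow> (\<exists>p\<in>F T. p c \<noteq> 0))"
    by (rule bchoice[THEN exE])
  have "(\<Union>T\<in>K. F T) \<subseteq> polyfun (coords A)"
    using F by (simp add: UN_subset_iff)
  moreover have "\<forall>c\<in>cover A. quo A c \<in> \<Union>K \<longleftrightarrow> (\<exists>p\<in>(\<Union>T\<in>K. F T). p c \<noteq> 0)"
    using F by simp
  moreover have "\<Union>K \<subseteq> points A"
    using K unfolding zariski_open_def by (simp add: Sup_le_iff)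
  ultimately show "zariski_open A (\<Union>K)"
    unfolding zariski_open_def by (intro conjI exI[of _ "\<Union>T\<in>K. F T"])
qed

lemma openin_zariski: "openin (zariski A) = zariski_open A"
  by (simp add: zariski_def istopology_zariski_open)

text \<open>\<open>regular A T f\<close>: locally on \<open>T\<close>, \<open>f\<close> is a quotient of polynomials in the homogeneous
  coordinates. A principal open set suffices as neighbourhood, since numerator and denominator may
  be multiplied by a common polynomial.\<close>

definition regular :: "('c, 'x) coord_space \<Rightarrow> 'x set \<Rightarrow> ('x \<Rightarrow> complex) \<Rightarrow> bool" where
  "regular A T f \<longleftrightarrow>
     (\<forall>c\<in>cover A. quo A c \<in> T \<longrightarrow>
        (\<exists>p\<in>polyfun (coords A). \<exists>r\<in>polyfun (coords A). r c \<noteq> 0 \<and>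
           (\<forall>c'\<in>cover A. quo A c' \<in> T \<and> r c' \<noteq> 0 \<longrightarrow> f (quo A c') = p c' / r c')))"

definition morphism ::
    "('c, 'x) coord_space \<Rightarrow> 'x set \<Rightarrow> ('e, 'y) coord_space \<Rightarrow> 'y set \<Rightarrow> ('x \<Rightarrow> 'y) \<Rightarrow> bool" where
  "morphism A X B Y \<Phi> \<longleftrightarrow>
     continuous_map (subtopology (zariski A) X) (subtopology (zariski B) Y) \<Phi> \<and>
     (\<forall>T f. openin (subtopology (zariski B) Y) T \<and> regular B T f \<longrightarrow>
        regular A {x \<in> X. \<Phi> x \<in> T} (f \<circ> \<Phi>))"

definition isomorphic_varieties ::
    "('c, 'x) coord_space \<Rightarrow> 'x set \<Rightarrow> ('e, 'y) coord_space \<Rightarrow> 'y set \<Rightarrow> bool" where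
  "isomorphic_varieties A X B Y \<longleftrightarrow>
     (\<exists>\<Phi> \<Psi>. morphism A X B Y \<Phi> \<and> morphism B Y A X \<Psi> \<and>
        (\<forall>x\<in>X. \<Psi> (\<Phi> x) = x) \<and> (\<forall>y\<in>Y. \<Phi> (\<Psi> y) = y))"

definition line :: "'v vspace \<Rightarrow> 'v \<Rightarrow> 'v set" where
  "line W w = range (\<lambda>c. vscl W c w)"

definition proj_space :: "'v vspace \<Rightarrow> ('v, 'v set) coord_space" where
  "proj_space W = \<lparr>cover = car W - {vzero W}, coords = Collect (linear_form W), quo = line W\<rparr>"

definition prod_space ::
    "('c, 'x) coord_space \<Rightarrow> ('e, 'y) coord_space \<Rightarrow> ('c \<times> 'e, 'x \<times> 'y) coord_space" where
  "prod_space A B =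
     \<lparr>cover = cover A \<times> cover B,
      coords = {\<lambda>(c, e). g c | g. g \<in> coords A} \<union> {\<lambda>(c, e). g e | g. g \<in> coords B},
      quo = map_prod (quo A) (quo B)\<rparr>"

definition Prod_space ::
    "'j set \<Rightarrow> ('j \<Rightarrow> ('c, 'x) coord_space) \<Rightarrow> ('j \<Rightarrow> 'c, 'j \<Rightarrow> 'x) coord_space" where
  "Prod_space J A =
     \<lparr>cover = (\<Pi>\<^sub>E j\<in>J. cover (A j)),
      coords = {\<lambda>c. g (c j) | j g. j \<in> J \<and> g \<in> coords (A j)},
      quo = (\<lambda>c. \<lambda>j\<in>J. quo (A j) (c j))\<rparr>"


section \<open>The PBW degenerate flag variety and the graph closure\<close>

type_synonym cvec = "nat \<Rightarrow> complex"

definition ell :: "nat \<Rightarrow> cvec" where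
  "ell i = (\<lambda>j. if j = i then 1 else 0)"

definition L :: "nat \<Rightarrow> cvec set" where
  "L n = cfun.span (ell ` {1..n})"

definition Lminus :: "nat \<Rightarrow> cvec set" where
  "Lminus d = cfun.span (ell ` {1..d})"

definition Lplus :: "nat \<Rightarrow> nat \<Rightarrow> cvec set" where
  "Lplus n d = cfun.span (ell ` {d+1..n})"

definition pr :: "nat \<Rightarrow> cvec \<Rightarrow> cvec" where
  "pr i x = x(i := 0)"

definition Gr :: "nat \<Rightarrow> nat \<Rightarrow> cvec set set" where
  "Gr n d = {U. cfun.subspace U \<and> U \<subseteq> L n \<and> cfun.dim U = d}"

definition Gr_space :: "nat \<Rightarrow> nat \<Rightarrow> (nat \<Rightarrow> cvec, cvec set) coord_space" where
  "Gr_space n d =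
     \<lparr>cover = {B \<in> {1..d} \<rightarrow>\<^sub>E L n. inj_on B {1..d} \<and> cfun.independent (B ` {1..d})},
      coords = {\<lambda>B. B k i | k i. k \<in> {1..d} \<and> i \<in> {1..n}},
      quo = (\<lambda>B. cfun.span (B ` {1..d}))\<rparr>"

definition flag_variety :: "nat \<Rightarrow> (nat \<Rightarrow> cvec set) set" where
  "flag_variety n =
     {U \<in> (\<Pi>\<^sub>E d\<in>{1..n-1}. Gr n d). \<forall>d\<in>{1..n-2}. pr (d+1) ` U d \<subseteq> U (d+1)}"

definition nminus :: "nat \<Rightarrow> (nat \<times> nat \<Rightarrow> complex) set" where
  "nminus n = {f. \<forall>i j. f (i, j) \<noteq> 0 \<longrightarrow> 1 \<le> j \<and> j < i \<and> i \<le> n}"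

definition fblock :: "nat \<Rightarrow> (nat \<times> nat \<Rightarrow> complex) \<Rightarrow> nat \<Rightarrow> cvec \<Rightarrow> cvec" where
  "fblock n f d x = (\<lambda>i. if i \<in> {d+1..n} then \<Sum>j=1..d. f (i, j) * x j else 0)"

definition iota :: "nat \<Rightarrow> (nat \<times> nat \<Rightarrow> complex) \<Rightarrow> nat \<Rightarrow> cvec set" where
  "iota n f = (\<lambda>d\<in>{1..n-1}. cfun.span {ell a + fblock n f d (ell a) | a. a \<in> {1..d}})"

text \<open>In \<open>V = \<complex>v \<oplus> nminus n\<close>, index \<open>None\<close> carries the coefficient of \<open>v\<close> and index
  \<open>Some (i, j)\<close> the matrix entry at \<open>(i, j)\<close>.\<close>

definition V :: "nat \<Rightarrow> ((nat \<times> nat) option \<Rightarrow> complex) vspace" where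
  "V n = fspace {w. (\<lambda>ij. w (Some ij)) \<in> nminus n}"

definition v_plus :: "(nat \<times> nat \<Rightarrow> complex) \<Rightarrow> (nat \<times> nat) option \<Rightarrow> complex" where
  "v_plus f = case_option 1 f"

definition ambient :: "nat \<Rightarrow>
    (((nat \<times> nat) option \<Rightarrow> complex) \<times> (nat \<Rightarrow> nat \<Rightarrow> cvec),
     ((nat \<times> nat) option \<Rightarrow> complex) set \<times> (nat \<Rightarrow> cvec set)) coord_space" where
  "ambient n = prod_space (proj_space (V n)) (Prod_space {1..n-1} (Gr_space n))"

definition graph_closure ::
    "nat \<Rightarrow> (((nat \<times> nat) option \<Rightarrow> complex) set \<times> (nat \<Rightarrow> cvec set)) set" where
  "graph_closure n =
     subtopology (zariski (ambient n)) (points (proj_space (V n)) \<times> flag_variety n)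
       closure_of {(line (V n) (v_plus f), iota n f) | f. f \<in> nminus n}"

definition phi_fiber :: "nat \<Rightarrow> (nat \<Rightarrow> cvec set) \<Rightarrow>
    (((nat \<times> nat) option \<Rightarrow> complex) set \<times> (nat \<Rightarrow> cvec set)) set" where
  "phi_fiber n U = {x \<in> graph_closure n. snd x = U}"


section \<open>Representations of the equioriented quiver \<open>1 \<rightarrow> 2 \<rightarrow> \<dots> \<rightarrow> m\<close>\<close>

text \<open>\<open>arr X d\<close> is the map from vertex \<open>d\<close> to vertex \<open>d + 1\<close>. Only vertices \<open>1, \<dots>, m\<close> and
  arrows \<open>1, \<dots>, m - 1\<close> matter.\<close>

record 'v qrep =
  sp :: "nat \<Rightarrow> 'v vspace"
  arr :: "nat \<Rightarrow> 'v \<Rightarrow> 'v"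

definition Mrep :: "nat \<Rightarrow> nat \<Rightarrow> complex qrep" where
  "Mrep a b =
     \<lparr>sp = (\<lambda>d. \<lparr>car = (if a \<le> d \<and> d \<le> b then UNIV else {0}),
                 vzero = 0, vadd = (+), vscl = (*)\<rparr>),
      arr = (\<lambda>d x. if a \<le> d \<and> d + 1 \<le> b then x else 0)\<rparr>"

definition dsum :: "nat set \<Rightarrow> (nat \<Rightarrow> complex qrep) \<Rightarrow> cvec qrep" where
  "dsum K X =
     \<lparr>sp = (\<lambda>d. fspace {x. (\<forall>k\<in>K. x k \<in> car (sp (X k) d)) \<and> (\<forall>k. k \<notin> K \<longrightarrow> x k = 0)}),
      arr = (\<lambda>d x k. if k \<in> K then arr (X k) d (x k) else 0)\<rparr>"

definition sub_rep :: "'v qrep \<Rightarrow> (nat \<Rightarrow> 'v set) \<Rightarrow> 'v qrep" where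
  "sub_rep X N = X\<lparr>sp := (\<lambda>d. (sp X d)\<lparr>car := N d\<rparr>)\<rparr>"

definition coset :: "'v vspace \<Rightarrow> 'v set \<Rightarrow> 'v \<Rightarrow> 'v set" where
  "coset W N x = {vadd W x u | u. u \<in> N}"

definition quot_space :: "'v vspace \<Rightarrow> 'v set \<Rightarrow> 'v set vspace" where
  "quot_space W N =
     \<lparr>car = coset W N ` car W,
      vzero = N,
      vadd = (\<lambda>A B. \<Union>a\<in>A. \<Union>b\<in>B. coset W N (vadd W a b)),
      vscl = (\<lambda>c A. \<Union>a\<in>A. coset W N (vscl W c a))\<rparr>"

definition quot_rep :: "'v qrep \<Rightarrow> (nat \<Rightarrow> 'v set) \<Rightarrow> 'v set qrep" where
  "quot_rep X N =
     \<lparr>sp = (\<lambda>d. quot_space (sp X d) (N d)),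
      arr = (\<lambda>d A. \<Union>a\<in>A. coset (sp X (d+1)) (N (d+1)) (arr X d a))\<rparr>"

definition linear_maps :: "'v vspace \<Rightarrow> 'w vspace \<Rightarrow> ('v \<Rightarrow> 'w) set" where
  "linear_maps W W' = {h \<in> car W \<rightarrow>\<^sub>E car W'.
     (\<forall>x\<in>car W. \<forall>y\<in>car W. h (vadd W x y) = vadd W' (h x) (h y)) \<and>
     (\<forall>c. \<forall>x\<in>car W. h (vscl W c x) = vscl W' c (h x))}"

definition Hom_Q :: "nat \<Rightarrow> 'v qrep \<Rightarrow> 'w qrep \<Rightarrow> (nat \<Rightarrow> 'v \<Rightarrow> 'w) vspace" where
  "Hom_Q m X Y =
     \<lparr>car = {h \<in> (\<Pi>\<^sub>E d\<in>{1..m}. linear_maps (sp X d) (sp Y d)).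
               \<forall>d\<in>{1..m-1}. \<forall>x\<in>car (sp X d). h (d+1) (arr X d x) = arr Y d (h d x)},
      vzero = (\<lambda>d\<in>{1..m}. \<lambda>x\<in>car (sp X d). vzero (sp Y d)),
      vadd = (\<lambda>g h. \<lambda>d\<in>{1..m}. \<lambda>x\<in>car (sp X d). vadd (sp Y d) (g d x) (h d x)),
      vscl = (\<lambda>c h. \<lambda>d\<in>{1..m}. \<lambda>x\<in>car (sp X d). vscl (sp Y d) c (h d x))\<rparr>"

definition quiver_Gr :: "nat \<Rightarrow> (nat \<Rightarrow> nat) \<Rightarrow> cvec qrep \<Rightarrow> (nat \<Rightarrow> cvec set) set" where
  "quiver_Gr m e X =
     {N \<in> extensional {1..m}.
        (\<forall>d\<in>{1..m}. cfun.subspace (N d) \<and> N d \<subseteq> car (sp X d) \<and> cfun.dim (N d) = e d) \<and>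
        (\<forall>d\<in>{1..m-1}. arr X d ` N d \<subseteq> N (d+1))}"


section \<open>The flag variety as a quiver Grassmannian\<close>

text \<open>The summand \<open>P_a\<close> sits in coordinate \<open>a\<close>, the summand \<open>I_b\<close> in coordinate \<open>b + 1\<close>.\<close>

definition Prep :: "nat \<Rightarrow> cvec qrep" where
  "Prep n = dsum {1..n-1} (\<lambda>a. Mrep a (n-1))"

definition Irep :: "nat \<Rightarrow> cvec qrep" where
  "Irep n = dsum (Suc ` {1..n-1}) (\<lambda>k. Mrep 1 (k-1))"

text \<open>With these coordinates \<open>P\<close> and \<open>I\<close> are complementary inside \<open>L\<close> at every vertex, so their
  direct sum is internal; see the lemmas below.\<close>

definition PIrep :: "nat \<Rightarrow> cvec qrep" where
  "PIrep n =
     \<lparr>sp = (\<lambda>d. fspace {p + i | p i. p \<in> car (sp (Prep n) d) \<and> i \<in> car (sp (Irep n) d)}),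
      arr = (\<lambda>d. pr (d+1))\<rparr>"

definition NI :: "nat \<Rightarrow> (nat \<Rightarrow> cvec set) \<Rightarrow> nat \<Rightarrow> cvec set" where
  "NI n N d = N d \<inter> car (sp (Irep n) d)"

definition NP :: "nat \<Rightarrow> (nat \<Rightarrow> cvec set) \<Rightarrow> nat \<Rightarrow> cvec set" where
  "NP n N d = {p \<in> car (sp (Prep n) d). \<exists>i\<in>car (sp (Irep n) d). p + i \<in> N d}"

lemma span_ell:
  assumes "finite K"
  shows "cfun.span (ell ` K) = {x. \<forall>k. k \<notin> K \<longrightarrow> x k = 0}"
proof
  have "cfun.subspace {x :: cvec. \<forall>k. k \<notin> K \<longrightarrow> x k = 0}"
    by (auto simp: cfun.subspace_def fscale_def)
  then show "cfun.span (ell ` K) \<subseteq> {x. \<forall>k. k \<notin> K \<longrightarrow> x k = 0}"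
    by (intro cfun.span_minimal) (auto simp: ell_def)
next
  show "{x. \<forall>k. k \<notin> K \<longrightarrow> x k = 0} \<subseteq> cfun.span (ell ` K)"
  proof
    fix x :: cvec assume x: "x \<in> {x. \<forall>k. k \<notin> K \<longrightarrow> x k = 0}"
    have s: "(\<Sum>k\<in>F. fscale (x k) (ell k)) j = (\<Sum>k\<in>F. if j = k then x k else 0)"
      if "finite F" for F j
      using that by (induction F rule: finite_induct) (auto simp: fscale_def ell_def)
    have "x = (\<Sum>k\<in>K. fscale (x k) (ell k))"
    proof
      fix j show "x j = (\<Sum>k\<in>K. fscale (x k) (ell k)) j"
        unfolding s[OF assms] using x assms by simp
    qed
    also have "\<dots> \<in> cfun.span (ell ` K)"
      by (intro cfun.span_sum cfun.span_scale cfun.span_base) auto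
    finally show "x \<in> cfun.span (ell ` K)" .
  qed
qed

lemma inj_ell: "inj ell"
  by (auto simp: inj_def ell_def fun_eq_iff split: if_splits)

lemma independent_ell:
  assumes "finite K"
  shows "cfun.independent (ell ` K)"
  unfolding cfun.dependent_def
proof (rule notI, elim bexE)
  fix a assume a: "a \<in> ell ` K" "a \<in> cfun.span (ell ` K - {a})"
  then obtain k where k: "k \<in> K" "a = ell k" by blast
  have "ell ` K - {a} = ell ` (K - {k})"
    using k inj_ell by (auto simp: inj_def)
  then have "ell k \<in> {x. \<forall>j. j \<notin> K - {k} \<longrightarrow> x j = 0}"
    using a k assms span_ell[of "K - {k}"] by simp
  then have "ell k k = 0" by blast
  then show False by (simp add: ell_def)
qed

lemma car_Prep: "d \<in> {1..n-1} \<Longrightarrow> car (sp (Prep n) d) = Lminus d"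
  by (auto simp: Prep_def dsum_def fspace_def Mrep_def Lminus_def span_ell)

lemma car_Irep:
  assumes "d \<in> {1..n-1}"
  shows "car (sp (Irep n) d) = Lplus n d"
proof -
  have *: "Suc ` {1..n-1} = {2..n}"
    using assms by (auto simp: image_Suc_atLeastAtMost)
  have "x \<in> car (sp (Irep n) d) \<longleftrightarrow> x \<in> Lplus n d" for x
  proof -
    have "x \<in> car (sp (Irep n) d) \<longleftrightarrow>
        (\<forall>k\<in>{2..n}. \<not> d \<le> k - 1 \<longrightarrow> x k = 0) \<and> (\<forall>k. k \<notin> {2..n} \<longrightarrow> x k = 0)"
      unfolding Irep_def * using assms by (auto simp: dsum_def fspace_def Mrep_def)
    also have "\<dots> \<longleftrightarrow> (\<forall>k. k \<notin> {d+1..n} \<longrightarrow> x k = 0)"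
    proof -
      have "k \<notin> {d+1..n} \<longleftrightarrow> k \<in> {2..n} \<and> \<not> d \<le> k - 1 \<or> k \<notin> {2..n}" for k
        using assms by auto
      then show ?thesis by blast
    qed
    also have "\<dots> \<longleftrightarrow> x \<in> Lplus n d" by (simp add: Lplus_def span_ell)
    finally show ?thesis .
  qed
  then show ?thesis by blast
qed

lemma P_Int_I:
  assumes "d \<in> {1..n-1}"
  shows "car (sp (Prep n) d) \<inter> car (sp (Irep n) d) = {0}"
proof
  show "car (sp (Prep n) d) \<inter> car (sp (Irep n) d) \<subseteq> {0}"
  proof
    fix x assume "x \<in> car (sp (Prep n) d) \<inter> car (sp (Irep n) d)"
    then have x: "\<And>k. k \<notin> {1..d} \<Longrightarrow> x k = 0" "\<And>k. k \<notin> {d+1..n} \<Longrightarrow> x k = 0"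
      using assms by (simp_all add: car_Prep car_Irep Lminus_def Lplus_def span_ell)
    have "x k = 0" for k
      using x[of k] by (cases "k \<le> d") auto
    then show "x \<in> {0}" by (auto simp: fun_eq_iff)
  qed
  show "{0} \<subseteq> car (sp (Prep n) d) \<inter> car (sp (Irep n) d)"
    using assms by (simp add: car_Prep car_Irep Lminus_def Lplus_def span_ell)
qed

lemma arr_PIrep:
  assumes "d \<in> {1..n-2}" "p \<in> car (sp (Prep n) d)" "i \<in> car (sp (Irep n) d)"
  shows "arr (PIrep n) d (p + i) = arr (Prep n) d p + arr (Irep n) d i"
    and "arr (Prep n) d p \<in> car (sp (Prep n) (d+1))"
    and "arr (Irep n) d i \<in> car (sp (Irep n) (d+1))"
proof -
  have d: "d \<in> {1..n-1}" "d + 1 \<in> {1..n-1}" using assms(1) by auto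
  have *: "Suc ` {1..n-1} = {2..n}"
    using d by (auto simp: image_Suc_atLeastAtMost)
  have p: "p k = 0" if "k \<notin> {1..d}" for k
    using assms(2) d that by (auto simp: car_Prep Lminus_def span_ell)
  have i: "i k = 0" if "k \<notin> {d+1..n}" for k
    using assms(3) d that by (auto simp: car_Irep Lplus_def span_ell)
  have ap: "arr (Prep n) d p = p"
    using p d by (auto simp: Prep_def dsum_def Mrep_def fun_eq_iff)
  have ai: "arr (Irep n) d i = i(d+1 := 0)"
    unfolding Irep_def * using i d by (auto simp: dsum_def Mrep_def fun_eq_iff)
  show "arr (PIrep n) d (p + i) = arr (Prep n) d p + arr (Irep n) d i"
    unfolding ap ai using p by (auto simp: PIrep_def pr_def fun_eq_iff)
  show "arr (Prep n) d p \<in> car (sp (Prep n) (d+1))"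
    unfolding ap using p d by (auto simp: car_Prep Lminus_def span_ell)
  show "arr (Irep n) d i \<in> car (sp (Irep n) (d+1))"
    unfolding ai using i d by (auto simp: car_Irep Lplus_def span_ell)
qed

lemma car_PIrep:
  assumes "d \<in> {1..n-1}"
  shows "car (sp (PIrep n) d) = L n"
proof
  show "car (sp (PIrep n) d) \<subseteq> L n"
    using assms
    by (auto simp: PIrep_def fspace_def car_Prep car_Irep Lminus_def Lplus_def L_def span_ell)
  show "L n \<subseteq> car (sp (PIrep n) d)"
  proof
    fix x assume x: "x \<in> L n"
    let ?p = "\<lambda>k. if k \<in> {1..d} then x k else 0"
    let ?i = "\<lambda>k. if k \<in> {d+1..n} then x k else 0"
    have "x = ?p + ?i"
      using x assms by (auto simp: L_def span_ell fun_eq_iff)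
    moreover have "?p \<in> car (sp (Prep n) d)" "?i \<in> car (sp (Irep n) d)"
      using assms by (auto simp: car_Prep car_Irep Lminus_def Lplus_def span_ell)
    ultimately show "x \<in> car (sp (PIrep n) d)"
      unfolding PIrep_def fspace_def by auto
  qed
qed

lemma dim_Prep:
  assumes "d \<in> {1..n-1}"
  shows "cfun.dim (car (sp (Prep n) d)) = d"
proof -
  have "cfun.dim (Lminus d) = card (ell ` {1..d})"
    unfolding Lminus_def by (rule cfun.dim_span_eq_card_independent[OF independent_ell]) simp
  also have "\<dots> = d"
    by (simp add: card_image inj_on_subset[OF inj_ell])
  finally show ?thesis using assms by (simp add: car_Prep)
qed

theorem flag_variety_eq_quiver_Gr:
  "flag_variety n = quiver_Gr (n-1) (\<lambda>d. cfun.dim (car (sp (Prep n) d))) (PIrep n)"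
proof -
  have "(\<Pi>\<^sub>E d\<in>{1..n-1}. Gr n d) =
      {N \<in> extensional {1..n-1}. \<forall>d\<in>{1..n-1}. cfun.subspace (N d) \<and>
         N d \<subseteq> car (sp (PIrep n) d) \<and> cfun.dim (N d) = cfun.dim (car (sp (Prep n) d))}"
    by (rule set_eqI) (simp add: PiE_def Pi_def Gr_def car_PIrep dim_Prep conj_commute Ball_def)
  moreover have "arr (PIrep n) d = pr (d+1)" for d by (simp add: PIrep_def)
  moreover have "n - 1 - 1 = n - 2" by simp
  ultimately show ?thesis
    unfolding flag_variety_def quiver_Gr_def by (simp only: mem_Collect_eq conj_assoc)
qed

end

theory Submission
  imports Defs
begin

text \<open>
  A strictly lower triangular matrix \<open>f\<close> is the same as a homomorphism \<open>P \<rightarrow> I\<close>, given at vertex \<open>d\<close> by the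
  block \<open>f\<^sub>d\<close>, and \<open>iota n f\<close> is its graph. The points of the graph closure over a flag \<open>U\<close> outside the
  open cell turn out to be the pairs \<open>([h], U)\<close> where \<open>h\<close> is a nonzero homomorphism \<open>P \<rightarrow> I\<close> with
  \<open>h(N_P) = 0\<close> and \<open>h(P) \<subseteq> N_I\<close> (\<open>phi_fiber_eq\<close>). These are the nonzero homomorphisms \<open>P/N_P \<rightarrow> N_I\<close>, and the
  resulting bijection is a linear isomorphism on homogeneous coordinates, hence an isomorphism of
  varieties (\<open>fiber_isomorphic\<close>).

  Necessity of the conditions. For a point \<open>([c v + h], U)\<close> of the graph, every \<open>u \<in> U\<^sub>d\<close> with components
  \<open>u\<^sub>- \<in> L\<^sub>d\<^sup>-\<close> and \<open>u\<^sub>+ \<in> L\<^sub>d\<^sup>+\<close> satisfies \<open>c u\<^sub>+ = h\<^sub>d u\<^sub>-\<close>, and \<open>c x + h\<^sub>d x \<in> U\<^sub>d\<close> for every \<open>x \<in> L\<^sub>d\<^sup>-\<close>. Both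
  conditions are closed (\<open>graph_closure_kernel\<close>, \<open>graph_closure_image\<close>). If \<open>c \<noteq> 0\<close>, the second one forces
  \<open>U = iota n (h/c)\<close>; if \<open>c = 0\<close>, they say \<open>h(N_P) = 0\<close> and \<open>h(P) \<subseteq> N_I\<close>.

  Sufficiency. Given subrepresentations \<open>K \<subseteq> P\<close> and \<open>J \<subseteq> I\<close> with \<open>dim K + dim J = dim P\<close>, the partial graph
  of \<open>f\<close> over \<open>(K, J)\<close> is \<open>{x + f x + y | x \<in> K, y \<in> J}\<close>. If \<open>h\<close> induces a homomorphism \<open>K \<rightarrow> I/J\<close> with kernel \<open>K'\<close>
  and if \<open>J' = J + h(K)\<close>, then the partial graph of \<open>f\<close> over \<open>(K', J')\<close> is the limit for \<open>s \<rightarrow> 0\<close> of the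
  partial graphs of \<open>f + h/s\<close> over \<open>(K, J)\<close> (\<open>partial_graph_approach\<close>). Apply this to \<open>(P, 0)\<close> and the
  given \<open>h\<close>: since \<open>[v + f + h/s]\<close> tends to \<open>[h]\<close>, the pair of \<open>[h]\<close> and any partial graph over
  \<open>(ker h, im h)\<close> lies in the closure. It remains to degenerate these partial graphs to \<open>U\<close> while \<open>[h]\<close> stays
  fixed (\<open>partial_graphs_dense\<close>). Suppose \<open>J \<subseteq> U \<subseteq> K \<oplus> I\<close>. The representations \<open>K/N_P\<close> and \<open>N_I/J\<close> have the same
  dimension vector \<open>r\<close>. If \<open>r \<noteq> 0\<close>, there is a nonzero homomorphism between them, because it is subject to
  \<open>\<Sum> r\<^sub>d r\<^sub>d\<^sub>+\<^sub>1\<close> linear equations in \<open>\<Sum> r\<^sub>d\<^sup>2\<close> unknowns and the Euler form of the quiver is positive definite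
  (\<open>nonzero_hom\<close>); it lifts to \<open>P \<rightarrow> I\<close>, and its kernel and image give a pair with smaller \<open>K\<close>. If \<open>r = 0\<close>,
  then \<open>U\<close> is a partial graph over \<open>(K, J)\<close>. Both the lift and the last claim come from \<open>exists_section\<close>:
  since \<open>N_P\<close> is projective and \<open>I\<close> is injective, every subrepresentation \<open>U\<close> of \<open>P \<oplus> I\<close> contains the graph over
  \<open>N_P\<close> of some homomorphism \<open>P \<rightarrow> I\<close>.
\<close>

section \<open>Linear algebra in spaces of functions\<close>

global_interpretation cpair: vector_space_pair
  "fscale :: complex \<Rightarrow> ('i \<Rightarrow> complex) \<Rightarrow> 'i \<Rightarrow> complex"
  "fscale :: complex \<Rightarrow> ('j \<Rightarrow> complex) \<Rightarrow> 'j \<Rightarrow> complex"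
  by unfold_locales

abbreviation lin :: "(('i \<Rightarrow> complex) \<Rightarrow> 'j \<Rightarrow> complex) \<Rightarrow> bool" where
  "lin \<equiv> Vector_Spaces.linear fscale fscale"

lemma linI:
  assumes "\<And>x y. F (x + y) = F x + F y" "\<And>c x. F (fscale c x) = fscale c (F x)"
  shows "lin F"
  using assms by (simp add: Vector_Spaces.linear_iff cfun.vector_space_axioms)

lemma lin_add: "lin F \<Longrightarrow> F (x + y) = F x + F y"
  and lin_scale: "lin F \<Longrightarrow> F (fscale c x) = fscale c (F x)"
  by (simp_all add: Vector_Spaces.linear_iff)

lemma lin_0: "lin F \<Longrightarrow> F 0 = 0"
  by (rule cpair.linear_0)

lemma lin_diff: "lin F \<Longrightarrow> F (x - y) = F x - F y"
  by (rule cpair.linear_diff)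

lemma fscale_apply: "fscale c x i = c * x i"
  by (simp add: fscale_def)

definition finite_dim :: "('i \<Rightarrow> complex) set \<Rightarrow> bool" where
  "finite_dim S \<longleftrightarrow> (\<exists>B. finite B \<and> S \<subseteq> cfun.span B)"

lemma finite_dim_subset: "finite_dim T \<Longrightarrow> S \<subseteq> T \<Longrightarrow> finite_dim S"
  unfolding finite_dim_def by blast

lemma finite_dim_basis_extend:
  assumes "finite_dim S" "cfun.subspace S" "A \<subseteq> S" "cfun.independent A"
  obtains B where "A \<subseteq> B" "finite B" "cfun.independent B" "cfun.span B = S" "card B = cfun.dim S"
proof -
  obtain B where B: "A \<subseteq> B" "B \<subseteq> S" "cfun.independent B" "S \<subseteq> cfun.span B"
    using cfun.maximal_independent_subset_extend[OF assms(3,4)] by blast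
  obtain C where C: "finite C" "S \<subseteq> cfun.span C" using assms(1) unfolding finite_dim_def by blast
  have "finite B" using cfun.independent_span_bound[OF C(1) B(3)] B(2) C(2) by blast
  moreover have "cfun.span B = S" using B assms(2) by (intro cfun.span_subspace) auto
  moreover have "card B = cfun.dim S" using B by (intro cfun.basis_card_eq_dim) auto
  ultimately show ?thesis using that B by blast
qed

lemma finite_dim_basis:
  assumes "finite_dim S" "cfun.subspace S"
  obtains B where "finite B" "cfun.independent B" "cfun.span B = S" "card B = cfun.dim S"
  using finite_dim_basis_extend[OF assms, of "{}"] by (auto simp: cfun.independent_empty)

lemma dim_mono_finite_dim:
  assumes "finite_dim T" "cfun.subspace S" "cfun.subspace T" "S \<subseteq> T"
  shows "cfun.dim S \<le> cfun.dim T"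
proof -
  obtain A where A: "finite A" "cfun.independent A" "cfun.span A = S" "card A = cfun.dim S"
    using finite_dim_basis[OF finite_dim_subset[OF assms(1,4)] assms(2)] .
  have "A \<subseteq> T" using A assms(4) cfun.span_superset by blast
  then obtain B where "A \<subseteq> B" "finite B" "card B = cfun.dim T"
    using finite_dim_basis_extend[OF assms(1,3) _ A(2)] by blast
  then show ?thesis using A card_mono by metis
qed

lemma subspace_dim_eq:
  assumes "finite_dim T" "cfun.subspace S" "cfun.subspace T" "S \<subseteq> T" "cfun.dim S = cfun.dim T"
  shows "S = T"
proof -
  obtain A where A: "finite A" "cfun.independent A" "cfun.span A = S" "card A = cfun.dim S"
    using finite_dim_basis[OF finite_dim_subset[OF assms(1,4)] assms(2)] .
  have "A \<subseteq> T" using A assms(4) cfun.span_superset by blast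
  then obtain B where B: "A \<subseteq> B" "finite B" "card B = cfun.dim T" "cfun.span B = T"
    using finite_dim_basis_extend[OF assms(1,3) _ A(2)] by blast
  then have "A = B" using A assms(5) by (intro card_subset_eq) auto
  then show ?thesis using A B by simp
qed

lemma subspace_kernel_on:
  assumes "lin F" "cfun.subspace S"
  shows "cfun.subspace {x \<in> S. F x = 0}"
  using assms(2) lin_add[OF assms(1)] lin_scale[OF assms(1)] lin_0[OF assms(1)]
  by (auto simp: cfun.subspace_def)

lemma subspace_image: "lin F \<Longrightarrow> cfun.subspace S \<Longrightarrow> cfun.subspace (F ` S)"
  by (rule cpair.linear_subspace_image)

lemma rank_nullity:
  assumes "lin F" "cfun.subspace S" "finite_dim S"
  shows "cfun.dim S = cfun.dim {x \<in> S. F x = 0} + cfun.dim (F ` S)"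
proof -
  let ?K = "{x \<in> S. F x = 0}"
  have K: "cfun.subspace ?K" "?K \<subseteq> S" using subspace_kernel_on[OF assms(1,2)] by auto
  obtain A where A: "finite A" "cfun.independent A" "cfun.span A = ?K" "card A = cfun.dim ?K"
    using finite_dim_basis[OF finite_dim_subset[OF assms(3) K(2)] K(1)] .
  have AS: "A \<subseteq> S" using A(3) K(2) cfun.span_superset by blast
  obtain B where B: "A \<subseteq> B" "finite B" "cfun.independent B" "cfun.span B = S" "card B = cfun.dim S"
    using finite_dim_basis_extend[OF assms(3,2) AS A(2)] .
  let ?C = "B - A"
  \<comment> \<open>\<open>F\<close> is injective on the complement spanned by \<open>?C\<close>, since \<open>A\<close> spans the kernel.\<close>
  have 0: "x = 0" if x: "x \<in> cfun.span ?C" "F x = 0" for x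
  proof -
    have "x \<in> S" using x B cfun.span_mono[of ?C B] by blast
    then have "x \<in> cfun.span A" using x A by simp
    moreover have "cfun.span A \<inter> cfun.span ?C = {0}"
    proof -
      have "cfun.span (A \<inter> ?C) = cfun.span A \<inter> cfun.span ?C"
      proof
        show "cfun.span A \<inter> cfun.span ?C \<subseteq> cfun.span (A \<inter> ?C)"
        proof
          fix y assume y: "y \<in> cfun.span A \<inter> cfun.span ?C"
          have fC: "finite ?C" using B by simp
          obtain u where u: "y = (\<Sum>a\<in>A. fscale (u a) a)"
            using y cfun.span_finite[OF A(1)] by auto
          obtain v where v: "y = (\<Sum>a\<in>?C. fscale (v a) a)"
            using y cfun.span_finite[OF fC] by auto
          let ?w = "\<lambda>a. if a \<in> A then u a else - v a"
          have "(\<Sum>a\<in>B. fscale (?w a) a) = (\<Sum>a\<in>A. fscale (?w a) a) + (\<Sum>a\<in>?C. fscale (?w a) a)"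
            using B by (metis (no_types, lifting) add.commute sum.subset_diff)
          also have "(\<Sum>a\<in>A. fscale (?w a) a) = y" using u by (simp cong: sum.cong)
          also have "(\<Sum>a\<in>?C. fscale (?w a) a) = - y"
          proof -
            have "(\<Sum>a\<in>?C. fscale (?w a) a) = (\<Sum>a\<in>?C. - fscale (v a) a)"
              by (intro sum.cong) auto
            then show ?thesis using v by (simp add: sum_negf)
          qed
          finally have s: "(\<Sum>a\<in>B. fscale (?w a) a) = 0" by (simp only: add.right_inverse)
          have "u a = 0" if "a \<in> A" for a
          proof -
            have "?w a = 0"
              by (rule cfun.independentD[OF B(3) B(2) order_refl s]) (use that B(1) in blast)
            then show ?thesis using that by simp
          qed
          then have "y = 0" using u by simp
          then show "y \<in> cfun.span (A \<inter> ?C)" by (simp add: cfun.span_zero)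
        qed
      qed (use cfun.span_mono[of "A \<inter> ?C"] in blast)
      then show ?thesis by simp
    qed
    ultimately show "x = 0" using x by blast
  qed
  have inj: "inj_on F (cfun.span ?C)"
  proof (rule inj_onI)
    fix x y assume xy: "x \<in> cfun.span ?C" "y \<in> cfun.span ?C" "F x = F y"
    then have "F (x - y) = 0" by (simp add: lin_diff[OF assms(1)])
    then have "x - y = 0" by (rule 0[OF cfun.span_diff[OF xy(1,2)]])
    then show "x = y" by simp
  qed
  have ind: "cfun.independent (F ` ?C)"
    by (rule cpair.linear_independent_injective_image[OF assms(1) _ inj])
       (use B cfun.independent_mono in blast)
  have "F ` S = cfun.span (F ` B)"
    using cpair.linear_span_image[OF assms(1), of B] B by simp
  also have "\<dots> = cfun.span (F ` ?C)"
  proof -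
    have "F ` A \<subseteq> {0}" using A cfun.span_superset[of A] by auto
    then have "F ` B \<subseteq> insert 0 (F ` ?C)" by auto
    then have "cfun.span (F ` B) \<subseteq> cfun.span (F ` ?C)"
      using cfun.span_mono[of "F ` B" "insert 0 (F ` ?C)"] by simp
    moreover have "cfun.span (F ` ?C) \<subseteq> cfun.span (F ` B)" by (intro cfun.span_mono) blast
    ultimately show ?thesis by blast
  qed
  finally have "cfun.dim (F ` S) = card (F ` ?C)"
    using cfun.dim_span_eq_card_independent[OF ind] by simp
  also have "\<dots> = card ?C"
    using inj cfun.span_superset[of ?C] by (intro card_image) (rule inj_on_subset)
  also have "\<dots> = cfun.dim S - cfun.dim ?K" using A B by (simp add: card_Diff_subset)
  finally show ?thesis using card_mono[OF B(2,1)] A(4) B(5) by simp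
qed

text \<open>Every subspace has a complement: extend a basis of \<open>J\<close> to the whole space and subtract the
  complementary component.\<close>

lemma exists_projection:
  fixes J :: "('i \<Rightarrow> complex) set"
  assumes "cfun.subspace J"
  obtains \<pi> :: "('i \<Rightarrow> complex) \<Rightarrow> 'i \<Rightarrow> complex"
    where "lin \<pi>" "\<And>x. \<pi> x \<in> J" "\<And>x. x \<in> J \<Longrightarrow> \<pi> x = x"
proof -
  obtain A where A: "A \<subseteq> J" "cfun.independent A" "J \<subseteq> cfun.span A"
    using cfun.maximal_independent_subset[of J] by blast
  obtain B where B: "A \<subseteq> B" "B \<subseteq> UNIV" "cfun.independent B" "UNIV \<subseteq> cfun.span B"
    using cfun.maximal_independent_subset_extend[OF subset_UNIV A(2)] .
  obtain F where F: "lin F" "\<forall>x\<in>B. F x = (if x \<in> A then 0 else x)"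
    using cpair.linear_independent_extend[OF B(3), of "\<lambda>x. if x \<in> A then 0 else x"] by blast
  have FA: "F x = 0" if "x \<in> J" for x
    by (rule cpair.linear_eq_0_on_span[OF F(1), of A]) (use F(2) A B that in auto)
  have l: "lin (\<lambda>x. x - F x)"
    by (rule linI) (simp_all only: lin_add[OF F(1)] lin_scale[OF F(1)] cfun.scale_right_diff_distrib
        add_diff_add)
  then have "cfun.subspace {x. x - F x \<in> J}"
    using cpair.linear_subspace_vimage[of "\<lambda>x. x - F x" J] assms by (simp add: vimage_def)
  moreover have "B \<subseteq> {x. x - F x \<in> J}"
    using F(2) A(1) cfun.subspace_0[OF assms] by auto
  ultimately have d: "x - F x \<in> J" for x
    using cfun.span_minimal[of B "{x. x - F x \<in> J}"] B(4) by blast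
  show ?thesis by (rule that[OF l d]) (simp add: FA)
qed

lemma exists_linear_with_kernel:
  fixes J :: "('i \<Rightarrow> complex) set"
  assumes "cfun.subspace J"
  shows "\<exists>F :: ('i \<Rightarrow> complex) \<Rightarrow> 'i \<Rightarrow> complex. lin F \<and> (\<forall>x. F x = 0 \<longleftrightarrow> x \<in> J)"
proof -
  obtain \<pi> :: "('i \<Rightarrow> complex) \<Rightarrow> 'i \<Rightarrow> complex"
    where \<pi>: "lin \<pi>" "\<And>x. \<pi> x \<in> J" "\<And>x. x \<in> J \<Longrightarrow> \<pi> x = x"
    using exists_projection[OF assms] by blast
  have "lin (\<lambda>x. x - \<pi> x)"
    by (rule linI) (simp_all only: lin_add[OF \<pi>(1)] lin_scale[OF \<pi>(1)]
        cfun.scale_right_diff_distrib add_diff_add)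
  moreover have "x - \<pi> x = 0 \<longleftrightarrow> x \<in> J" for x using \<pi>(2)[of x] \<pi>(3)[of x] by auto
  ultimately show ?thesis by blast
qed

text \<open>Coordinates on the quotient \<open>K/M\<close>, expressed by linear maps on the surrounding space so that no
  quotient has to be formed: \<open>\<beta>\<close> reads off the coordinates of a class with respect to a basis of \<open>K/M\<close>,
  and \<open>\<rho>\<close> returns a representative. They come from extending a basis of \<open>M\<close> to one of \<open>K\<close>.\<close>

lemma quotient_coordinates:
  fixes K M :: "cvec set"
  assumes "cfun.subspace M" "cfun.subspace K" "M \<subseteq> K" "finite_dim K"
  obtains \<beta> \<rho> :: "cvec \<Rightarrow> cvec" where "lin \<beta>" "lin \<rho>" "\<And>x. x \<in> M \<Longrightarrow> \<beta> x = 0"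
    "\<And>x. x \<in> K \<Longrightarrow> x - \<rho> (\<beta> x) \<in> M" "\<And>w. \<rho> w \<in> K"
    "\<And>k. k < cfun.dim K - cfun.dim M \<Longrightarrow> \<beta> (\<rho> (ell k)) = ell k"
    "\<And>x i. i \<ge> cfun.dim K - cfun.dim M \<Longrightarrow> \<beta> x i = 0"
proof -
  let ?r = "cfun.dim K - cfun.dim M"
  obtain A where A: "finite A" "cfun.independent A" "cfun.span A = M" "card A = cfun.dim M"
    using finite_dim_basis[OF finite_dim_subset[OF assms(4,3)] assms(1)] .
  have AK: "A \<subseteq> K" using A(3) assms(3) cfun.span_superset by blast
  obtain B where B: "A \<subseteq> B" "finite B" "cfun.independent B" "cfun.span B = K" "card B = cfun.dim K"
    using finite_dim_basis_extend[OF assms(4,2) AK A(2)] .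
  have c: "card (B - A) = ?r" using A B by (simp add: card_Diff_subset)
  then obtain b where b: "bij_betw b {..<?r} (B - A)"
    using B(2) by (metis finite_Diff ex_bij_betw_nat_finite atLeast0LessThan)
  let ?i = "inv_into {..<?r} b"
  have bi: "?i (b k) = k" if "k < ?r" for k
    using that b by (simp add: bij_betw_def inv_into_f_f)
  have ib: "?i x < ?r" "b (?i x) = x" if "x \<in> B - A" for x
    using that b inv_into_into[of x b "{..<?r}"] f_inv_into_f[of x b "{..<?r}"]
    by (auto simp: bij_betw_def)
  obtain \<beta> where \<beta>: "lin \<beta>" "\<forall>x\<in>B. \<beta> x = (if x \<in> A then 0 else ell (?i x))"
     "range \<beta> = cfun.span ((\<lambda>x. if x \<in> A then 0 else ell (?i x)) ` B)"
    using cpair.linear_independent_extend_subspace[OF B(3), of "\<lambda>x. if x \<in> A then 0 else ell (?i x)"]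
    by blast
  define \<rho> where "\<rho> = (\<lambda>w :: cvec. \<Sum>k<?r. fscale (w k) (b k))"
  have \<rho>: "lin \<rho>" unfolding \<rho>_def
    by (rule linI) (simp_all add: sum.distrib cfun.scale_left_distrib cfun.scale_sum_right fscale_apply)
  have \<rho>e: "\<rho> (ell k) = b k" if "k < ?r" for k
  proof -
    have "\<rho> (ell k) = (\<Sum>j<?r. if j = k then b k else 0)"
      unfolding \<rho>_def by (intro sum.cong) (auto simp: ell_def)
    then show ?thesis using that by simp
  qed
  have bB: "b k \<in> B - A" if "k < ?r" for k using b that by (auto simp: bij_betw_def)
  show ?thesis
  proof (rule that[OF \<beta>(1) \<rho>])
    show "\<beta> x = 0" if "x \<in> M" for x
      by (rule cpair.linear_eq_0_on_span[OF \<beta>(1), of A]) (use \<beta>(2) A B that in auto)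
    show "\<rho> w \<in> K" for w unfolding \<rho>_def
      using bB B by (intro cfun.subspace_sum cfun.subspace_scale assms)
        (metis DiffD1 cfun.span_base lessThan_iff)
    show "\<beta> (\<rho> (ell k)) = ell k" if "k < ?r" for k
      using \<rho>e[OF that] bB[OF that] \<beta>(2) bi[OF that] by simp
    show "\<beta> x i = 0" if "i \<ge> ?r" for x i
    proof -
      have "cfun.span ((\<lambda>x. if x \<in> A then 0 else ell (?i x)) ` B) \<subseteq> {w. w i = 0}"
      proof (rule cfun.span_minimal)
        show "(\<lambda>x. if x \<in> A then 0 else ell (?i x)) ` B \<subseteq> {w. w i = 0}"
        proof (rule image_subsetI)
          fix x assume "x \<in> B"
          then have "x \<notin> A \<Longrightarrow> ?i x < i" using ib[of x] that by simp
          then show "(if x \<in> A then 0 else ell (?i x)) \<in> {w. w i = 0}"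
            by (auto simp: ell_def)
        qed
      qed (auto simp: cfun.subspace_def fscale_apply)
      moreover have "\<beta> x \<in> range \<beta>" by simp
      ultimately show ?thesis unfolding \<beta>(3) by blast
    qed
    have "lin (\<lambda>x. x - \<rho> (\<beta> x))"
      by (rule linI) (simp_all only: lin_add[OF \<beta>(1)] lin_scale[OF \<beta>(1)] lin_add[OF \<rho>]
          lin_scale[OF \<rho>] cfun.scale_right_diff_distrib add_diff_add)
    then have sub: "cfun.subspace {x. x - \<rho> (\<beta> x) \<in> M}"
      using cpair.linear_subspace_vimage[of "\<lambda>x. x - \<rho> (\<beta> x)" M] assms(1) by (simp add: vimage_def)
    have "x - \<rho> (\<beta> x) \<in> M" if "x \<in> B" for x
    proof (cases "x \<in> A")
      case True
      then have "x \<in> M" "\<rho> (\<beta> x) = 0" using \<beta>(2) that A(3) cfun.span_base lin_0[OF \<rho>] by auto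
      then show ?thesis by simp
    next
      case False
      then have "\<rho> (\<beta> x) = x" using that \<beta>(2) ib[of x] \<rho>e by simp
      then show ?thesis using cfun.subspace_0[OF assms(1)] by simp
    qed
    then show "x - \<rho> (\<beta> x) \<in> M" if "x \<in> K" for x
      using cfun.span_minimal[OF _ sub, of B] B(4) that by blast
  qed
qed

definition funs_on :: "'i set \<Rightarrow> ('i \<Rightarrow> complex) set" where
  "funs_on A = {x. \<forall>i. i \<notin> A \<longrightarrow> x i = 0}"

lemma subspace_funs_on: "cfun.subspace (funs_on A)"
  by (auto simp: cfun.subspace_def funs_on_def fscale_apply)

lemma funs_on_dim:
  assumes "finite (A :: 'i set)"
  shows "finite_dim (funs_on A)" "cfun.dim (funs_on A) = card A"
proof -
  let ?e = "\<lambda>a i. if i = a then 1 else 0 :: complex"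
  have ev: "(\<Sum>a\<in>A. fscale (x a) (?e a)) i = (if i \<in> A then x i else 0)" for x i
  proof -
    have "(\<Sum>a\<in>A. fscale (x a) (?e a)) i = (\<Sum>a\<in>A. (if i = a then x i else 0))"
      using assms by (induction A rule: finite_induct) (auto simp: fscale_apply)
    then show ?thesis using assms by simp
  qed
  have inj: "inj ?e" by (auto simp: inj_def fun_eq_iff split: if_splits)
  have sp: "cfun.span (?e ` A) = funs_on A"
  proof
    show "cfun.span (?e ` A) \<subseteq> funs_on A"
      by (intro cfun.span_minimal subspace_funs_on) (auto simp: funs_on_def)
    show "funs_on A \<subseteq> cfun.span (?e ` A)"
    proof
      fix x assume "x \<in> funs_on A"
      then have "x = (\<Sum>a\<in>A. fscale (x a) (?e a))"
        by (intro ext) (simp only: ev, auto simp: funs_on_def)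
      also have "\<dots> \<in> cfun.span (?e ` A)"
        by (intro cfun.span_sum cfun.span_scale cfun.span_base) auto
      finally show "x \<in> cfun.span (?e ` A)" .
    qed
  qed
  have ind: "cfun.independent (?e ` A)"
  proof (rule cfun.independent_if_scalars_zero)
    show "finite (?e ` A)" using assms by simp
    fix u v assume s: "(\<Sum>x\<in>?e ` A. fscale (u x) x) = 0" and v: "v \<in> ?e ` A"
    then obtain a where a: "a \<in> A" "v = ?e a" by blast
    have "(\<Sum>x\<in>?e ` A. fscale (u x) x) = (\<Sum>a\<in>A. fscale (u (?e a)) (?e a))"
      by (subst sum.reindex) (auto intro: inj_on_subset[OF inj])
    then have "(\<Sum>a\<in>A. fscale (u (?e a)) (?e a)) a = 0" using s by simp
    then show "u v = 0" using ev[of "\<lambda>a. u (?e a)" a] a by simp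
  qed
  show "finite_dim (funs_on A)" unfolding finite_dim_def using sp assms by blast
  show "cfun.dim (funs_on A) = card A"
    using cfun.dim_span_eq_card_independent[OF ind] sp card_image[OF inj_on_subset[OF inj, of A]]
    by simp
qed

text \<open>More unknowns than equations: the unknowns are indexed by \<open>A\<close>, the equations by \<open>B\<close>, and rank and
  nullity leave no room for \<open>F\<close> to be injective.\<close>

lemma underdetermined_system:
  fixes F :: "('a \<Rightarrow> complex) \<Rightarrow> 'b \<Rightarrow> complex"
  assumes F: "lin F" and fin: "finite A" "finite B" and less: "card B < card A"
  obtains z where "z \<in> funs_on A" "z \<noteq> 0" "\<And>b. b \<in> B \<Longrightarrow> F z b = 0"
proof -
  let ?F = "\<lambda>z b. if b \<in> B then F z b else 0"
  have lF: "lin ?F" by (rule linI) (auto simp: fun_eq_iff lin_add[OF F] lin_scale[OF F] fscale_apply)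
  have "?F ` funs_on A \<subseteq> funs_on B" by (auto simp: funs_on_def)
  then have "cfun.dim (?F ` funs_on A) \<le> card B"
    using dim_mono_finite_dim[of "funs_on B" "?F ` funs_on A"] funs_on_dim[OF fin(2)] subspace_funs_on
      subspace_image[OF lF subspace_funs_on] by metis
  then have "cfun.dim {z \<in> funs_on A. ?F z = 0} \<noteq> 0"
    using rank_nullity[OF lF subspace_funs_on, of A] funs_on_dim[OF fin(1)] less by simp
  then have "{z \<in> funs_on A. ?F z = 0} \<noteq> {0}"
    by (metis cfun.dim_span_eq_card_independent cfun.independent_empty cfun.span_empty card.empty)
  moreover have "0 \<in> {z \<in> funs_on A. ?F z = 0}"
    using lin_0[OF lF] subspace_funs_on[of A] cfun.subspace_0 by blast
  ultimately obtain z where "z \<in> funs_on A" "?F z = 0" "z \<noteq> 0" by blast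
  moreover have "F z b = 0" if "b \<in> B" for b
    using fun_cong[OF \<open>?F z = 0\<close>, of b] that by simp
  ultimately show ?thesis by (intro that[of z])
qed

section \<open>Linear independence is a Zariski open condition\<close>

text \<open>Independence of the family \<open>Y 0, \<dots>, Y (k-1)\<close>, phrased through coordinates so that it can be followed
  along polynomial families of vectors.\<close>

definition indep_fam :: "nat \<Rightarrow> (nat \<Rightarrow> cvec) \<Rightarrow> bool" where
  "indep_fam k Y \<longleftrightarrow> (\<forall>u. (\<forall>i. (\<Sum>a<k. u a * Y a i) = 0) \<longrightarrow> (\<forall>a<k. u a = 0))"

lemma polyfun_diff_mult:
  assumes "p \<in> polyfun G" "q \<in> polyfun G" "p' \<in> polyfun G" "q' \<in> polyfun G"
  shows "(\<lambda>c. p c * q c - p' c * q' c) \<in> polyfun G"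
proof -
  have "(\<lambda>c. p c * q c + (- 1) * (p' c * q' c)) \<in> polyfun G"
    by (intro polyfun.add polyfun.mult polyfun.const assms)
  then show ?thesis by simp
qed

text \<open>This is Gauss elimination with a pivot \<open>Y k c j\<close> that is nonzero at \<open>c0\<close>: the vectors
  \<open>Y k c j * Y a c - Y a c j * Y k c\<close> have a zero in position \<open>j\<close> and are polynomial again, and where
  the pivot does not vanish their independence implies that of the family. The product of the pivots
  is the polynomial \<open>p\<close>; it replaces a nonvanishing maximal minor.\<close>

lemma independence_open:
  assumes "\<And>a i. a < k \<Longrightarrow> (\<lambda>c. Y a c i) \<in> polyfun G" "indep_fam k (\<lambda>a. Y a c0)"
  shows "\<exists>p\<in>polyfun G. p c0 \<noteq> 0 \<and> (\<forall>c. p c \<noteq> 0 \<longrightarrow> indep_fam k (\<lambda>a. Y a c))"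
  using assms
proof (induction k arbitrary: Y)
  case 0
  show ?case by (rule bexI[of _ "\<lambda>_. 1"]) (auto simp: indep_fam_def intro: polyfun.const)
next
  case (Suc k)
  have "\<exists>i. Y k c0 i \<noteq> 0"
  proof (rule ccontr)
    assume "\<not> ?thesis"
    then have "\<forall>i. (\<Sum>a<Suc k. (if a = k then 1 else 0) * Y a c0 i) = 0" by simp
    then have "\<forall>a<Suc k. (if a = k then 1 else 0 :: complex) = 0"
      by (rule mp[OF spec[OF Suc.prems(2)[unfolded indep_fam_def]]])
    then show False by (metis lessI one_neq_zero)
  qed
  then obtain j where j: "Y k c0 j \<noteq> 0" by blast
  define Z where "Z a c i = Y k c j * Y a c i - Y a c j * Y k c i" for a c i
  have sumZ: "(\<Sum>a<k. u a * Z a c i) = Y k c j * (\<Sum>a<k. u a * Y a c i) - (\<Sum>a<k. u a * Y a c j) * Y k c i"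
    for u c i
    by (simp add: Z_def sum_subtractf sum_distrib_left sum_distrib_right algebra_simps)
  have "(\<lambda>c. Z a c i) \<in> polyfun G" if "a < k" for a i
    unfolding Z_def using that by (intro polyfun_diff_mult Suc.prems) auto
  moreover have "indep_fam k (\<lambda>a. Z a c0)"
    unfolding indep_fam_def
  proof (intro allI impI)
    fix u a assume u: "\<forall>i. (\<Sum>a<k. u a * Z a c0 i) = 0" and a: "a < k"
    let ?u = "\<lambda>a. if a = k then - (\<Sum>a<k. u a * Y a c0 j) else Y k c0 j * u a"
    have "(\<Sum>a<Suc k. ?u a * Y a c0 i) = (\<Sum>a<k. u a * Z a c0 i)" for i
      unfolding sumZ by (simp add: sum_distrib_left mult.assoc)
    then have "\<forall>i. (\<Sum>a<Suc k. ?u a * Y a c0 i) = 0" using u by simp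
    then have "\<forall>a<Suc k. ?u a = 0"
      by (rule mp[OF spec[OF Suc.prems(2)[unfolded indep_fam_def]]])
    then have "?u a = 0" using a less_SucI by blast
    then show "u a = 0" using a j by simp
  qed
  ultimately obtain p where p: "p \<in> polyfun G" "p c0 \<noteq> 0"
    "\<And>c. p c \<noteq> 0 \<Longrightarrow> indep_fam k (\<lambda>a. Z a c)"
    using Suc.IH[of Z] by blast
  have "indep_fam (Suc k) (\<lambda>a. Y a c)" if pc: "Y k c j * p c \<noteq> 0" for c
    unfolding indep_fam_def
  proof (rule allI, rule impI)
    fix u assume u: "\<forall>i. (\<Sum>a<Suc k. u a * Y a c i) = 0"
    then have e: "(\<Sum>a<k. u a * Y a c i) = - u k * Y k c i" for i
      by (simp add: eq_neg_iff_add_eq_0)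
    have "\<forall>i. (\<Sum>a<k. u a * Z a c i) = 0" unfolding sumZ e by simp
    then have z: "\<forall>a<k. u a = 0" using p(3)[of c] pc unfolding indep_fam_def by auto
    then have "u k * Y k c j = 0" using e[of j] by simp
    then show "\<forall>a<Suc k. u a = 0" using z pc less_Suc_eq by auto
  qed
  then show ?case
    using p j Suc.prems(1)[of k j] by (intro bexI[of _ "\<lambda>c. Y k c j * p c"] polyfun.mult) auto
qed

lemma sum_fun_apply: "(\<Sum>a\<in>A. f a) i = (\<Sum>a\<in>A. f a i)"
  by (induction A rule: infinite_finite_induct) auto

lemma indep_fam_iff:
  "indep_fam k Y \<longleftrightarrow> inj_on Y {..<k} \<and> cfun.independent (Y ` {..<k})"
proof
  assume Y: "indep_fam k Y"
  have inj: "inj_on Y {..<k}"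
  proof (rule inj_onI, rule ccontr)
    fix a b assume ab: "a \<in> {..<k}" "b \<in> {..<k}" "Y a = Y b" "a \<noteq> b"
    let ?u = "\<lambda>c. (if c = a then 1 else 0) - (if c = b then 1 else 0) :: complex"
    have "(\<Sum>c<k. ?u c * Y c i) = 0" for i
    proof -
      have "(\<Sum>c<k. ?u c * Y c i) =
         (\<Sum>c<k. (if c = a then Y c i else 0)) - (\<Sum>c<k. (if c = b then Y c i else 0))"
        by (subst sum_subtractf[symmetric], intro sum.cong) auto
      then show ?thesis using ab by simp
    qed
    then have "\<forall>i. (\<Sum>c<k. ?u c * Y c i) = 0" by blast
    then have "\<forall>c<k. ?u c = 0" by (rule mp[OF spec[OF Y[unfolded indep_fam_def]]])
    then have "?u a = 0" using ab by blast
    then show False using ab by simp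
  qed
  moreover have "cfun.independent (Y ` {..<k})"
  proof (rule cfun.independent_if_scalars_zero)
    fix u v assume s: "(\<Sum>x\<in>Y ` {..<k}. fscale (u x) x) = 0" and v: "v \<in> Y ` {..<k}"
    have "(\<Sum>a<k. fscale (u (Y a)) (Y a)) = 0" using s by (simp add: sum.reindex[OF inj])
    then have "(\<Sum>a<k. fscale (u (Y a)) (Y a)) i = 0" for i by simp
    then have "\<forall>i. (\<Sum>a<k. u (Y a) * Y a i) = 0" by (simp add: sum_fun_apply fscale_apply)
    then have "\<forall>a<k. u (Y a) = 0"
      using spec[OF Y[unfolded indep_fam_def], of "\<lambda>a. u (Y a)"] by blast
    then show "u v = 0" using v by blast
  qed simp
  ultimately show "inj_on Y {..<k} \<and> cfun.independent (Y ` {..<k})" ..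
next
  assume Y: "inj_on Y {..<k} \<and> cfun.independent (Y ` {..<k})"
  show "indep_fam k Y" unfolding indep_fam_def
  proof (intro allI impI)
    fix u a assume u: "\<forall>i. (\<Sum>a<k. u a * Y a i) = 0" and a: "a < k"
    let ?i = "inv_into {..<k} Y"
    have i: "?i (Y a) = a" if "a < k" for a using Y that by (simp add: inv_into_f_f)
    have "(\<Sum>x\<in>Y ` {..<k}. fscale (u (?i x)) x) = (\<Sum>a<k. fscale (u a) (Y a))"
      using Y i by (subst sum.reindex) auto
    also have "\<dots> = 0" using u by (intro ext) (simp add: sum_fun_apply fscale_apply)
    finally show "u a = 0"
      using cfun.independentD[of "Y ` {..<k}" "Y ` {..<k}" "\<lambda>x. u (?i x)" "Y a"] Y a i by auto
  qed
qed

section \<open>The two parts of a flag\<close>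

lemma mem_L: "x \<in> L n \<longleftrightarrow> (\<forall>k. k \<notin> {1..n} \<longrightarrow> x k = 0)"
  and mem_Lminus: "x \<in> Lminus d \<longleftrightarrow> (\<forall>k. k \<notin> {1..d} \<longrightarrow> x k = 0)"
  and mem_Lplus: "x \<in> Lplus n d \<longleftrightarrow> (\<forall>k. k \<notin> {d+1..n} \<longrightarrow> x k = 0)"
  by (simp_all add: L_def Lminus_def Lplus_def span_ell)

lemma subspace_L: "cfun.subspace (L n)" "cfun.subspace (Lminus d)" "cfun.subspace (Lplus n d)"
  by (simp_all add: L_def Lminus_def Lplus_def cfun.subspace_span)

lemma finite_dim_L: "S \<subseteq> L n \<Longrightarrow> finite_dim S"
  unfolding finite_dim_def L_def by (rule exI[of _ "ell ` {1..n}"]) simp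

lemma Lminus_subset: "d \<le> n \<Longrightarrow> Lminus d \<subseteq> L n" and Lplus_subset: "Lplus n d \<subseteq> L n"
  by (auto simp: mem_L mem_Lminus mem_Lplus)

lemma lin_pr: "lin (pr i)"
  by (rule linI) (auto simp: pr_def fun_eq_iff fscale_apply)

lemma lin_fblock: "lin (fblock n f d)"
  by (rule linI)
    (auto simp: fblock_def fun_eq_iff distrib_left sum.distrib sum_distrib_left mult.left_commute fscale_apply)

lemmas pr_add = lin_add[OF lin_pr]
lemmas fblock_add = lin_add[OF lin_fblock] and fblock_scale = lin_scale[OF lin_fblock]
  and fblock_0 = lin_0[OF lin_fblock] and fblock_diff = lin_diff[OF lin_fblock]

lemma fblock_Lplus: "fblock n f d x \<in> Lplus n d"
  by (auto simp: mem_Lplus fblock_def)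

lemma fblock_add_matrix: "fblock n (f + g) d x = fblock n f d x + fblock n g d x"
  and fblock_scale_matrix: "fblock n (fscale c f) d x = fscale c (fblock n f d x)"
  by (auto simp: fblock_def fun_eq_iff distrib_right sum.distrib sum_distrib_left mult.assoc fscale_apply)

lemma pr_Lminus: "x \<in> Lminus d \<Longrightarrow> pr (d+1) x = x"
  by (auto simp: mem_Lminus pr_def fun_eq_iff)

lemma pr_fblock: "x \<in> Lminus d \<Longrightarrow> pr (d+1) (fblock n f d x) = fblock n f (d+1) x"
  by (auto simp: mem_Lminus pr_def fblock_def fun_eq_iff)

lemma pr_Lplus: "y \<in> Lplus n d \<Longrightarrow> pr (d+1) y \<in> Lplus n (d+1)"
  by (auto simp: mem_Lplus pr_def)

text \<open>The projection of \<open>L\<close> onto \<open>Lminus d\<close> along \<open>Lplus n d\<close>. Rank and nullity for its restriction to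
  \<open>U d\<close> compare \<open>U d\<close> with its projection \<open>NP n U d\<close> and its intersection \<open>NI n U d\<close>.\<close>

definition low :: "nat \<Rightarrow> cvec \<Rightarrow> cvec" where
  "low d x = (\<lambda>i. if i \<le> d then x i else 0)"

lemma lin_low: "lin (low d)"
  by (rule linI) (auto simp: low_def fun_eq_iff fscale_apply)

lemma low_Lminus: "x \<in> L n \<Longrightarrow> low d x \<in> Lminus d"
  and low_Lplus: "x \<in> L n \<Longrightarrow> x - low d x \<in> Lplus n d"
  by (auto simp: mem_L mem_Lminus mem_Lplus low_def)

lemma low_split: "x \<in> Lminus d \<Longrightarrow> y \<in> Lplus n d \<Longrightarrow> low d (x + y) = x"
  by (auto simp: mem_Lminus mem_Lplus low_def fun_eq_iff)

lemma split_unique: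
  assumes "x \<in> Lminus d" "x' \<in> Lminus d" "y \<in> Lplus n d" "y' \<in> Lplus n d" "x + y = x' + y'"
  shows "x = x'" "y = y'"
proof -
  show "x = x'" using low_split[OF assms(1,3)] low_split[OF assms(2,4)] assms(5) by simp
  then show "y = y'" using assms(5) by simp
qed

lemma low_0_Lplus: "x \<in> L n \<Longrightarrow> low d x = 0 \<Longrightarrow> x \<in> Lplus n d"
  using low_Lplus[of x n d] by simp

lemma mem_NP:
  assumes "d \<in> {1..n-1}"
  shows "p \<in> NP n U d \<longleftrightarrow> p \<in> Lminus d \<and> (\<exists>i\<in>Lplus n d. p + i \<in> U d)"
  using assms by (simp add: NP_def car_Prep car_Irep)

lemma mem_NI:
  assumes "d \<in> {1..n-1}"
  shows "p \<in> NI n U d \<longleftrightarrow> p \<in> Lplus n d \<and> p \<in> U d"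
  using assms by (auto simp add: NI_def car_Irep)

lemma NP_eq_image:
  assumes "d \<in> {1..n-1}" "U d \<subseteq> L n"
  shows "NP n U d = low d ` U d"
proof (intro set_eqI iffI)
  fix p assume "p \<in> NP n U d"
  then obtain i where i: "i \<in> Lplus n d" "p + i \<in> U d" "p \<in> Lminus d"
    by (auto simp: mem_NP[OF assms(1)])
  then show "p \<in> low d ` U d" using low_split[OF i(3,1)] by force
next
  fix p assume "p \<in> low d ` U d"
  then obtain u where u: "u \<in> U d" "p = low d u" by blast
  then have "u \<in> L n" using assms by blast
  then show "p \<in> NP n U d" unfolding mem_NP[OF assms(1)]
    using low_Lminus low_Lplus u by (auto intro!: bexI[of _ "u - low d u"])
qed

lemma NI_eq_kernel:
  assumes "d \<in> {1..n-1}" "U d \<subseteq> L n"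
  shows "NI n U d = {u \<in> U d. low d u = 0}"
proof (intro set_eqI iffI)
  fix p assume "p \<in> NI n U d"
  then show "p \<in> {u \<in> U d. low d u = 0}"
    unfolding mem_NI[OF assms(1)] by (auto simp: mem_Lplus low_def fun_eq_iff)
next
  fix p assume "p \<in> {u \<in> U d. low d u = 0}"
  then show "p \<in> NI n U d" unfolding mem_NI[OF assms(1)] using low_0_Lplus assms by blast
qed

lemma subspace_NP: "d \<in> {1..n-1} \<Longrightarrow> U d \<subseteq> L n \<Longrightarrow> cfun.subspace (U d) \<Longrightarrow> cfun.subspace (NP n U d)"
  by (simp add: NP_eq_image subspace_image lin_low)

lemma subspace_NI: "d \<in> {1..n-1} \<Longrightarrow> cfun.subspace (U d) \<Longrightarrow> cfun.subspace (NI n U d)"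
  by (simp add: NI_def car_Irep subspace_L cfun.subspace_inter)

lemma dim_NP_NI:
  assumes "d \<in> {1..n-1}" "U d \<subseteq> L n" "cfun.subspace (U d)"
  shows "cfun.dim (U d) = cfun.dim (NI n U d) + cfun.dim (NP n U d)"
  using rank_nullity[OF lin_low assms(3) finite_dim_L[OF assms(2)], of d]
  unfolding NP_eq_image[where U = U, OF assms(1,2)] NI_eq_kernel[where U = U, OF assms(1,2)] .

section \<open>Sections over the projection to P\<close>

text \<open>Subrepresentations of \<open>P \<oplus> I\<close> with an arbitrary dimension vector.\<close>

definition sub_chain :: "nat \<Rightarrow> (nat \<Rightarrow> cvec set) \<Rightarrow> bool" where
  "sub_chain n U \<longleftrightarrow> (\<forall>d\<in>{1..n-1}. cfun.subspace (U d) \<and> U d \<subseteq> L n) \<and>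
     (\<forall>d\<in>{1..n-2}. pr (d+1) ` U d \<subseteq> U (d+1))"

lemma flag_sub_chain: "U \<in> flag_variety n \<Longrightarrow> sub_chain n U"
  by (auto simp: flag_variety_def sub_chain_def Gr_def PiE_def Pi_def)

lemma flag_dim: "U \<in> flag_variety n \<Longrightarrow> d \<in> {1..n-1} \<Longrightarrow> cfun.dim (U d) = d"
  by (auto simp: flag_variety_def Gr_def PiE_def Pi_def)

lemma NP_mono:
  assumes "sub_chain n U" "d \<in> {1..n-2}"
  shows "NP n U d \<subseteq> NP n U (d+1)"
proof
  have d: "d \<in> {1..n-1}" "d + 1 \<in> {1..n-1}" using assms(2) by auto
  fix p assume "p \<in> NP n U d"
  then obtain i where i: "p \<in> Lminus d" "i \<in> Lplus n d" "p + i \<in> U d" using mem_NP[OF d(1)] by blast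
  have "pr (d+1) (p + i) \<in> U (d+1)" using assms i unfolding sub_chain_def by blast
  moreover have "pr (d+1) (p + i) = p + pr (d+1) i" using pr_Lminus[OF i(1)] by (simp add: pr_add)
  moreover have "p \<in> Lminus (d+1)" using i(1) by (auto simp: mem_Lminus)
  ultimately show "p \<in> NP n U (d+1)" unfolding mem_NP[OF d(2)] using pr_Lplus[OF i(2)] by auto
qed

lemma NI_pr:
  assumes "sub_chain n U" "d \<in> {1..n-2}"
  shows "pr (d+1) ` NI n U d \<subseteq> NI n U (d+1)"
proof -
  have d: "d \<in> {1..n-1}" "d + 1 \<in> {1..n-1}" using assms(2) by auto
  have "pr (d+1) ` U d \<subseteq> U (d+1)" using assms unfolding sub_chain_def by blast
  then show ?thesis using pr_Lplus mem_NI[OF d(1)] mem_NI[OF d(2)] by blast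
qed

text \<open>A basis of the largest space that is adapted to all smaller ones, obtained by extending bases along
  the chain. It exhibits the chain as a direct sum of modules \<open>P_a\<close>, one for each basis vector, that
  starts at the vertex where the vector first occurs.\<close>

lemma chain_basis:
  assumes "\<And>d. d \<in> {1..m} \<Longrightarrow> cfun.subspace (K d)" "\<And>d. 1 \<le> d \<Longrightarrow> d < m \<Longrightarrow> K d \<subseteq> K (Suc d)"
  shows "\<exists>B. cfun.independent B \<and> B \<subseteq> (\<Union>d\<in>{1..m}. K d) \<and> (\<forall>d\<in>{1..m}. K d \<subseteq> cfun.span (B \<inter> K d))"
  using assms
proof (induction m)
  case 0
  show ?case by (intro exI[of _ "{}"] conjI cfun.independent_empty) simp_all
next
  case (Suc m)
  obtain A where A: "cfun.independent A" "A \<subseteq> (\<Union>d\<in>{1..m}. K d)"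
      "\<forall>d\<in>{1..m}. K d \<subseteq> cfun.span (A \<inter> K d)"
    using Suc.IH[OF Suc.prems] by auto
  have mono: "K d \<subseteq> K (Suc m)" if "d \<in> {1..m}" for d
  proof -
    have "d \<le> e \<Longrightarrow> e \<le> Suc m \<Longrightarrow> K d \<subseteq> K e" for e
    proof (induction e rule: dec_induct)
      case (step e)
      then show ?case using Suc.prems(2)[of e] that by auto
    qed simp
    then show ?thesis using that by simp
  qed
  have "A \<subseteq> K (Suc m)" using A(2) mono by blast
  then obtain B where B: "A \<subseteq> B" "B \<subseteq> K (Suc m)" "cfun.independent B" "K (Suc m) \<subseteq> cfun.span B"
    using cfun.maximal_independent_subset_extend[OF _ A(1)] by metis
  have "K d \<subseteq> cfun.span (B \<inter> K d)" if "d \<in> {1..Suc m}" for d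
  proof (cases "d = Suc m")
    case True
    then show ?thesis using B by (simp add: Int_absorb2)
  next
    case False
    then have "K d \<subseteq> cfun.span (A \<inter> K d)" using A that by simp
    also have "\<dots> \<subseteq> cfun.span (B \<inter> K d)" using B by (intro cfun.span_mono) blast
    finally show ?thesis .
  qed
  moreover have "B \<subseteq> (\<Union>d\<in>{1..Suc m}. K d)"
    using B(2) by (auto intro!: bexI[of _ "Suc m"])
  ultimately show ?case using B(3) by blast
qed

text \<open>The composite of the arrows from \<open>e\<close> to \<open>d\<close> erases the coordinates \<open>e+1, \<dots>, d\<close>.\<close>

lemma sub_chain_truncate:
  assumes "sub_chain n U" "e \<in> {1..n-1}" "u \<in> U e" "e \<le> d" "d \<le> n - 1"
  shows "(\<lambda>i. if e < i \<and> i \<le> d then 0 else u i) \<in> U d"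
  using assms(4,5)
proof (induction d rule: dec_induct)
  case base
  have "(\<lambda>i. if e < i \<and> i \<le> e then 0 else u i) = u" by (intro ext) auto
  then show ?case using assms(3) by metis
next
  case (step d)
  let ?u = "\<lambda>d i. if e < i \<and> i \<le> d then 0 else u i"
  have "pr (d+1) (?u d) \<in> U (d+1)"
    using assms step unfolding sub_chain_def by (auto simp: image_subset_iff)
  moreover have "pr (d+1) (?u d) = ?u (Suc d)" using step by (auto simp: pr_def fun_eq_iff)
  ultimately show ?case by simp
qed

text \<open>The surjection \<open>U \<rightarrow> N_P\<close> splits because \<open>N_P\<close> is projective, and the \<open>I\<close>-component of a splitting
  extends from \<open>N_P\<close> to \<open>P\<close> because \<open>I\<close> is injective; a homomorphism \<open>P \<rightarrow> I\<close> is a strictly lower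
  triangular matrix. Concretely: on a basis adapted to the chain \<open>N_P\<close>, prescribe a lift of each basis
  vector at the vertex where it is born, and extend linearly to the whole space. Later lifts are
  truncations of the first one, so the columns of this one linear map give the matrix.\<close>

lemma exists_section:
  assumes "sub_chain n U"
  obtains f where "f \<in> nminus n"
    "\<And>d x. d \<in> {1..n-1} \<Longrightarrow> x \<in> NP n U d \<Longrightarrow> x + fblock n f d x \<in> U d"
proof -
  have sub: "cfun.subspace (U d)" "U d \<subseteq> L n" if "d \<in> {1..n-1}" for d
    using assms that unfolding sub_chain_def by auto
  let ?K = "NP n U"
  have mono: "?K d \<subseteq> ?K (Suc d)" if "1 \<le> d" "d < n - 1" for d
  proof -
    have "d \<in> {1..n-2}" using that by auto
    then show ?thesis using NP_mono[OF assms] by simp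
  qed
  have subK: "cfun.subspace (?K d)" if "d \<in> {1..n-1}" for d
    using subspace_NP[of d n U] sub[OF that] that by blast
  obtain B where B: "cfun.independent B" "B \<subseteq> (\<Union>d\<in>{1..n-1}. ?K d)"
      "\<And>d. d \<in> {1..n-1} \<Longrightarrow> ?K d \<subseteq> cfun.span (B \<inter> ?K d)"
    using chain_basis[of "n-1" ?K, OF subK mono] by blast
  \<comment> \<open>The vertex at which a basis vector is born.\<close>
  define e where "e b = (LEAST d. d \<in> {1..n-1} \<and> b \<in> ?K d)" for b
  have e: "e b \<in> {1..n-1}" "b \<in> ?K (e b)" if "b \<in> B" for b
  proof -
    obtain d where "d \<in> {1..n-1} \<and> b \<in> ?K d" using B(2) \<open>b \<in> B\<close> by blast
    then have "e b \<in> {1..n-1} \<and> b \<in> ?K (e b)" unfolding e_def by (rule LeastI)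
    then show "e b \<in> {1..n-1}" "b \<in> ?K (e b)" by auto
  qed
  have e_le: "e b \<le> d" if "d \<in> {1..n-1}" "b \<in> ?K d" for b d
    unfolding e_def using that by (intro Least_le) simp
  have "\<forall>b\<in>B. \<exists>y. y \<in> Lplus n (e b) \<and> b + y \<in> U (e b)" using e mem_NP by blast
  then obtain y where y: "\<And>b. b \<in> B \<Longrightarrow> y b \<in> Lplus n (e b) \<and> b + y b \<in> U (e b)" by metis
  obtain F where F: "lin F" "\<And>b. b \<in> B \<Longrightarrow> F b = y b"
    using cpair.linear_independent_extend[OF B(1), of y] by blast
  define f where "f = (\<lambda>(i, j). if 1 \<le> j \<and> j < i \<and> i \<le> n then F (ell j) i else 0)"
  have f: "f \<in> nminus n" by (auto simp: nminus_def f_def)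
  have fF: "fblock n f d x i = (if i \<in> {d+1..n} then F x i else 0)" if "x \<in> Lminus d" for d x i
  proof -
    have "x = (\<Sum>j=1..d. fscale (x j) (ell j))"
    proof
      fix i
      have "(\<Sum>j=1..d. fscale (x j) (ell j)) i = (\<Sum>j=1..d. if i = j then x j else 0)"
        unfolding sum_fun_apply by (intro sum.cong) (auto simp: ell_def fscale_apply)
      also have "\<dots> = x i" using that by (auto simp: mem_Lminus)
      finally show "x i = (\<Sum>j=1..d. fscale (x j) (ell j)) i" ..
    qed
    then have "F x = (\<Sum>j=1..d. fscale (x j) (F (ell j)))"
      by (metis (no_types, lifting) cpair.linear_sum[OF F(1)] lin_scale[OF F(1)] sum.cong)
    then have "F x i = (\<Sum>j=1..d. x j * F (ell j) i)" by (simp add: sum_fun_apply fscale_apply)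
    moreover have "fblock n f d x i = (\<Sum>j=1..d. x j * F (ell j) i)" if "i \<in> {d+1..n}"
      using that unfolding fblock_def f_def by (auto intro!: sum.cong)
    ultimately show ?thesis by (auto simp: fblock_def)
  qed
  show ?thesis
  proof (rule that[OF f])
    fix d x assume d: "d \<in> {1..n-1}" and x: "x \<in> ?K d"
    let ?S = "{x. x + fblock n f d x \<in> U d}"
    have "lin (\<lambda>x. x + fblock n f d x)"
      by (rule linI) (simp_all only: fblock_add fblock_scale cfun.scale_right_distrib ac_simps)
    then have "cfun.subspace ?S"
      using cpair.linear_subspace_vimage[of "\<lambda>x. x + fblock n f d x" "U d"] sub[OF d]
      by (simp add: vimage_def)
    moreover have "B \<inter> ?K d \<subseteq> ?S"
    proof
      fix b assume b: "b \<in> B \<inter> ?K d"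
      then have ed: "e b \<le> d" using e_le d by blast
      have bm: "b \<in> Lminus d" "b \<in> Lminus (e b)" using b e mem_NP d by blast+
      have yb: "y b \<in> Lplus n (e b)" "b + y b \<in> U (e b)" using y b by auto
      have "(\<lambda>i. if e b < i \<and> i \<le> d then 0 else (b + y b) i) \<in> U d"
        using sub_chain_truncate[OF assms _ yb(2) ed] e b d by auto
      moreover have "b + fblock n f d b = (\<lambda>i. if e b < i \<and> i \<le> d then 0 else (b + y b) i)"
      proof
        fix i
        have "fblock n f d b i = (if i \<in> {d+1..n} then y b i else 0)" using fF[OF bm(1)] F b by simp
        moreover have "b i = 0" if "e b < i" using bm(2) that by (simp add: mem_Lminus)
        moreover have "y b i = 0" if "i \<le> e b \<or> n < i" using yb(1) that by (auto simp: mem_Lplus)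
        ultimately show "(b + fblock n f d b) i = (if e b < i \<and> i \<le> d then 0 else (b + y b) i)"
          using ed by auto
      qed
      ultimately show "b \<in> ?S" by simp
    qed
    ultimately show "x + fblock n f d x \<in> U d"
      using cfun.span_minimal[of "B \<inter> ?K d" ?S] B(3)[OF d] x by blast
  qed
qed

section \<open>Partial graphs\<close>

text \<open>Subrepresentations \<open>K\<close> of \<open>P\<close> and \<open>J\<close> of \<open>I\<close> whose dimension vectors add up to that of \<open>P\<close>.\<close>

definition sub_pair :: "nat \<Rightarrow> (nat \<Rightarrow> cvec set) \<Rightarrow> (nat \<Rightarrow> cvec set) \<Rightarrow> bool" where
  "sub_pair n K J \<longleftrightarrow>
     (\<forall>d\<in>{1..n-1}. cfun.subspace (K d) \<and> K d \<subseteq> Lminus d \<and> cfun.subspace (J d) \<and> J d \<subseteq> Lplus n d \<and>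
        cfun.dim (K d) + cfun.dim (J d) = d) \<and>
     (\<forall>d\<in>{1..n-2}. K d \<subseteq> K (d+1) \<and> pr (d+1) ` J d \<subseteq> J (d+1))"

text \<open>The preimage in \<open>K \<oplus> I\<close> of the graph of the homomorphism \<open>K \<rightarrow> I/J\<close> induced by \<open>f\<close>. For \<open>K = P\<close> and
  \<open>J = 0\<close> these are the points of the open cell; \<open>K \<oplus> J\<close> is the case \<open>f = 0\<close>.\<close>

definition partial_graph ::
    "nat \<Rightarrow> (nat \<Rightarrow> cvec set) \<Rightarrow> (nat \<Rightarrow> cvec set) \<Rightarrow> (nat \<times> nat \<Rightarrow> complex) \<Rightarrow> nat \<Rightarrow> cvec set" where
  "partial_graph n K J f = (\<lambda>d\<in>{1..n-1}. {x + fblock n f d x + y | x y. x \<in> K d \<and> y \<in> J d})"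

lemma sub_pairD:
  assumes "sub_pair n K J" "d \<in> {1..n-1}"
  shows "cfun.subspace (K d)" "K d \<subseteq> Lminus d" "cfun.subspace (J d)" "J d \<subseteq> Lplus n d"
    "cfun.dim (K d) + cfun.dim (J d) = d" "finite_dim (K d)" "finite_dim (J d)"
    "K d \<subseteq> L n" "J d \<subseteq> L n"
proof -
  show *: "cfun.subspace (K d)" "K d \<subseteq> Lminus d" "cfun.subspace (J d)" "J d \<subseteq> Lplus n d"
    "cfun.dim (K d) + cfun.dim (J d) = d"
    using assms unfolding sub_pair_def by blast+
  have "d \<le> n" using assms(2) by auto
  then show "K d \<subseteq> L n" using *(2) Lminus_subset by blast
  then show "finite_dim (K d)" by (rule finite_dim_L)
  show "J d \<subseteq> L n" using *(4) Lplus_subset by blast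
  then show "finite_dim (J d)" by (rule finite_dim_L)
qed

lemma mem_partial_graph:
  "d \<in> {1..n-1} \<Longrightarrow> u \<in> partial_graph n K J f d \<longleftrightarrow>
     (\<exists>x y. x \<in> K d \<and> y \<in> J d \<and> u = x + fblock n f d x + y)"
  by (auto simp: partial_graph_def)

lemma partial_graph_flag:
  assumes "sub_pair n K J"
  shows "partial_graph n K J f \<in> flag_variety n"
proof -
  let ?U = "partial_graph n K J f"
  have "?U d \<in> Gr n d" if d: "d \<in> {1..n-1}" for d
  proof -
    note KJ = sub_pairD[OF assms d]
    have l: "lin (\<lambda>x. x + fblock n f d x)"
      by (rule linI) (simp_all only: fblock_add fblock_scale cfun.scale_right_distrib ac_simps)
    have eq: "?U d = {x + y | x y. x \<in> (\<lambda>x. x + fblock n f d x) ` K d \<and> y \<in> J d}"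
      using d by (auto simp: partial_graph_def)
    have sub: "cfun.subspace (?U d)"
      unfolding eq using subspace_image[OF l KJ(1)] KJ(3) by (intro cfun.subspace_sums)
    have UL: "?U d \<subseteq> L n"
    proof
      fix u assume "u \<in> ?U d"
      then obtain x y where "x \<in> K d" "y \<in> J d" "u = x + fblock n f d x + y"
        using mem_partial_graph[OF d] by blast
      then show "u \<in> L n"
        using KJ(8,9) Lplus_subset[of n d] fblock_Lplus[of n f d x]
        by (metis cfun.subspace_add subspace_L(1) subsetD)
    qed
    have low: "low d (x + fblock n f d x + y) = x" if "x \<in> K d" "y \<in> J d" for x y
    proof -
      have "fblock n f d x + y \<in> Lplus n d"
        using that KJ fblock_Lplus by (intro cfun.subspace_add subspace_L) auto
      then show ?thesis using low_split[of x d "fblock n f d x + y" n] that KJ by (auto simp: add.assoc)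
    qed
    have "{u \<in> ?U d. low d u = 0} = J d"
    proof (intro set_eqI iffI)
      fix u assume "u \<in> {u \<in> ?U d. low d u = 0}"
      then obtain x y where xy: "x \<in> K d" "y \<in> J d" "u = x + fblock n f d x + y" "low d u = 0"
        using mem_partial_graph[OF d] by blast
      then have "x = 0" using low by metis
      then show "u \<in> J d" using xy by (simp add: fblock_0)
    next
      fix u assume u: "u \<in> J d"
      have "0 \<in> K d" using KJ(1) cfun.subspace_0 by blast
      then have "u \<in> ?U d" unfolding mem_partial_graph[OF d]
        using u by (intro exI[of _ 0] exI[of _ u]) (simp add: fblock_0)
      then show "u \<in> {u \<in> ?U d. low d u = 0}"
        using low[OF \<open>0 \<in> K d\<close> u] by (simp add: fblock_0)
    qed
    moreover have "low d ` ?U d = K d"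
    proof (intro set_eqI iffI)
      fix x assume "x \<in> low d ` ?U d"
      then show "x \<in> K d" using mem_partial_graph[OF d] low by auto
    next
      fix x assume x: "x \<in> K d"
      have "0 \<in> J d" using KJ(3) cfun.subspace_0 by blast
      then have "x + fblock n f d x + 0 \<in> ?U d" unfolding mem_partial_graph[OF d] using x by blast
      then show "x \<in> low d ` ?U d" using low[OF x \<open>0 \<in> J d\<close>] by (metis imageI)
    qed
    ultimately have "cfun.dim (?U d) = d"
      using rank_nullity[OF lin_low sub finite_dim_L[OF UL], of d] KJ(5) by simp
    then show ?thesis using sub UL by (simp add: Gr_def)
  qed
  moreover have "pr (d+1) ` ?U d \<subseteq> ?U (d+1)" if d: "d \<in> {1..n-2}" for d
  proof
    have d': "d \<in> {1..n-1}" "d + 1 \<in> {1..n-1}" using d by auto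
    fix v assume "v \<in> pr (d+1) ` ?U d"
    then obtain x y where xy: "x \<in> K d" "y \<in> J d" "v = pr (d+1) (x + fblock n f d x + y)"
      using mem_partial_graph[OF d'(1)] by auto
    have x: "x \<in> Lminus d" using xy sub_pairD[OF assms d'(1)] by blast
    have "v = x + fblock n f (d+1) x + pr (d+1) y"
      using xy by (simp only: pr_add pr_Lminus[OF x] pr_fblock[OF x])
    moreover have "x \<in> K (d+1)" "pr (d+1) y \<in> J (d+1)"
      using assms d xy unfolding sub_pair_def by blast+
    ultimately show "v \<in> ?U (d+1)" unfolding mem_partial_graph[OF d'(2)] by blast
  qed
  ultimately show ?thesis unfolding flag_variety_def by (auto simp: partial_graph_def)
qed

lemma sub_pair_full: "sub_pair n Lminus (\<lambda>d. {0})"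
proof -
  have "cfun.dim (Lminus d) = d" for d
    using cfun.dim_span_eq_card_independent[OF independent_ell[of "{1..d}"]]
    by (simp add: Lminus_def card_image inj_on_subset[OF inj_ell])
  moreover have "cfun.dim {0 :: cvec} = 0"
    by (metis cfun.dim_span_eq_card_independent cfun.independent_empty cfun.span_empty card.empty)
  ultimately show ?thesis
    using subspace_L lin_0[OF lin_pr]
    by (auto simp: sub_pair_def mem_Lminus mem_Lplus)
qed

lemma iota_eq_partial_graph: "iota n f = partial_graph n Lminus (\<lambda>d. {0}) f"
proof
  fix d
  show "iota n f d = partial_graph n Lminus (\<lambda>d. {0}) f d"
  proof (cases "d \<in> {1..n-1}")
    case True
    have l: "lin (\<lambda>x. x + fblock n f d x)"
      by (rule linI) (simp_all only: fblock_add fblock_scale cfun.scale_right_distrib ac_simps)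
    have "{ell a + fblock n f d (ell a) | a. a \<in> {1..d}} = (\<lambda>x. x + fblock n f d x) ` ell ` {1..d}"
      by auto
    then have "iota n f d = (\<lambda>x. x + fblock n f d x) ` Lminus d"
      using cpair.linear_span_image[OF l, of "ell ` {1..d}"] True by (simp add: iota_def Lminus_def)
    then show ?thesis using True by (auto simp: partial_graph_def)
  qed (auto simp: iota_def partial_graph_def)
qed

lemma mem_iota: "d \<in> {1..n-1} \<Longrightarrow> u \<in> iota n f d \<longleftrightarrow> (\<exists>x\<in>Lminus d. u = x + fblock n f d x)"
  by (auto simp: iota_eq_partial_graph mem_partial_graph)

lemma iota_flag: "iota n f \<in> flag_variety n"
  unfolding iota_eq_partial_graph by (rule partial_graph_flag[OF sub_pair_full])

section \<open>Existence of nonzero homomorphisms\<close>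

text \<open>The Euler form of a linear quiver is positive definite:
  \<open>2 (\<Sum> x\<^sub>d\<^sup>2 - \<Sum> x\<^sub>d x\<^sub>d\<^sub>+\<^sub>1) = x\<^sub>1\<^sup>2 + x\<^sub>m\<^sup>2 + \<Sum> (x\<^sub>d - x\<^sub>d\<^sub>+\<^sub>1)\<^sup>2\<close>. The induction keeps the last square aside.\<close>

lemma sum_squares_gt_sum_products:
  fixes x :: "nat \<Rightarrow> nat"
  assumes "d \<in> {1..m}" "x d \<noteq> 0"
  shows "(\<Sum>d=1..<m. x d * x (Suc d)) < (\<Sum>d=1..m. x d * x d)"
proof -
  define D where "D m = 2 * (\<Sum>d=1..m. int (x d) * int (x d)) - 2 * (\<Sum>d=1..<m. int (x d) * int (x (Suc d)))"
    for m
  have "D m \<ge> int (x m) * int (x m) \<and> ((\<exists>d\<in>{1..m}. x d \<noteq> 0) \<longrightarrow> D m > 0)" if "m \<ge> 1" for m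
    using that
  proof (induction m rule: dec_induct)
    case base
    show ?case by (auto simp: D_def)
  next
    case (step m)
    let ?a = "int (x m)" and ?b = "int (x (Suc m))"
    have D: "D (Suc m) = D m + 2 * ?b * ?b - 2 * ?a * ?b"
      using step.hyps(1) by (simp add: D_def algebra_simps)
    have sq: "(?a - ?b) * (?a - ?b) = ?a * ?a + ?b * ?b - 2 * ?a * ?b" by (simp add: algebra_simps)
    have ge: "D (Suc m) \<ge> ?b * ?b + (?a - ?b) * (?a - ?b)" using step.IH D sq by linarith
    have "D (Suc m) > 0" if "\<exists>d\<in>{1..Suc m}. x d \<noteq> 0"
    proof (cases "x (Suc m) = 0")
      case True
      then have "\<exists>d\<in>{1..m}. x d \<noteq> 0" using that atLeastAtMostSuc_conv[of 1 m] by auto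
      then show ?thesis using step.IH D True by simp
    next
      case False
      then have "?b * ?b > 0" by simp
      moreover have "(?a - ?b) * (?a - ?b) \<ge> 0" by simp
      ultimately show ?thesis using ge by linarith
    qed
    moreover have "D (Suc m) \<ge> ?b * ?b"
      using ge zero_le_square[of "?a - ?b"] by linarith
    ultimately show ?case by blast
  qed
  from this[of m] have "D m > 0" using assms by auto
  then have "int (\<Sum>d=1..<m. x d * x (Suc d)) < int (\<Sum>d=1..m. x d * x d)"
    by (simp add: D_def)
  then show ?thesis by (simp only: of_nat_less_iff)
qed

text \<open>Two representations \<open>K/M\<close> and \<open>T/J\<close> with the same nonzero dimension vector \<open>r\<close> admit a nonzero
  homomorphism: families of linear maps have \<open>\<Sum> r\<^sub>d\<^sup>2\<close> parameters, and compatibility with the arrows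
  imposes only \<open>\<Sum> r\<^sub>d r\<^sub>d\<^sub>+\<^sub>1\<close> linear conditions. The homomorphism is given by linear maps that
  vanish on \<open>M\<close> and are compatible modulo \<open>J\<close>.\<close>

lemma nonzero_hom:
  fixes K M T J :: "nat \<Rightarrow> cvec set"
  assumes KM: "\<And>d. d \<in> {1..m} \<Longrightarrow> cfun.subspace (M d) \<and> cfun.subspace (K d) \<and> M d \<subseteq> K d \<and> finite_dim (K d)"
    and TJ: "\<And>d. d \<in> {1..m} \<Longrightarrow> cfun.subspace (J d) \<and> cfun.subspace (T d) \<and> J d \<subseteq> T d \<and> finite_dim (T d)"
    and same_dim: "\<And>d. d \<in> {1..m} \<Longrightarrow> cfun.dim (K d) - cfun.dim (M d) = cfun.dim (T d) - cfun.dim (J d)"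
    and KS: "\<And>d. 1 \<le> d \<Longrightarrow> d < m \<Longrightarrow> K d \<subseteq> K (Suc d) \<and> M d \<subseteq> M (Suc d)"
    and \<tau>: "\<And>d. lin (\<tau> d)"
    and TS: "\<And>d. 1 \<le> d \<Longrightarrow> d < m \<Longrightarrow> \<tau> d ` T d \<subseteq> T (Suc d) \<and> \<tau> d ` J d \<subseteq> J (Suc d)"
    and nz: "\<exists>d\<in>{1..m}. cfun.dim (K d) - cfun.dim (M d) \<noteq> 0"
  obtains \<phi> :: "nat \<Rightarrow> cvec \<Rightarrow> cvec" where
    "\<And>d. d \<in> {1..m} \<Longrightarrow> lin (\<phi> d)"
    "\<And>d x. d \<in> {1..m} \<Longrightarrow> \<phi> d x \<in> T d"
    "\<And>d x. d \<in> {1..m} \<Longrightarrow> x \<in> M d \<Longrightarrow> \<phi> d x = 0"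
    "\<And>d x. 1 \<le> d \<Longrightarrow> d < m \<Longrightarrow> x \<in> K d \<Longrightarrow> \<tau> d (\<phi> d x) - \<phi> (Suc d) x \<in> J (Suc d)"
    "\<exists>d\<in>{1..m}. \<exists>x\<in>K d. \<phi> d x \<notin> J d"
proof -
  define r where "r d = cfun.dim (K d) - cfun.dim (M d)" for d
  define good where "good M K s \<beta> \<rho> \<longleftrightarrow> lin \<beta> \<and> lin \<rho> \<and> (\<forall>x\<in>M. \<beta> x = 0) \<and> (\<forall>x\<in>K. x - \<rho> (\<beta> x) \<in> M) \<and>
      (\<forall>w. \<rho> w \<in> K) \<and> (\<forall>k<s. \<beta> (\<rho> (ell k)) = ell k) \<and> (\<forall>x i. s \<le> i \<longrightarrow> \<beta> x i = 0)"
    for M K :: "cvec set" and s :: nat and \<beta> \<rho> :: "cvec \<Rightarrow> cvec"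
  have good: "\<exists>\<beta> \<rho>. good M K (cfun.dim K - cfun.dim M) \<beta> \<rho>"
    if "cfun.subspace M" "cfun.subspace K" "M \<subseteq> K" "finite_dim K" for M K
    using quotient_coordinates[OF that, of "\<exists>\<beta> \<rho>. good M K (cfun.dim K - cfun.dim M) \<beta> \<rho>"]
    unfolding good_def by blast
  have "\<forall>d\<in>{1..m}. \<exists>\<beta> \<rho>. good (M d) (K d) (r d) \<beta> \<rho>" using good KM unfolding r_def by blast
  then obtain \<beta> \<rho> where g1: "\<And>d. d \<in> {1..m} \<Longrightarrow> good (M d) (K d) (r d) (\<beta> d) (\<rho> d)" by metis
  have "\<forall>d\<in>{1..m}. \<exists>\<beta> \<rho>. good (J d) (T d) (r d) \<beta> \<rho>"
  proof
    fix d assume d: "d \<in> {1..m}"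
    show "\<exists>\<beta> \<rho>. good (J d) (T d) (r d) \<beta> \<rho>"
      unfolding r_def same_dim[OF d] using good TJ[OF d] by blast
  qed
  then obtain \<gamma> \<sigma> where g2: "\<And>d. d \<in> {1..m} \<Longrightarrow> good (J d) (T d) (r d) (\<gamma> d) (\<sigma> d)" by metis
  note g1' = g1[unfolded good_def] and g2' = g2[unfolded good_def]
  have l\<beta>: "lin (\<beta> d)" and l\<rho>: "lin (\<rho> d)" and l\<gamma>: "lin (\<gamma> d)" and l\<sigma>: "lin (\<sigma> d)"
    if "d \<in> {1..m}" for d using g1'[OF that] g2'[OF that] by blast+
  \<comment> \<open>The entry \<open>z (d, k, l)\<close> is the coefficient of the \<open>l\<close>-th basis vector of \<open>T/J\<close> in the image of the
    \<open>k\<close>-th basis vector of \<open>K/M\<close> at vertex \<open>d\<close>.\<close>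
  define \<Phi> where "\<Phi> z d w = (\<lambda>l. if l < r d then \<Sum>k<r d. z (d, k, l) * w k else 0)"
    for z :: "nat \<times> nat \<times> nat \<Rightarrow> complex" and d and w :: cvec
  have l\<Phi>: "lin (\<Phi> z d)" for z d
    by (rule linI) (auto simp: \<Phi>_def fun_eq_iff distrib_left sum.distrib sum_distrib_left
        mult.left_commute fscale_apply)
  have \<Phi>_add: "\<Phi> (z + z') d w = \<Phi> z d w + \<Phi> z' d w" for z z' d w
    by (auto simp: \<Phi>_def fun_eq_iff distrib_right sum.distrib)
  have \<Phi>_scale: "\<Phi> (fscale c z) d w = fscale c (\<Phi> z d w)" for c z d w
    by (auto simp: \<Phi>_def fun_eq_iff sum_distrib_left mult.assoc fscale_apply)
  have \<Phi>_ell: "\<Phi> z d (ell k) = (\<lambda>l. if l < r d then z (d, k, l) else 0)" if "k < r d" for z d k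
  proof
    fix l
    have "(\<Sum>j<r d. z (d, j, l) * ell k j) = (\<Sum>j<r d. if j = k then z (d, k, l) else 0)"
      by (intro sum.cong) (auto simp: ell_def)
    then show "\<Phi> z d (ell k) l = (if l < r d then z (d, k, l) else 0)"
      using that by (simp add: \<Phi>_def)
  qed
  \<comment> \<open>\<open>?A\<close> indexes the unknown entries. \<open>?B\<close> indexes the equations, which say that the two ways from
    \<open>K/M\<close> at \<open>d\<close> to \<open>T/J\<close> at \<open>Suc d\<close> agree on basis vectors.\<close>
  let ?A = "SIGMA d:{1..m}. {..<r d} \<times> {..<r d}"
  let ?B = "SIGMA d:{1..<m}. {..<r d} \<times> {..<r (Suc d)}"
  define F where "F z = (\<lambda>(d, k, l). if d \<in> {1..<m} then
      (\<gamma> (Suc d) (\<tau> d (\<sigma> d (\<Phi> z d (ell k)))) - \<Phi> z (Suc d) (\<beta> (Suc d) (\<rho> d (ell k)))) l else 0)" for z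
  have linF: "lin F"
  proof (rule linI)
    have in1: "d \<in> {1..m}" "Suc d \<in> {1..m}" if "d \<in> {1..<m}" for d using that by auto
    fix y z
    show "F (y + z) = F y + F z"
    proof
      fix t show "F (y + z) t = (F y + F z) t"
        by (cases t) (auto simp: F_def \<Phi>_add lin_add[OF \<tau>] lin_add[OF l\<sigma>[OF in1(1)]]
            lin_add[OF l\<gamma>[OF in1(2)]])
    qed
  next
    have in1: "d \<in> {1..m}" "Suc d \<in> {1..m}" if "d \<in> {1..<m}" for d using that by auto
    fix c z
    show "F (fscale c z) = fscale c (F z)"
    proof
      fix t show "F (fscale c z) t = fscale c (F z) t"
        by (cases t) (auto simp: F_def \<Phi>_scale lin_scale[OF \<tau>] lin_scale[OF l\<sigma>[OF in1(1)]]
            lin_scale[OF l\<gamma>[OF in1(2)]] fscale_apply right_diff_distrib)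
    qed
  qed
  have "card ?B < card ?A"
  proof -
    obtain d where "d \<in> {1..m}" "r d \<noteq> 0" using nz unfolding r_def by blast
    then show ?thesis using sum_squares_gt_sum_products[of d m r] by simp
  qed
  then obtain z where z: "z \<in> funs_on ?A" "z \<noteq> 0" "\<And>b. b \<in> ?B \<Longrightarrow> F z b = 0"
    using underdetermined_system[OF linF, of ?A ?B] by auto
  define \<phi> where "\<phi> d x = \<sigma> d (\<Phi> z d (\<beta> d x))" for d x
  show ?thesis
  proof (rule that[of \<phi>])
    fix d assume d: "d \<in> {1..m}"
    show "lin (\<phi> d)" unfolding \<phi>_def
      by (rule linI) (simp_all only: lin_add[OF l\<beta>[OF d]] lin_add[OF l\<sigma>[OF d]] lin_add[OF l\<Phi>]
          lin_scale[OF l\<beta>[OF d]] lin_scale[OF l\<sigma>[OF d]] lin_scale[OF l\<Phi>])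
    show "\<phi> d x \<in> T d" for x unfolding \<phi>_def using g2'[OF d] by blast
    show "\<phi> d x = 0" if "x \<in> M d" for x
    proof -
      have "\<beta> d x = 0" using g1'[OF d] that by blast
      then show ?thesis unfolding \<phi>_def by (simp only: lin_0[OF l\<Phi>] lin_0[OF l\<sigma>[OF d]])
    qed
  next
    fix d x assume d: "1 \<le> d" "d < m" and x: "x \<in> K d"
    have d1: "d \<in> {1..m}" and d2: "Suc d \<in> {1..m}" using d by auto
    let ?G = "\<lambda>w. \<gamma> (Suc d) (\<tau> d (\<sigma> d (\<Phi> z d w)))"
    let ?H = "\<lambda>w. \<Phi> z (Suc d) (\<beta> (Suc d) (\<rho> d w))"
    have lG: "lin ?G"
      by (rule linI) (simp_all only: lin_add[OF l\<gamma>[OF d2]] lin_add[OF \<tau>] lin_add[OF l\<sigma>[OF d1]] lin_add[OF l\<Phi>]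
          lin_scale[OF l\<gamma>[OF d2]] lin_scale[OF \<tau>] lin_scale[OF l\<sigma>[OF d1]] lin_scale[OF l\<Phi>])
    have lH: "lin ?H"
      by (rule linI) (simp_all only: lin_add[OF l\<beta>[OF d2]] lin_add[OF l\<rho>[OF d1]] lin_add[OF l\<Phi>]
          lin_scale[OF l\<beta>[OF d2]] lin_scale[OF l\<rho>[OF d1]] lin_scale[OF l\<Phi>])
    have GH: "?G (ell k) = ?H (ell k)" if k: "k < r d" for k
    proof
      fix l show "?G (ell k) l = ?H (ell k) l"
      proof (cases "l < r (Suc d)")
        case True
        then have "F z (d, k, l) = 0" using k d by (intro z(3)) auto
        then show ?thesis using d by (simp add: F_def)
      next
        case False
        then have "?G (ell k) l = 0" using g2'[OF d2] by simp
        then show ?thesis using False by (simp add: \<Phi>_def)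
      qed
    qed
    have supp: "w \<in> cfun.span (ell ` {..<s})" if "\<And>i. s \<le> i \<Longrightarrow> w i = 0" for w s
      using that span_ell[of "{..<s}"] by auto
    have "\<beta> d x \<in> cfun.span (ell ` {..<r d})"
      by (rule supp) (use g1'[OF d1] in blast)
    then have GHx: "?G (\<beta> d x) = ?H (\<beta> d x)"
      by (rule cpair.linear_eq_on[OF lG lH]) (use GH in auto)
    have "\<beta> (Suc d) (\<rho> d (\<beta> d x)) = \<beta> (Suc d) x"
    proof -
      have "x - \<rho> d (\<beta> d x) \<in> M (Suc d)" using g1'[OF d1] KS[OF d] x by blast
      then have "\<beta> (Suc d) (x - \<rho> d (\<beta> d x)) = 0" using g1'[OF d2] by blast
      then show ?thesis by (simp add: lin_diff[OF l\<beta>[OF d2]])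
    qed
    then have H: "?H (\<beta> d x) = \<Phi> z (Suc d) (\<beta> (Suc d) x)" by simp
    have \<gamma>\<sigma>: "\<gamma> (Suc d) (\<sigma> (Suc d) w) = w" if "w \<in> cfun.span (ell ` {..<r (Suc d)})" for w
    proof (rule cpair.linear_eq_on[OF _ _ that])
      show "lin (\<lambda>w. \<gamma> (Suc d) (\<sigma> (Suc d) w))"
        by (rule linI) (simp_all only: lin_add[OF l\<gamma>[OF d2]] lin_add[OF l\<sigma>[OF d2]]
            lin_scale[OF l\<gamma>[OF d2]] lin_scale[OF l\<sigma>[OF d2]])
      show "lin (\<lambda>w :: cvec. w)" by (rule linI) simp_all
    qed (use g2'[OF d2] in auto)
    have "\<gamma> (Suc d) (\<phi> (Suc d) x) = \<Phi> z (Suc d) (\<beta> (Suc d) x)"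
      unfolding \<phi>_def by (intro \<gamma>\<sigma> supp) (simp add: \<Phi>_def)
    then have "\<gamma> (Suc d) (\<tau> d (\<phi> d x) - \<phi> (Suc d) x) = 0"
      using GHx H by (simp add: lin_diff[OF l\<gamma>[OF d2]] \<phi>_def)
    moreover have "\<tau> d (\<phi> d x) - \<phi> (Suc d) x \<in> T (Suc d)"
    proof (rule cfun.subspace_diff)
      show "cfun.subspace (T (Suc d))" using TJ[OF d2] by blast
      show "\<tau> d (\<phi> d x) \<in> T (Suc d)" using TS[OF d] g2'[OF d1] unfolding \<phi>_def by blast
      show "\<phi> (Suc d) x \<in> T (Suc d)" using g2'[OF d2] unfolding \<phi>_def by blast
    qed
    ultimately show "\<tau> d (\<phi> d x) - \<phi> (Suc d) x \<in> J (Suc d)"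
      using g2'[OF d2] lin_0[OF l\<sigma>[OF d2]] by (metis diff_zero)
  next
    obtain t where t: "z t \<noteq> 0" using z(2) by (auto simp: fun_eq_iff)
    moreover obtain d k l where "t = (d, k, l)" by (cases t)
    ultimately have zd: "z (d, k, l) \<noteq> 0" "d \<in> {1..m}" "k < r d" "l < r d"
      using z(1) unfolding funs_on_def by auto
    let ?x = "\<rho> d (ell k)"
    have "\<phi> d ?x \<notin> J d"
    proof
      assume "\<phi> d ?x \<in> J d"
      then have "\<gamma> d (\<phi> d ?x) = 0" using g2'[OF zd(2)] by blast
      moreover have "\<beta> d ?x = ell k" using g1'[OF zd(2)] zd(3) by blast
      moreover have "\<gamma> d (\<sigma> d w) = w" if "w \<in> cfun.span (ell ` {..<r d})" for w
      proof (rule cpair.linear_eq_on[OF _ _ that])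
        show "lin (\<lambda>w. \<gamma> d (\<sigma> d w))"
          by (rule linI) (simp_all only: lin_add[OF l\<gamma>[OF zd(2)]] lin_add[OF l\<sigma>[OF zd(2)]]
              lin_scale[OF l\<gamma>[OF zd(2)]] lin_scale[OF l\<sigma>[OF zd(2)]])
        show "lin (\<lambda>w :: cvec. w)" by (rule linI) simp_all
      qed (use g2'[OF zd(2)] in auto)
      moreover have "\<Phi> z d (ell k) \<in> cfun.span (ell ` {..<r d})"
        using span_ell[of "{..<r d}"] by (auto simp: \<Phi>_def)
      ultimately have "\<Phi> z d (ell k) = 0" unfolding \<phi>_def by metis
      then have "\<Phi> z d (ell k) l = 0" by simp
      then show False using zd by (simp add: \<Phi>_ell)
    qed
    moreover have "?x \<in> K d" using g1'[OF zd(2)] by blast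
    ultimately show "\<exists>d\<in>{1..m}. \<exists>x\<in>K d. \<phi> d x \<notin> J d" using zd(2) by blast
  qed
qed

section \<open>Degenerating partial graphs to an arbitrary flag\<close>

text \<open>As long as \<open>N_P\<close> is smaller than \<open>K\<close>, there is a nonzero homomorphism \<open>K/N_P \<rightarrow> N_I/J\<close>, since both
  sides have the same dimension vector. It is induced by a matrix: a section of the preimage of its
  graph in \<open>K \<oplus> I\<close> is one.\<close>

lemma exists_matrix_between:
  assumes KJ: "sub_pair n K J" and U: "U \<in> flag_variety n"
    and JU: "\<And>d. d \<in> {1..n-1} \<Longrightarrow> J d \<subseteq> U d" and UK: "\<And>d. d \<in> {1..n-1} \<Longrightarrow> NP n U d \<subseteq> K d"
    and ne: "d0 \<in> {1..n-1}" "NP n U d0 \<noteq> K d0"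
  obtains h where "h \<in> nminus n"
    "\<And>d x. d \<in> {1..n-1} \<Longrightarrow> x \<in> K d \<Longrightarrow> fblock n h d x \<in> NI n U d"
    "\<And>d x. d \<in> {1..n-1} \<Longrightarrow> x \<in> NP n U d \<Longrightarrow> fblock n h d x \<in> J d"
    "\<exists>d\<in>{1..n-1}. \<exists>x\<in>K d. fblock n h d x \<notin> J d"
proof -
  note sc = flag_sub_chain[OF U]
  have sub: "cfun.subspace (U d)" "U d \<subseteq> L n" if "d \<in> {1..n-1}" for d
    using sc that unfolding sub_chain_def by auto
  have P: "cfun.subspace (NP n U d)" "cfun.subspace (NI n U d)" if "d \<in> {1..n-1}" for d
    using subspace_NP[of d n U] subspace_NI[of d n U] sub[OF that] that by blast+
  have JN: "J d \<subseteq> NI n U d" if "d \<in> {1..n-1}" for d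
    using JU[OF that] sub_pairD(4)[OF KJ that] mem_NI[OF that] by blast
  have fN: "finite_dim (NI n U d)" if "d \<in> {1..n-1}" for d
    using finite_dim_L[of "NI n U d" n] sub[OF that] mem_NI[OF that] by blast
  have eq: "cfun.dim (K d) + cfun.dim (J d) = cfun.dim (NI n U d) + cfun.dim (NP n U d)"
    if "d \<in> {1..n-1}" for d
    using sub_pairD(5)[OF KJ that] dim_NP_NI[where U = U, OF that] sub[OF that] flag_dim[OF U that] by simp
  have le: "cfun.dim (NP n U d) \<le> cfun.dim (K d)" if "d \<in> {1..n-1}" for d
    using dim_mono_finite_dim sub_pairD(1,6)[OF KJ that] P(1)[OF that] UK[OF that] by blast
  have step: "d \<in> {1..n-2}" if "1 \<le> d" "d < n - 1" for d using that by auto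
  obtain \<phi> :: "nat \<Rightarrow> cvec \<Rightarrow> cvec" where
    l\<phi>: "\<And>d. d \<in> {1..n-1} \<Longrightarrow> lin (\<phi> d)" and
    \<phi>I: "\<And>d x. d \<in> {1..n-1} \<Longrightarrow> \<phi> d x \<in> NI n U d" and
    \<phi>0: "\<And>d x. d \<in> {1..n-1} \<Longrightarrow> x \<in> NP n U d \<Longrightarrow> \<phi> d x = 0" and
    \<phi>S: "\<And>d x. 1 \<le> d \<Longrightarrow> d < n-1 \<Longrightarrow> x \<in> K d \<Longrightarrow> pr (d+1) (\<phi> d x) - \<phi> (Suc d) x \<in> J (Suc d)" and
    \<phi>J: "\<exists>d\<in>{1..n-1}. \<exists>x\<in>K d. \<phi> d x \<notin> J d"
  proof (rule nonzero_hom[of "n-1" "NP n U" K J "NI n U" "\<lambda>d. pr (d+1)"])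
    show "cfun.subspace (NP n U d) \<and> cfun.subspace (K d) \<and> NP n U d \<subseteq> K d \<and> finite_dim (K d)"
      if "d \<in> {1..n-1}" for d using P[OF that] sub_pairD[OF KJ that] UK[OF that] by blast
    show "cfun.subspace (J d) \<and> cfun.subspace (NI n U d) \<and> J d \<subseteq> NI n U d \<and> finite_dim (NI n U d)"
      if "d \<in> {1..n-1}" for d using P[OF that] sub_pairD[OF KJ that] JN[OF that] fN[OF that] by blast
    show "cfun.dim (K d) - cfun.dim (NP n U d) = cfun.dim (NI n U d) - cfun.dim (J d)"
      if "d \<in> {1..n-1}" for d using eq[OF that] le[OF that] by linarith
    show "K d \<subseteq> K (Suc d) \<and> NP n U d \<subseteq> NP n U (Suc d)" if "1 \<le> d" "d < n-1" for d
      using KJ NP_mono[OF sc step[OF that]] step[OF that] unfolding sub_pair_def by simp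
    show "pr (d+1) ` NI n U d \<subseteq> NI n U (Suc d) \<and> pr (d+1) ` J d \<subseteq> J (Suc d)"
      if "1 \<le> d" "d < n-1" for d
      using KJ NI_pr[OF sc step[OF that]] step[OF that] unfolding sub_pair_def by simp
    show "\<exists>d\<in>{1..n-1}. cfun.dim (K d) - cfun.dim (NP n U d) \<noteq> 0"
    proof
      have "cfun.dim (K d0) \<noteq> cfun.dim (NP n U d0)"
        using subspace_dim_eq[OF sub_pairD(6)[OF KJ ne(1)] P(1)[OF ne(1)] sub_pairD(1)[OF KJ ne(1)]
            UK[OF ne(1)]] ne(2) by metis
      then show "cfun.dim (K d0) - cfun.dim (NP n U d0) \<noteq> 0" using le[OF ne(1)] by simp
    qed (rule ne(1))
    show "lin (pr (d+1))" for d by (rule lin_pr)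
  qed blast
  \<comment> \<open>The preimage in \<open>K \<oplus> I\<close> of the graph of \<open>\<phi>\<close>.\<close>
  let ?W = "\<lambda>d. {x + y | x y. x \<in> (\<lambda>x. x + \<phi> d x) ` K d \<and> y \<in> J d}"
  have "sub_chain n ?W" unfolding sub_chain_def
  proof (intro conjI ballI)
    fix d assume d: "d \<in> {1..n-1}"
    note D = sub_pairD[OF KJ d]
    have "lin (\<lambda>x. x + \<phi> d x)"
      by (rule linI) (simp_all only: lin_add[OF l\<phi>[OF d]] lin_scale[OF l\<phi>[OF d]]
          cfun.scale_right_distrib ac_simps)
    then show "cfun.subspace (?W d)" using D by (intro cfun.subspace_sums subspace_image)
    have "\<phi> d x \<in> L n" for x using \<phi>I[OF d, of x] mem_NI[OF d] sub[OF d] by blast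
    then have "x + \<phi> d x + y \<in> L n" if "x \<in> K d" "y \<in> J d" for x y
      using that D by (intro cfun.subspace_add subspace_L) auto
    then show "?W d \<subseteq> L n" by blast
  next
    fix d assume d: "d \<in> {1..n-2}"
    then have d1: "d \<in> {1..n-1}" and d': "1 \<le> d" "d < n-1" and d2: "d + 1 \<in> {1..n-1}" by auto
    show "pr (d+1) ` ?W d \<subseteq> ?W (d+1)"
    proof
      fix v assume "v \<in> pr (d+1) ` ?W d"
      then obtain x y where xy: "x \<in> K d" "y \<in> J d" "v = pr (d+1) (x + \<phi> d x + y)" by auto
      have x: "x \<in> Lminus d" using xy(1) sub_pairD(2)[OF KJ d1] by blast
      let ?z = "pr (d+1) (\<phi> d x) - \<phi> (d+1) x"
      have "v = x + \<phi> (d+1) x + (?z + pr (d+1) y)"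
        using xy(3) by (simp add: pr_add pr_Lminus[OF x, simplified])
      moreover have "?z \<in> J (d+1)" using \<phi>S[OF d' xy(1)] by simp
      moreover have "pr (d+1) y \<in> J (d+1)" "x \<in> K (d+1)"
        using KJ d xy unfolding sub_pair_def by blast+
      ultimately show "v \<in> ?W (d+1)"
        using cfun.subspace_add[OF sub_pairD(3)[OF KJ d2]] by blast
    qed
  qed
  then obtain h where h: "h \<in> nminus n"
    "\<And>d x. d \<in> {1..n-1} \<Longrightarrow> x \<in> NP n ?W d \<Longrightarrow> x + fblock n h d x \<in> ?W d"
    using exists_section by blast
  have hJ: "fblock n h d x - \<phi> d x \<in> J d" if d: "d \<in> {1..n-1}" and x: "x \<in> K d" for d x
  proof -
    note D = sub_pairD[OF KJ d]
    have \<phi>L: "\<phi> d x \<in> Lplus n d" for x using \<phi>I[OF d] mem_NI[OF d] by blast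
    have "x + \<phi> d x + 0 \<in> ?W d" using x cfun.subspace_0[OF D(3)] by blast
    then have "x \<in> NP n ?W d" unfolding mem_NP[OF d] using D(2) x \<phi>L[of x] by auto
    then obtain x' y where xy: "x' \<in> K d" "y \<in> J d" "x + fblock n h d x = x' + \<phi> d x' + y"
      using h(2)[OF d] by blast
    have L: "\<phi> d x' + y \<in> Lplus n d"
      using \<phi>L[of x'] D(4) xy(2) by (intro cfun.subspace_add subspace_L) auto
    have e: "x + fblock n h d x = x' + (\<phi> d x' + y)" using xy(3) by (simp add: add.assoc)
    have "x = x'" "fblock n h d x = \<phi> d x' + y"
      using split_unique[OF _ _ fblock_Lplus L e] D(2) x xy(1) by blast+
    then show ?thesis using xy(2) by simp
  qed
  show ?thesis
  proof (rule that[OF h(1)])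
    fix d x assume d: "d \<in> {1..n-1}"
    show "fblock n h d x \<in> NI n U d" if "x \<in> K d"
      using cfun.subspace_add[OF P(2)[OF d] subsetD[OF JN[OF d] hJ[OF d that]] \<phi>I[OF d, of x]] by simp
    show "fblock n h d x \<in> J d" if "x \<in> NP n U d"
      using hJ[OF d, of x] \<phi>0[OF d that] UK[OF d] that by auto
  next
    obtain d x where dx: "d \<in> {1..n-1}" "x \<in> K d" "\<phi> d x \<notin> J d" using \<phi>J by blast
    have "fblock n h d x \<notin> J d"
    proof
      assume "fblock n h d x \<in> J d"
      then have "fblock n h d x - (fblock n h d x - \<phi> d x) \<in> J d"
        using hJ[OF dx(1,2)] cfun.subspace_diff[OF sub_pairD(3)[OF KJ dx(1)]] by blast
      then show False using dx(3) by simp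
    qed
    then show "\<exists>d\<in>{1..n-1}. \<exists>x\<in>K d. fblock n h d x \<notin> J d" using dx by blast
  qed
qed

text \<open>The kernel and the image of the homomorphism \<open>K \<rightarrow> I/J\<close> induced by \<open>h\<close>, the image being replaced by
  its preimage in \<open>I\<close>.\<close>

definition next_kernel ::
    "nat \<Rightarrow> (nat \<times> nat \<Rightarrow> complex) \<Rightarrow> (nat \<Rightarrow> cvec set) \<Rightarrow> (nat \<Rightarrow> cvec set) \<Rightarrow> nat \<Rightarrow> cvec set" where
  "next_kernel n h K J d = {x \<in> K d. fblock n h d x \<in> J d}"

definition next_image ::
    "nat \<Rightarrow> (nat \<times> nat \<Rightarrow> complex) \<Rightarrow> (nat \<Rightarrow> cvec set) \<Rightarrow> (nat \<Rightarrow> cvec set) \<Rightarrow> nat \<Rightarrow> cvec set" where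
  "next_image n h K J d = {x + y | x y. x \<in> fblock n h d ` K d \<and> y \<in> J d}"

lemma sub_pair_next:
  assumes KJ: "sub_pair n K J"
  shows "sub_pair n (next_kernel n h K J) (next_image n h K J)"
  unfolding sub_pair_def
proof (rule conjI; rule ballI)
  fix d assume d: "d \<in> {1..n-1}"
  note D = sub_pairD[OF KJ d]
  obtain F :: "cvec \<Rightarrow> cvec" where F: "lin F" "\<And>x. F x = 0 \<longleftrightarrow> x \<in> J d"
    using exists_linear_with_kernel[OF D(3)] by blast
  have l: "lin (\<lambda>x. F (fblock n h d x))"
    by (rule linI) (simp_all only: lin_add[OF F(1)] lin_scale[OF F(1)] fblock_add fblock_scale)
  have K2: "next_kernel n h K J d = {x \<in> K d. F (fblock n h d x) = 0}"
    by (simp add: next_kernel_def F(2))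
  have J2: "cfun.subspace (next_image n h K J d)"
    unfolding next_image_def using D by (intro cfun.subspace_sums subspace_image lin_fblock)
  have J2L: "next_image n h K J d \<subseteq> Lplus n d"
    unfolding next_image_def using fblock_Lplus D(4) subspace_L(3)[of n d]
    by (auto intro!: cfun.subspace_add)
  have 0: "0 \<in> K d" "0 \<in> J d" using D cfun.subspace_0 by blast+
  have "J d \<subseteq> next_image n h K J d"
    unfolding next_image_def using 0 fblock_0[of n h d] by force
  then have ker: "{x \<in> next_image n h K J d. F x = 0} = J d" using F(2) by blast
  have im: "F ` next_image n h K J d = (\<lambda>x. F (fblock n h d x)) ` K d"
  proof (intro set_eqI iffI)
    fix v assume "v \<in> F ` next_image n h K J d"
    then obtain x y where x: "x \<in> K d" "y \<in> J d" "v = F (fblock n h d x + y)"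
      unfolding next_image_def by blast
    then have "F y = 0" using F(2) by blast
    then show "v \<in> (\<lambda>x. F (fblock n h d x)) ` K d" using x by (auto simp: lin_add[OF F(1)])
  next
    fix v assume "v \<in> (\<lambda>x. F (fblock n h d x)) ` K d"
    then obtain x where x: "x \<in> K d" "v = F (fblock n h d x)" by blast
    moreover have "fblock n h d x + 0 \<in> next_image n h K J d"
      unfolding next_image_def using x 0 by blast
    ultimately show "v \<in> F ` next_image n h K J d" by auto
  qed
  have "finite_dim (next_image n h K J d)"
    using finite_dim_L[of "next_image n h K J d" n] J2L Lplus_subset[of n d] by blast
  then have "cfun.dim (next_image n h K J d) =
      cfun.dim (J d) + cfun.dim ((\<lambda>x. F (fblock n h d x)) ` K d)"
    using rank_nullity[OF F(1) J2] ker im by simp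
  moreover have "cfun.dim (K d) =
      cfun.dim (next_kernel n h K J d) + cfun.dim ((\<lambda>x. F (fblock n h d x)) ` K d)"
    using rank_nullity[OF l D(1,6)] K2 by simp
  ultimately have "cfun.dim (next_kernel n h K J d) + cfun.dim (next_image n h K J d) = d"
    using D(5) by simp
  moreover have "cfun.subspace (next_kernel n h K J d)"
    unfolding K2 by (rule subspace_kernel_on[OF l D(1)])
  moreover have "next_kernel n h K J d \<subseteq> Lminus d" using D(2) by (auto simp: next_kernel_def)
  ultimately show "cfun.subspace (next_kernel n h K J d) \<and> next_kernel n h K J d \<subseteq> Lminus d \<and>
      cfun.subspace (next_image n h K J d) \<and> next_image n h K J d \<subseteq> Lplus n d \<and>
      cfun.dim (next_kernel n h K J d) + cfun.dim (next_image n h K J d) = d"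
    using J2 J2L by blast
next
  fix d assume d: "d \<in> {1..n-2}"
  then have d1: "d \<in> {1..n-1}" by auto
  have s: "K d \<subseteq> K (d+1)" "pr (d+1) ` J d \<subseteq> J (d+1)" using KJ d unfolding sub_pair_def by blast+
  have pr_fb: "pr (d+1) (fblock n h d x) = fblock n h (d+1) x" if "x \<in> K d" for x
    using pr_fblock sub_pairD(2)[OF KJ d1] that by blast
  have "next_kernel n h K J d \<subseteq> next_kernel n h K J (d+1)"
  proof
    fix x assume "x \<in> next_kernel n h K J d"
    then have x: "x \<in> K d" "fblock n h d x \<in> J d" unfolding next_kernel_def by auto
    then show "x \<in> next_kernel n h K J (d+1)"
      unfolding next_kernel_def using s pr_fb[OF x(1)] by force
  qed
  moreover have "pr (d+1) ` next_image n h K J d \<subseteq> next_image n h K J (d+1)"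
  proof
    fix v assume "v \<in> pr (d+1) ` next_image n h K J d"
    then obtain x y where xy: "x \<in> K d" "y \<in> J d" "v = pr (d+1) (fblock n h d x + y)"
      unfolding next_image_def by blast
    then have "v = fblock n h (d+1) x + pr (d+1) y" by (simp only: pr_add pr_fb[OF xy(1)])
    then show "v \<in> next_image n h K J (d+1)" unfolding next_image_def using s xy by blast
  qed
  ultimately show "next_kernel n h K J d \<subseteq> next_kernel n h K J (d+1) \<and>
      pr (d+1) ` next_image n h K J d \<subseteq> next_image n h K J (d+1)" by blast
qed

text \<open>A form of closedness for sets of flags that tests only limits at \<open>s = 0\<close> along families in which
  every vector of the limit is moved along an affine line. It suffices for the degenerations below
  and does not mention coordinates.\<close>

definition line_closed :: "nat \<Rightarrow> (nat \<Rightarrow> cvec set) set \<Rightarrow> bool" where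
  "line_closed n G \<longleftrightarrow> (\<forall>U0 Us. U0 \<in> flag_variety n \<longrightarrow> (\<forall>s. s \<noteq> 0 \<longrightarrow> Us s \<in> G) \<longrightarrow>
     (\<forall>d\<in>{1..n-1}. \<forall>u\<in>U0 d. \<exists>u1. \<forall>s. s \<noteq> 0 \<longrightarrow> u + fscale s u1 \<in> Us s d) \<longrightarrow> U0 \<in> G)"

text \<open>Scaling \<open>h\<close> by \<open>1/s\<close> and letting \<open>s\<close> tend to \<open>0\<close> degenerates the graph over \<open>(K, J)\<close> to the graph over
  the kernel and the image of \<open>h\<close>: a vector \<open>x\<close> of the kernel keeps its value \<open>c x\<close> modulo \<open>J\<close>, while the
  value at \<open>s y\<close> is \<open>s (c y) + h y\<close>, which tends to \<open>h y\<close>.\<close>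

lemma partial_graph_approach:
  assumes KJ: "sub_pair n K J" and d: "d \<in> {1..n-1}"
    and u: "u \<in> partial_graph n (next_kernel n h K J) (next_image n h K J) c d"
  shows "\<exists>u1. \<forall>s. s \<noteq> 0 \<longrightarrow>
     u + fscale s u1 \<in> partial_graph n K J (c + fscale (inverse s) h) d"
proof -
  note D = sub_pairD[OF KJ d]
  obtain x y z where x: "x \<in> K d" "fblock n h d x \<in> J d" and y: "y \<in> K d" and z: "z \<in> J d"
    and ueq: "u = x + fblock n c d x + (fblock n h d y + z)"
  proof -
    obtain x w where x: "x \<in> next_kernel n h K J d" "w \<in> next_image n h K J d"
        "u = x + fblock n c d x + w"
      using u mem_partial_graph[OF d] by blast
    moreover from x(2) obtain y z where "y \<in> K d" "z \<in> J d" "w = fblock n h d y + z"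
      unfolding next_image_def by blast
    ultimately show thesis using that by (auto simp: next_kernel_def)
  qed
  have "u + fscale s (y + fblock n c d y) \<in> partial_graph n K J (c + fscale (inverse s) h) d"
    if s: "s \<noteq> 0" for s
  proof -
    \<comment> \<open>The term \<open>h x / s\<close> diverges but lies in \<open>J\<close>, so the \<open>J\<close>-component absorbs it.\<close>
    let ?x = "x + fscale s y" and ?y = "z - fscale (inverse s) (fblock n h d x)"
    have "?x \<in> K d" using x y D(1) by (simp add: cfun.subspace_add cfun.subspace_scale)
    moreover have "?y \<in> J d" using x z D(3) by (simp add: cfun.subspace_diff cfun.subspace_scale)
    moreover have "u + fscale s (y + fblock n c d y) =
        ?x + fblock n (c + fscale (inverse s) h) d ?x + ?y"
    proof
      fix i
      show "(u + fscale s (y + fblock n c d y)) i =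
        (?x + fblock n (c + fscale (inverse s) h) d ?x + ?y) i"
        using s unfolding ueq fblock_add_matrix fblock_scale_matrix fblock_add fblock_scale
        by (simp add: fscale_apply field_simps)
    qed
    ultimately show ?thesis unfolding mem_partial_graph[OF d] by blast
  qed
  then show ?thesis by blast
qed

lemma nminus_add_scale: "f \<in> nminus n \<Longrightarrow> g \<in> nminus n \<Longrightarrow> f + fscale c g \<in> nminus n"
  by (auto simp: nminus_def fscale_apply) (metis add_0 mult_zero_right)+

text \<open>Partial graphs over \<open>(K, J)\<close> degenerate to every flag between \<open>J\<close> and \<open>K \<oplus> I\<close>. If \<open>N_P = K\<close>, a section
  shows that \<open>U\<close> is itself a partial graph. Otherwise pass to the kernel and the image of a nonzero
  homomorphism \<open>K/N_P \<rightarrow> N_I/J\<close>; this makes \<open>K\<close> smaller and \<open>U\<close> stays in between.\<close>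

lemma partial_graphs_dense:
  assumes "line_closed n G" "U \<in> flag_variety n" "sub_pair n K J"
    and "\<And>d. d \<in> {1..n-1} \<Longrightarrow> J d \<subseteq> U d" "\<And>d. d \<in> {1..n-1} \<Longrightarrow> NP n U d \<subseteq> K d"
    and "\<And>f. f \<in> nminus n \<Longrightarrow> partial_graph n K J f \<in> G"
  shows "U \<in> G"
  using assms(3-)
proof (induction "\<Sum>d\<in>{1..n-1}. cfun.dim (K d)" arbitrary: K J rule: less_induct)
  case less
  note KJ = less.prems(1)
  note sc = flag_sub_chain[OF assms(2)]
  show ?case
  proof (cases "\<forall>d\<in>{1..n-1}. NP n U d = K d")
    case True
    obtain f where f: "f \<in> nminus n"
      "\<And>d x. d \<in> {1..n-1} \<Longrightarrow> x \<in> NP n U d \<Longrightarrow> x + fblock n f d x \<in> U d"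
      using exists_section[OF sc] by blast
    have "U d = partial_graph n K J f d" for d
    proof (cases "d \<in> {1..n-1}")
      case d: True
      note D = sub_pairD[OF KJ d]
      have sub: "cfun.subspace (U d)" "U d \<subseteq> L n"
        using sc d unfolding sub_chain_def by auto
      have "partial_graph n K J f d \<subseteq> U d"
      proof
        fix u assume "u \<in> partial_graph n K J f d"
        then obtain x y where "x \<in> K d" "y \<in> J d" "u = x + fblock n f d x + y"
          using mem_partial_graph[OF d] by blast
        then show "u \<in> U d"
          using f(2)[OF d] True d less.prems(2)[OF d] cfun.subspace_add[OF sub(1)] by blast
      qed
      moreover have "partial_graph n K J f \<in> flag_variety n" by (rule partial_graph_flag[OF KJ])
      ultimately have "partial_graph n K J f d = U d"
        using flag_dim[OF assms(2) d] flag_dim[of "partial_graph n K J f" n d] d sub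
          flag_sub_chain[of "partial_graph n K J f" n]
        by (intro subspace_dim_eq finite_dim_L) (auto simp: sub_chain_def)
      then show ?thesis ..
    next
      case False
      then show ?thesis using assms(2)
        by (auto simp: flag_variety_def partial_graph_def PiE_def extensional_def)
    qed
    then have "U = partial_graph n K J f" by blast
    then show ?thesis using less.prems(4)[OF f(1)] by metis
  next
    case False
    then obtain d0 where d0: "d0 \<in> {1..n-1}" "NP n U d0 \<noteq> K d0" by blast
    obtain h where h: "h \<in> nminus n"
      "\<And>d x. d \<in> {1..n-1} \<Longrightarrow> x \<in> K d \<Longrightarrow> fblock n h d x \<in> NI n U d"
      "\<And>d x. d \<in> {1..n-1} \<Longrightarrow> x \<in> NP n U d \<Longrightarrow> fblock n h d x \<in> J d"
      "\<exists>d\<in>{1..n-1}. \<exists>x\<in>K d. fblock n h d x \<notin> J d"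
      using exists_matrix_between[OF KJ assms(2) less.prems(2,3) d0] by blast
    let ?K = "next_kernel n h K J" and ?J = "next_image n h K J"
    have KJ2: "sub_pair n ?K ?J" by (rule sub_pair_next[OF KJ])
    have sub: "?K d \<subseteq> K d" for d by (auto simp: next_kernel_def)
    have le: "cfun.dim (?K d) \<le> cfun.dim (K d)" if "d \<in> {1..n-1}" for d
      using dim_mono_finite_dim[OF sub_pairD(6)[OF KJ that] sub_pairD(1)[OF KJ2 that] sub_pairD(1)[OF KJ that] sub] .
    obtain d x where dx: "d \<in> {1..n-1}" "x \<in> K d" "fblock n h d x \<notin> J d" using h(4) by blast
    have "?K d \<noteq> K d" using dx by (auto simp: next_kernel_def)
    then have "cfun.dim (?K d) \<noteq> cfun.dim (K d)"
      using subspace_dim_eq[OF sub_pairD(6)[OF KJ dx(1)] sub_pairD(1)[OF KJ2 dx(1)]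
          sub_pairD(1)[OF KJ dx(1)] sub] by blast
    then have "cfun.dim (?K d) < cfun.dim (K d)" using le[OF dx(1)] by simp
    then have lt: "(\<Sum>d\<in>{1..n-1}. cfun.dim (?K d)) < (\<Sum>d\<in>{1..n-1}. cfun.dim (K d))"
      using le dx(1) by (intro sum_strict_mono_ex1) auto
    show ?thesis
    proof (rule less.hyps[OF lt KJ2])
      fix d assume d: "d \<in> {1..n-1}"
      have "cfun.subspace (U d)" using sc d unfolding sub_chain_def by auto
      then show "?J d \<subseteq> U d"
        unfolding next_image_def using h(2)[OF d] less.prems(2)[OF d] mem_NI[OF d]
        by (auto intro!: cfun.subspace_add)
      show "NP n U d \<subseteq> ?K d"
        unfolding next_kernel_def using h(3)[OF d] less.prems(3)[OF d] by blast
    next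
      fix f assume f: "f \<in> nminus n"
      let ?Us = "\<lambda>s. partial_graph n K J (f + fscale (inverse s) h)"
      have "?Us s \<in> G" for s by (rule less.prems(4)[OF nminus_add_scale[OF f h(1)]])
      then show "partial_graph n ?K ?J f \<in> G"
        using assms(1)[unfolded line_closed_def, rule_format, of "partial_graph n ?K ?J f" ?Us]
          partial_graph_flag[OF KJ2] partial_graph_approach[OF KJ] by blast
    qed
  qed
qed

section \<open>Homogeneous coordinates on the ambient space\<close>

lemma topspace_zariski: "topspace (zariski A) = points A"
proof
  show "topspace (zariski A) \<subseteq> points A"
    unfolding topspace_def openin_zariski by (auto simp: zariski_open_def)
  have "zariski_open A (points A)"
    unfolding zariski_open_def points_def
    by (intro conjI exI[of _ "{\<lambda>_. 1}"]) (auto intro: polyfun.const)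
  then show "points A \<subseteq> topspace (zariski A)"
    unfolding topspace_def openin_zariski by blast
qed

lemma polyfun_tendsto:
  assumes "p \<in> polyfun G" "\<And>g. g \<in> G \<Longrightarrow> ((\<lambda>s. g (c s)) \<longlongrightarrow> g c0) F"
  shows "((\<lambda>s. p (c s)) \<longlongrightarrow> p c0) F"
  using assms(1) by induction (auto intro: tendsto_add tendsto_mult assms(2))

lemma polyfun_sum:
  assumes "finite A" "\<And>a. a \<in> A \<Longrightarrow> (\<lambda>c. f a c) \<in> polyfun G"
  shows "(\<lambda>c. \<Sum>a\<in>A. f a c) \<in> polyfun G"
  using assms
proof (induction A rule: finite_induct)
  case empty
  then show ?case using polyfun.const[of 0 G] by simp
next
  case (insert a A)
  then show ?case using polyfun.add[of "f a" G "\<lambda>c. \<Sum>a\<in>A. f a c"] by simp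
qed

abbreviation mat :: "((nat \<times> nat) option \<Rightarrow> complex) \<Rightarrow> nat \<times> nat \<Rightarrow> complex" where
  "mat w \<equiv> \<lambda>ij. w (Some ij)"

lemma V_simps [simp]:
  "w \<in> car (V n) \<longleftrightarrow> mat w \<in> nminus n" "vzero (V n) = 0" "vadd (V n) = (+)" "vscl (V n) = fscale"
  by (simp_all add: V_def fspace_def)

lemma line_V: "line (V n) w = range (\<lambda>c. fscale c w)"
  by (simp add: line_def)

lemma line_self: "w \<in> line (V n) w"
  unfolding line_V by (rule image_eqI[of _ _ 1]) simp_all

lemma line_scale:
  assumes "s \<noteq> 0"
  shows "line (V n) (fscale s w) = line (V n) w"
proof -
  have "fscale c w \<in> range (\<lambda>c. fscale c (fscale s w))" for c
    by (rule image_eqI[of _ _ "c / s"]) (use assms in simp_all)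
  moreover have "fscale c (fscale s w) \<in> range (\<lambda>c. fscale c w)" for c
    by (rule image_eqI[of _ _ "c * s"]) simp_all
  ultimately show ?thesis unfolding line_V by blast
qed

definition frames :: "nat \<Rightarrow> nat \<Rightarrow> (nat \<Rightarrow> cvec) set" where
  "frames n d = {B \<in> {1..d} \<rightarrow>\<^sub>E L n. indep_fam d (\<lambda>a. B (Suc a))}"

lemma Suc_image_lessThan: "Suc ` {..<d} = {1..d}"
  by (simp add: lessThan_atLeast0 image_Suc_atLeastLessThan atLeastLessThanSuc_atLeastAtMost)

lemma indep_fam_Suc_iff:
  "indep_fam d (\<lambda>a. B (Suc a)) \<longleftrightarrow> inj_on B {1..d} \<and> cfun.independent (B ` {1..d})"
proof -
  have "inj_on (\<lambda>a. B (Suc a)) {..<d} \<longleftrightarrow> inj_on B (Suc ` {..<d})"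
    by (simp add: inj_on_def)
  moreover have "(\<lambda>a. B (Suc a)) ` {..<d} = B ` Suc ` {..<d}" by (simp add: image_image)
  ultimately show ?thesis unfolding indep_fam_iff Suc_image_lessThan by simp
qed

lemma cover_Gr: "cover (Gr_space n d) = frames n d"
  by (simp add: Gr_space_def frames_def indep_fam_Suc_iff)

lemma cover_ambient:
  "(w, B) \<in> cover (ambient n) \<longleftrightarrow>
     mat w \<in> nminus n \<and> w \<noteq> 0 \<and> B \<in> (\<Pi>\<^sub>E d\<in>{1..n-1}. frames n d)"
  by (simp add: ambient_def prod_space_def proj_space_def Prod_space_def cover_Gr)

lemma quo_ambient:
  "quo (ambient n) (w, B) = (line (V n) w, \<lambda>d\<in>{1..n-1}. cfun.span (B d ` {1..d}))"
  by (simp add: ambient_def prod_space_def proj_space_def Prod_space_def Gr_space_def)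

lemma coords_ambient:
  "coords (ambient n) = {\<lambda>(w, B). g w | g. linear_form (V n) g} \<union>
     {\<lambda>(w, B). B d k i | d k i. d \<in> {1..n-1} \<and> k \<in> {1..d} \<and> i \<in> {1..n}}"
  unfolding ambient_def prod_space_def proj_space_def Prod_space_def Gr_space_def
  by (simp, intro arg_cong2[of _ _ _ _ "(\<union>)"]) fastforce+

lemma polyfun_form: "linear_form (V n) g \<Longrightarrow> (\<lambda>(w, B). g w) \<in> polyfun (coords (ambient n))"
  unfolding coords_ambient by (intro polyfun.coord) blast

lemma polyfun_entry:
  "d \<in> {1..n-1} \<Longrightarrow> k \<in> {1..d} \<Longrightarrow> i \<in> {1..n} \<Longrightarrow> (\<lambda>(w, B). B d k i) \<in> polyfun (coords (ambient n))"
  unfolding coords_ambient by (intro polyfun.coord) blast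

lemma linear_form_component: "linear_form (V n) (\<lambda>w. w t)"
  by (simp add: linear_form_def fscale_apply)

lemma span_frame_Gr:
  assumes "B \<in> frames n d"
  shows "cfun.span (B ` {1..d}) \<in> Gr n d"
proof -
  have "inj_on B {1..d}" "cfun.independent (B ` {1..d})" "B ` {1..d} \<subseteq> L n"
    using assms unfolding frames_def indep_fam_Suc_iff by auto
  then show ?thesis unfolding Gr_def
    using cfun.dim_span_eq_card_independent[of "B ` {1..d}"] cfun.span_minimal[of "B ` {1..d}" "L n"]
      subspace_L(1) by (simp add: card_image cfun.subspace_span)
qed

lemma exists_frame:
  assumes "U \<in> Gr n d"
  obtains B where "B \<in> frames n d" "cfun.span (B ` {1..d}) = U"
proof -
  have U: "cfun.subspace U" "U \<subseteq> L n" "cfun.dim U = d" using assms by (auto simp: Gr_def)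
  obtain A where A: "finite A" "cfun.independent A" "cfun.span A = U" "card A = d"
    using finite_dim_basis[OF finite_dim_L[OF U(2)] U(1)] U(3) by metis
  obtain b where b: "bij_betw b {1..d} A" using ex_bij_betw_nat_finite_1[OF A(1)] A(4) by blast
  let ?B = "restrict b {1..d}"
  have im: "?B ` {1..d} = A" using b by (auto simp: bij_betw_def)
  have "inj_on ?B {1..d}" using b bij_betw_imp_inj_on inj_on_restrict_eq by blast
  moreover have "A \<subseteq> L n" using A(3) U(2) cfun.span_superset by blast
  then have "?B \<in> {1..d} \<rightarrow>\<^sub>E L n" using im by auto
  ultimately have "?B \<in> {1..d} \<rightarrow>\<^sub>E L n \<and> indep_fam d (\<lambda>a. ?B (Suc a))"
    using indep_fam_Suc_iff[of d ?B] im A(2) by metis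
  then have "?B \<in> frames n d" unfolding frames_def by blast
  then show ?thesis using that im A(3) by metis
qed

lemma flag_Gr: "U \<in> flag_variety n \<Longrightarrow> d \<in> {1..n-1} \<Longrightarrow> U d \<in> Gr n d"
  by (auto simp: flag_variety_def)

lemma flag_eqI:
  assumes "U \<in> flag_variety n" "U' \<in> flag_variety n" "\<And>d. d \<in> {1..n-1} \<Longrightarrow> U d = U' d"
  shows "U = U'"
proof -
  have "U \<in> extensional {1..n-1}" "U' \<in> extensional {1..n-1}"
    using assms(1,2) unfolding flag_variety_def PiE_def by blast+
  then show ?thesis by (rule extensionalityI) (rule assms(3))
qed

lemma flag_eqI_subset:
  assumes "U \<in> flag_variety n" "U' \<in> flag_variety n" "\<And>d. d \<in> {1..n-1} \<Longrightarrow> U d \<subseteq> U' d"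
  shows "U = U'"
proof (rule flag_eqI[OF assms(1,2)])
  fix d assume d: "d \<in> {1..n-1}"
  have U: "cfun.subspace (U d)" "cfun.subspace (U' d)" "U' d \<subseteq> L n" "cfun.dim (U d) = cfun.dim (U' d)"
    using flag_Gr[OF assms(1) d] flag_Gr[OF assms(2) d] unfolding Gr_def by simp_all
  show "U d = U' d"
    by (rule subspace_dim_eq[OF finite_dim_L[OF U(3)] U(1,2) assms(3)[OF d] U(4)])
qed

lemma exists_flag_frame:
  assumes "U \<in> flag_variety n"
  obtains B where "B \<in> (\<Pi>\<^sub>E d\<in>{1..n-1}. frames n d)" "(\<lambda>d\<in>{1..n-1}. cfun.span (B d ` {1..d})) = U"
proof -
  have "\<forall>d\<in>{1..n-1}. \<exists>B. B \<in> frames n d \<and> cfun.span (B ` {1..d}) = U d"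
  proof
    fix d assume "d \<in> {1..n-1}"
    from exists_frame[OF flag_Gr[OF assms this]]
    show "\<exists>B. B \<in> frames n d \<and> cfun.span (B ` {1..d}) = U d" by blast
  qed
  then obtain B where B: "\<And>d. d \<in> {1..n-1} \<Longrightarrow> B d \<in> frames n d \<and> cfun.span (B d ` {1..d}) = U d"
    by metis
  let ?B = "restrict B {1..n-1}"
  have "?B \<in> (\<Pi>\<^sub>E d\<in>{1..n-1}. frames n d)" using B by auto
  moreover have "(\<lambda>d\<in>{1..n-1}. cfun.span (?B d ` {1..d})) = U"
  proof
    fix d show "(\<lambda>d\<in>{1..n-1}. cfun.span (?B d ` {1..d})) d = U d"
    proof (cases "d \<in> {1..n-1}")
      case True then show ?thesis using B[OF True] by simp
    next
      case False
      have "U \<in> extensional {1..n-1}" using assms unfolding flag_variety_def PiE_def by blast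
      then show ?thesis using extensional_arb[of U _ d] False by (metis restrict_apply)
    qed
  qed
  ultimately show ?thesis by (rule that)
qed

lemma points_proj_V: "l \<in> points (proj_space (V n)) \<longleftrightarrow> (\<exists>w. mat w \<in> nminus n \<and> w \<noteq> 0 \<and> l = line (V n) w)"
  by (auto simp: points_def proj_space_def)

lemma flag_subset_points:
  "points (proj_space (V n)) \<times> flag_variety n \<subseteq> points (ambient n)"
proof clarify
  fix l U assume l: "l \<in> points (proj_space (V n))" and U: "U \<in> flag_variety n"
  obtain w where w: "mat w \<in> nminus n" "w \<noteq> 0" "l = line (V n) w" using l points_proj_V by blast
  obtain B where B: "B \<in> (\<Pi>\<^sub>E d\<in>{1..n-1}. frames n d)" "(\<lambda>d\<in>{1..n-1}. cfun.span (B d ` {1..d})) = U"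
    using exists_flag_frame[OF U] .
  have "quo (ambient n) (w, B) = (l, U)" using quo_ambient w B by simp
  moreover have "(w, B) \<in> cover (ambient n)" using cover_ambient w B by blast
  ultimately show "(l, U) \<in> points (ambient n)" unfolding points_def by (metis imageI)
qed

section \<open>Limits and closed conditions\<close>

lemma graph_closure_iff:
  "(l, U) \<in> graph_closure n \<longleftrightarrow> l \<in> points (proj_space (V n)) \<and> U \<in> flag_variety n \<and>
     (\<forall>T. zariski_open (ambient n) T \<and> (l, U) \<in> T \<longrightarrow> (\<exists>f\<in>nminus n. (line (V n) (v_plus f), iota n f) \<in> T))"
proof -
  let ?X = "points (proj_space (V n)) \<times> flag_variety n"
  have top: "topspace (subtopology (zariski (ambient n)) ?X) = ?X"
    using flag_subset_points by (simp add: topspace_zariski Int_absorb1)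
  have gr: "(line (V n) (v_plus f), iota n f) \<in> ?X" if "f \<in> nminus n" for f
  proof -
    have "v_plus f \<noteq> 0" by (auto simp: v_plus_def fun_eq_iff intro!: exI[of _ None])
    moreover have "mat (v_plus f) = f" by (simp add: v_plus_def)
    ultimately show ?thesis using iota_flag points_proj_V that by (metis mem_Sigma_iff)
  qed
  let ?G = "{(line (V n) (v_plus f), iota n f) | f. f \<in> nminus n}"
  have iff: "(l, U) \<in> graph_closure n \<longleftrightarrow> (l, U) \<in> ?X \<and>
      (\<forall>T. (l, U) \<in> T \<and> (\<exists>T'. zariski_open (ambient n) T' \<and> T = T' \<inter> ?X) \<longrightarrow> (\<exists>y. y \<in> ?G \<and> y \<in> T))"
    unfolding graph_closure_def in_closure_of top openin_subtopology openin_zariski ..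
  show ?thesis
  proof
    assume G: "(l, U) \<in> graph_closure n"
    then have X: "(l, U) \<in> ?X" by (rule conjunct1[OF iffD1[OF iff]])
    have "\<exists>f\<in>nminus n. (line (V n) (v_plus f), iota n f) \<in> T"
      if T: "zariski_open (ambient n) T" "(l, U) \<in> T" for T
    proof -
      have "(l, U) \<in> T \<inter> ?X \<and> (\<exists>T'. zariski_open (ambient n) T' \<and> T \<inter> ?X = T' \<inter> ?X)"
        using T X by (intro conjI IntI exI[of _ T]) simp_all
      then have "\<exists>y. y \<in> ?G \<and> y \<in> T \<inter> ?X"
        by (rule mp[OF spec[OF conjunct2[OF iffD1[OF iff G]]]])
      then show ?thesis by auto
    qed
    then show "l \<in> points (proj_space (V n)) \<and> U \<in> flag_variety n \<and>
        (\<forall>T. zariski_open (ambient n) T \<and> (l, U) \<in> T \<longrightarrow>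
          (\<exists>f\<in>nminus n. (line (V n) (v_plus f), iota n f) \<in> T))"
      using X by blast
  next
    assume r: "l \<in> points (proj_space (V n)) \<and> U \<in> flag_variety n \<and>
        (\<forall>T. zariski_open (ambient n) T \<and> (l, U) \<in> T \<longrightarrow>
          (\<exists>f\<in>nminus n. (line (V n) (v_plus f), iota n f) \<in> T))"
    show "(l, U) \<in> graph_closure n"
    proof (rule iffD2[OF iff], intro conjI allI impI)
      show "(l, U) \<in> ?X" using r by blast
      fix T assume "(l, U) \<in> T \<and> (\<exists>T'. zariski_open (ambient n) T' \<and> T = T' \<inter> ?X)"
      then obtain T' where T': "zariski_open (ambient n) T'" "T = T' \<inter> ?X" "(l, U) \<in> T'" by blast
      then obtain f where "f \<in> nminus n" "(line (V n) (v_plus f), iota n f) \<in> T'" using r by blast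
      then show "\<exists>y. y \<in> ?G \<and> y \<in> T" using gr T'(2) by blast
    qed
  qed
qed

lemma graph_subset_closure:
  assumes "f \<in> nminus n"
  shows "(line (V n) (v_plus f), iota n f) \<in> graph_closure n"
proof -
  have "v_plus f \<noteq> 0" by (auto simp: v_plus_def fun_eq_iff intro!: exI[of _ None])
  moreover have "mat (v_plus f) = f" by (simp add: v_plus_def)
  ultimately have "line (V n) (v_plus f) \<in> points (proj_space (V n))"
    using points_proj_V assms by metis
  then show ?thesis unfolding graph_closure_iff using iota_flag assms by blast
qed

text \<open>Limits along a line in \<open>V\<close> and along affine lines in the flags stay in the graph closure. A frame of
  \<open>U0\<close> moves along such lines; for small \<open>s\<close> it remains independent, hence spans \<open>Us s\<close>, and a polynomial
  that is nonzero at the limit is nonzero for small \<open>s\<close> by continuity in the usual topology of the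
  complex numbers.\<close>

lemma graph_closure_limit:
  assumes w: "mat w0 \<in> nminus n" "mat w1 \<in> nminus n" "w0 \<noteq> 0" and U0: "U0 \<in> flag_variety n"
    and Us: "\<And>s. s \<noteq> 0 \<Longrightarrow> Us s \<in> flag_variety n"
    and cl: "\<And>s. s \<noteq> 0 \<Longrightarrow> w0 + fscale s w1 \<noteq> 0 \<Longrightarrow> (line (V n) (w0 + fscale s w1), Us s) \<in> graph_closure n"
    and lim: "\<And>d u. d \<in> {1..n-1} \<Longrightarrow> u \<in> U0 d \<Longrightarrow> \<exists>u1. \<forall>s. s \<noteq> 0 \<longrightarrow> u + fscale s u1 \<in> Us s d"
  shows "(line (V n) w0, U0) \<in> graph_closure n"
  unfolding graph_closure_iff
proof (intro conjI allI impI U0)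
  show "line (V n) w0 \<in> points (proj_space (V n))" using points_proj_V w by blast
  fix T assume T: "zariski_open (ambient n) T \<and> (line (V n) w0, U0) \<in> T"
  obtain B where B: "B \<in> (\<Pi>\<^sub>E d\<in>{1..n-1}. frames n d)" "(\<lambda>d\<in>{1..n-1}. cfun.span (B d ` {1..d})) = U0"
    using exists_flag_frame[OF U0] .
  obtain S where S: "S \<subseteq> polyfun (coords (ambient n))"
      "\<forall>c\<in>cover (ambient n). quo (ambient n) c \<in> T \<longleftrightarrow> (\<exists>p\<in>S. p c \<noteq> 0)"
    using conjunct1[OF T] unfolding zariski_open_def by (elim conjE exE)
  have c0: "(w0, B) \<in> cover (ambient n)" using cover_ambient w B by blast
  moreover have "quo (ambient n) (w0, B) \<in> T" using T B(2) quo_ambient by simp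
  ultimately obtain p where p: "p \<in> S" "p (w0, B) \<noteq> 0" using bspec[OF S(2)] by blast
  have BU: "B d k \<in> U0 d" if "d \<in> {1..n-1}" "k \<in> {1..d}" for d k
  proof -
    have "U0 d = cfun.span (B d ` {1..d})" using B(2) that(1) by auto
    then show ?thesis using that cfun.span_base by blast
  qed
  have "\<forall>d\<in>{1..n-1}. \<forall>k\<in>{1..d}. \<exists>u1. \<forall>s. s \<noteq> 0 \<longrightarrow> B d k + fscale s u1 \<in> Us s d"
    using lim BU by blast
  then obtain u1 where u1: "\<And>d k s. d \<in> {1..n-1} \<Longrightarrow> k \<in> {1..d} \<Longrightarrow> s \<noteq> 0 \<Longrightarrow>
      B d k + fscale s (u1 d k) \<in> Us s d" by metis
  define Bs where "Bs s = (\<lambda>d\<in>{1..n-1}. \<lambda>k\<in>{1..d}. B d k + fscale s (u1 d k))" for s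
  let ?c = "\<lambda>s. (w0 + fscale s w1, Bs s)"
  have lin_lim: "((\<lambda>s. a + s * b) \<longlongrightarrow> a) (at 0)" for a b :: complex
    by (rule tendsto_eq_intros refl | simp)+
  have "((\<lambda>s. p (?c s)) \<longlongrightarrow> p (w0, B)) (at 0)"
  proof (rule polyfun_tendsto[of p "coords (ambient n)" ?c])
    show "p \<in> polyfun (coords (ambient n))" using S(1) p(1) by blast
    fix g assume "g \<in> coords (ambient n)"
    then consider g' where "g = (\<lambda>(w, B). g' w)" "linear_form (V n) g'"
      | d k i where "g = (\<lambda>(w, B). B d k i)" "d \<in> {1..n-1}" "k \<in> {1..d}"
      unfolding coords_ambient by blast
    then show "((\<lambda>s. g (?c s)) \<longlongrightarrow> g (w0, B)) (at 0)"
    proof cases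
      case 1
      have "mat (fscale s w1) \<in> nminus n" for s
        using w(2) by (auto simp: nminus_def fscale_apply)
      then have "g' (w0 + fscale s w1) = g' w0 + s * g' w1" for s
        using 1(2) w(1,2) unfolding linear_form_def by simp
      then show ?thesis using 1(1) lin_lim by simp
    next
      case 2
      then have "g (?c s) = B d k i + s * u1 d k i" for s by (simp add: Bs_def fscale_apply)
      then show ?thesis using 2(1) lin_lim by simp
    qed
  qed
  then have ev1: "\<forall>\<^sub>F s in at 0. p (?c s) \<noteq> 0"
    using p(2) by (rule tendsto_imp_eventually_ne)
  have ev2: "\<forall>\<^sub>F s in at 0. w0 + fscale s w1 \<noteq> 0"
  proof -
    obtain i where i: "w0 i \<noteq> 0" using w(3) by (auto simp: fun_eq_iff)
    have "\<forall>\<^sub>F s in at 0. w0 i + s * w1 i \<noteq> 0"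
      using lin_lim i by (rule tendsto_imp_eventually_ne)
    then show ?thesis
    proof (rule eventually_mono)
      fix s assume "w0 i + s * w1 i \<noteq> 0"
      then have "(w0 + fscale s w1) i \<noteq> 0" by (simp add: fscale_apply)
      then show "w0 + fscale s w1 \<noteq> 0" by (metis zero_fun_apply)
    qed
  qed
  have "\<forall>\<^sub>F s in at 0. indep_fam d (\<lambda>a. Bs s d (Suc a))" if d: "d \<in> {1..n-1}" for d
  proof -
    let ?Y = "\<lambda>a s i. B d (Suc a) i + s * u1 d (Suc a) i"
    have Bd: "indep_fam d (\<lambda>a. B d (Suc a))" using B(1) d by (auto simp: frames_def)
    have "\<exists>q\<in>polyfun {\<lambda>s. s}. q 0 \<noteq> 0 \<and> (\<forall>s. q s \<noteq> 0 \<longrightarrow> indep_fam d (\<lambda>a. ?Y a s))"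
    proof (rule independence_open)
      show "(\<lambda>s. ?Y a s i) \<in> polyfun {\<lambda>s. s}" for a i
        by (intro polyfun.add polyfun.mult polyfun.const polyfun.coord) simp
      show "indep_fam d (\<lambda>a. ?Y a 0)" using Bd by simp
    qed
    then obtain q where q: "q \<in> polyfun {\<lambda>s. s}" "q 0 \<noteq> 0"
      "\<And>s. q s \<noteq> 0 \<Longrightarrow> indep_fam d (\<lambda>a. ?Y a s)" by blast
    have "((\<lambda>s. q s) \<longlongrightarrow> q 0) (at 0)"
      by (rule polyfun_tendsto[OF q(1)]) auto
    then have "\<forall>\<^sub>F s in at 0. q s \<noteq> 0" using q(2) by (rule tendsto_imp_eventually_ne)
    then show ?thesis
    proof (rule eventually_mono)
      fix s assume "q s \<noteq> 0"
      then have "indep_fam d (\<lambda>a. ?Y a s)" by (rule q(3))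
      then show "indep_fam d (\<lambda>a. Bs s d (Suc a))"
        using d by (simp add: indep_fam_def Bs_def fscale_apply)
    qed
  qed
  then have ev3: "\<forall>\<^sub>F s in at 0. \<forall>d\<in>{1..n-1}. indep_fam d (\<lambda>a. Bs s d (Suc a))"
    by (intro eventually_ball_finite) auto
  have ev4: "\<forall>\<^sub>F s in at (0::complex). s \<noteq> 0" by (rule eventually_neq_at_within)
  have "\<forall>\<^sub>F s in at 0. p (?c s) \<noteq> 0 \<and> w0 + fscale s w1 \<noteq> 0 \<and>
      (\<forall>d\<in>{1..n-1}. indep_fam d (\<lambda>a. Bs s d (Suc a))) \<and> s \<noteq> 0"
    using ev1 ev2 ev3 ev4 by (intro eventually_conj)
  then obtain s where s: "p (?c s) \<noteq> 0" "w0 + fscale s w1 \<noteq> 0"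
      "\<And>d. d \<in> {1..n-1} \<Longrightarrow> indep_fam d (\<lambda>a. Bs s d (Suc a))" "s \<noteq> 0"
    using eventually_happens'[OF at_neq_bot] by blast
  have UG: "Us s d \<in> Gr n d" if "d \<in> {1..n-1}" for d using flag_Gr[OF Us[OF s(4)] that] .
  have BsU: "Bs s d ` {1..d} \<subseteq> Us s d" if "d \<in> {1..n-1}" for d
    using u1[OF that _ s(4)] that by (auto simp: Bs_def)
  have fr: "Bs s d \<in> frames n d" if d: "d \<in> {1..n-1}" for d
  proof -
    have "Us s d \<subseteq> L n" using UG[OF d] by (simp add: Gr_def)
    then have "Bs s d \<in> {1..d} \<rightarrow>\<^sub>E L n" using BsU[OF d] d by (auto simp: Bs_def)
    then show ?thesis using s(3)[OF d] by (simp add: frames_def)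
  qed
  have "cfun.span (Bs s d ` {1..d}) = Us s d" if d: "d \<in> {1..n-1}" for d
  proof (rule subspace_dim_eq)
    have U: "cfun.subspace (Us s d)" "Us s d \<subseteq> L n" "cfun.dim (Us s d) = d"
      using UG[OF d] by (auto simp: Gr_def)
    show "cfun.span (Bs s d ` {1..d}) \<subseteq> Us s d" by (rule cfun.span_minimal[OF BsU[OF d] U(1)])
    show "finite_dim (Us s d)" by (rule finite_dim_L[OF U(2)])
    show "cfun.dim (cfun.span (Bs s d ` {1..d})) = cfun.dim (Us s d)"
      using span_frame_Gr[OF fr[OF d]] U(3) by (simp add: Gr_def)
  qed (use UG[OF d] in \<open>auto simp: Gr_def cfun.subspace_span\<close>)
  then have sp: "(\<lambda>d\<in>{1..n-1}. cfun.span (Bs s d ` {1..d})) = Us s"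
  proof -
    assume a: "\<And>d. d \<in> {1..n-1} \<Longrightarrow> cfun.span (Bs s d ` {1..d}) = Us s d"
    have "Us s \<in> extensional {1..n-1}" using Us[OF s(4)] unfolding flag_variety_def PiE_def by blast
    then show ?thesis using a by (intro extensionalityI[of _ "{1..n-1}"]) auto
  qed
  have "mat (w0 + fscale s w1) \<in> nminus n"
    using nminus_add_scale[OF w(1,2), of s] by (simp add: plus_fun_def fscale_def)
  moreover have "Bs s \<in> (\<Pi>\<^sub>E d\<in>{1..n-1}. frames n d)"
    using fr by (auto simp: Bs_def)
  ultimately have "?c s \<in> cover (ambient n)" unfolding cover_ambient using s(2) by blast
  then have "quo (ambient n) (?c s) \<in> T" using bspec[OF S(2)] p(1) s(1) by blast
  then have "(line (V n) (w0 + fscale s w1), Us s) \<in> T" unfolding quo_ambient sp .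
  moreover have "(line (V n) (w0 + fscale s w1), Us s) \<in> graph_closure n" by (rule cl[OF s(4,2)])
  ultimately show "\<exists>f\<in>nminus n. (line (V n) (v_plus f), iota n f) \<in> T"
    using T unfolding graph_closure_iff by blast
qed

text \<open>A condition \<open>Q\<close> on points is closed when its failure at any coordinate vector is detected by a
  polynomial that vanishes wherever \<open>Q\<close> holds. All polynomials that vanish wherever \<open>Q\<close>
  holds then cut out exactly the set where it holds.\<close>

lemma graph_closure_closed_condition:
  assumes graph: "\<And>f. f \<in> nminus n \<Longrightarrow> Q (line (V n) (v_plus f), iota n f)"
    and opn: "\<And>c. c \<in> cover (ambient n) \<Longrightarrow> \<not> Q (quo (ambient n) c) \<Longrightarrow>
      \<exists>p\<in>polyfun (coords (ambient n)). p c \<noteq> 0 \<and>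
        (\<forall>c'\<in>cover (ambient n). Q (quo (ambient n) c') \<longrightarrow> p c' = 0)"
    and x: "(l, U) \<in> graph_closure n"
  shows "Q (l, U)"
proof (rule ccontr)
  assume nQ: "\<not> Q (l, U)"
  let ?T = "{x \<in> points (ambient n). \<not> Q x}"
  let ?S = "{p \<in> polyfun (coords (ambient n)). \<forall>c\<in>cover (ambient n). Q (quo (ambient n) c) \<longrightarrow> p c = 0}"
  have "zariski_open (ambient n) ?T" unfolding zariski_open_def
  proof (intro conjI exI[of _ ?S] ballI)
    fix c assume c: "c \<in> cover (ambient n)"
    then have "quo (ambient n) c \<in> points (ambient n)" by (simp add: points_def)
    then show "quo (ambient n) c \<in> ?T \<longleftrightarrow> (\<exists>p\<in>?S. p c \<noteq> 0)"
      using opn[OF c] c by blast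
  qed auto
  moreover have "(l, U) \<in> points (ambient n)"
    using x flag_subset_points unfolding graph_closure_iff by blast
  ultimately show False using x nQ graph unfolding graph_closure_iff by blast
qed

section \<open>Equations of the fiber\<close>

lemma fblock_Lplus_0: "y \<in> Lplus n d \<Longrightarrow> fblock n f d y = 0"
  by (auto simp: mem_Lplus fblock_def fun_eq_iff intro!: sum.neutral)

lemma fblock_ell: "a \<in> {1..d} \<Longrightarrow> fblock n f d (ell a) i = (if i \<in> {d+1..n} then f (i, a) else 0)"
proof -
  assume a: "a \<in> {1..d}"
  have "(\<Sum>j=1..d. f (i, j) * ell a j) = (\<Sum>j=1..d. if j = a then f (i, a) else 0)"
    by (intro sum.cong) (auto simp: ell_def)
  then show ?thesis using a by (simp add: fblock_def)
qed

lemma line_v_plus: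
  assumes "w \<in> line (V n) (v_plus f)"
  shows "\<exists>c. w None = c \<and> mat w = fscale c f"
  using assms by (auto simp: line_V v_plus_def fscale_def)

text \<open>On the graph, a vector of \<open>U d\<close> is \<open>x + f x\<close> with \<open>x\<close> in \<open>Lminus d\<close>; multiplied by the coefficient of \<open>v\<close>
  this becomes a bihomogeneous equation in the matrix and a frame, which persists on the closure.\<close>

lemma graph_closure_kernel:
  assumes "(l, U) \<in> graph_closure n" "w \<in> l" "d \<in> {1..n-1}" "u \<in> U d" "i \<in> {d+1..n}"
  shows "w None * u i = fblock n (mat w) d u i"
proof -
  define Q where "Q = (\<lambda>(l, U). \<forall>w\<in>l. \<forall>d\<in>{1..n-1}. \<forall>u\<in>U d. \<forall>i\<in>{d+1..n}.
      w None * u i = fblock n (mat w) d u i)"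
  have "Q (l, U)"
  proof (rule graph_closure_closed_condition[OF _ _ assms(1)])
    fix f assume "f \<in> nminus n"
    have "w None * u i = fblock n (mat w) d u i"
      if w: "w \<in> line (V n) (v_plus f)" and d: "d \<in> {1..n-1}" and u: "u \<in> iota n f d"
        and i: "i \<in> {d+1..n}" for w d u i
    proof -
      obtain c where c: "w None = c" "mat w = fscale c f" using line_v_plus[OF w] by blast
      obtain x where x: "x \<in> Lminus d" "u = x + fblock n f d x" using u mem_iota[OF d] by blast
      have "u i = fblock n f d x i" using x i by (auto simp: mem_Lminus)
      moreover have "fblock n f d u = fblock n f d x"
        unfolding x(2) fblock_add using fblock_Lplus_0[OF fblock_Lplus] by simp
      ultimately show ?thesis using c by (simp add: fblock_scale_matrix fscale_apply)
    qed
    then show "Q (line (V n) (v_plus f), iota n f)" unfolding Q_def by blast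
  next
    fix c assume c: "c \<in> cover (ambient n)" and nQ: "\<not> Q (quo (ambient n) c)"
    obtain w B where cwB: "c = (w, B)" by (cases c)
    have "\<exists>w'\<in>line (V n) w. \<exists>d\<in>{1..n-1}. \<exists>u\<in>cfun.span (B d ` {1..d}). \<exists>i\<in>{d+1..n}.
        w' None * u i \<noteq> fblock n (mat w') d u i"
      using nQ unfolding cwB quo_ambient Q_def by simp
    then obtain w' d u i where 1: "w' \<in> line (V n) w" "d \<in> {1..n-1}" "u \<in> cfun.span (B d ` {1..d})"
        "i \<in> {d+1..n}" "w' None * u i \<noteq> fblock n (mat w') d u i"
      by blast
    obtain s where s: "w' = fscale s w" using 1(1) unfolding line_V by blast
    have "mat w' = fscale s (mat w)" unfolding s by (simp add: fscale_def)
    then have ne: "w None * u i \<noteq> fblock n (mat w) d u i"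
      using 1(5) by (auto simp: s fscale_apply fblock_scale_matrix)
    have "\<exists>k\<in>{1..d}. w None * B d k i \<noteq> fblock n (mat w) d (B d k) i"
    proof (rule ccontr)
      assume a: "\<not> ?thesis"
      let ?S = "{u. w None * u i = fblock n (mat w) d u i}"
      have "cfun.subspace ?S"
        by (auto simp: cfun.subspace_def fblock_0 fblock_add fblock_scale fscale_apply algebra_simps)
      moreover have "B d ` {1..d} \<subseteq> ?S" using a by blast
      ultimately show False using cfun.span_minimal[of "B d ` {1..d}" ?S] 1(3) ne by blast
    qed
    then obtain k where k: "k \<in> {1..d}" "w None * B d k i \<noteq> fblock n (mat w) d (B d k) i" by blast
    define p :: "((nat \<times> nat) option \<Rightarrow> complex) \<times> (nat \<Rightarrow> nat \<Rightarrow> cvec) \<Rightarrow> complex"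
      where "p = (\<lambda>c. (case c of (w, B) \<Rightarrow> w None) * (case c of (w, B) \<Rightarrow> B d k i) +
       (- 1) * (\<Sum>j=1..d. (case c of (w, B) \<Rightarrow> w (Some (i, j))) * (case c of (w, B) \<Rightarrow> B d k j)))"
    have pe: "p (w, B) = w None * B d k i - fblock n (mat w) d (B d k) i" for w B
      using 1(4) by (simp add: p_def fblock_def)
    have dn: "j \<in> {1..n}" if "j \<in> {1..d}" for j using that 1(2) by auto
    have "p \<in> polyfun (coords (ambient n))" unfolding p_def
      using 1(2,4) k(1) dn
      by (intro polyfun.add polyfun.mult polyfun.const polyfun_sum polyfun_form
          linear_form_component polyfun_entry) auto
    moreover have "p c \<noteq> 0" unfolding cwB pe using k(2) by simp
    moreover have "p c' = 0" if c': "c' \<in> cover (ambient n)" "Q (quo (ambient n) c')" for c'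
    proof -
      obtain v C where e: "c' = (v, C)" by (cases c')
      have "C d k \<in> cfun.span (C d ` {1..d})" using k(1) by (intro cfun.span_base) blast
      then have "v None * C d k i = fblock n (mat v) d (C d k) i"
        using c'(2) 1(2,4) line_self[of v n] unfolding e quo_ambient Q_def by simp
      then show ?thesis unfolding e pe by simp
    qed
    ultimately show "\<exists>p\<in>polyfun (coords (ambient n)). p c \<noteq> 0 \<and>
        (\<forall>c'\<in>cover (ambient n). Q (quo (ambient n) c') \<longrightarrow> p c' = 0)" by blast
  qed
  then show ?thesis using assms(2-) unfolding Q_def by blast
qed

lemma indep_fam_snoc:
  assumes "indep_fam d Y"
  shows "indep_fam (Suc d) Y \<longleftrightarrow> Y d \<notin> cfun.span (Y ` {..<d})"
proof
  have Y: "inj_on Y {..<d}" "cfun.independent (Y ` {..<d})"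
    using assms unfolding indep_fam_iff by blast+
  show "indep_fam (Suc d) Y" if n: "Y d \<notin> cfun.span (Y ` {..<d})"
  proof -
    have "Y d \<notin> Y ` {..<d}" using n cfun.span_base[of "Y d" "Y ` {..<d}"] by blast
    then have "inj_on Y {..<Suc d}" using Y(1) by (auto simp: lessThan_Suc)
    moreover have "cfun.independent (Y ` {..<Suc d})"
      using cfun.independent_insertI[OF n Y(2)] by (simp add: lessThan_Suc)
    ultimately show ?thesis unfolding indep_fam_iff ..
  qed
  show "Y d \<notin> cfun.span (Y ` {..<d})" if i: "indep_fam (Suc d) Y"
  proof
    assume s: "Y d \<in> cfun.span (Y ` {..<d})"
    have i': "inj_on Y {..<Suc d}" "cfun.independent (Y ` {..<Suc d})"
      using i unfolding indep_fam_iff by blast+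
    have "Y ` {..<Suc d} - {Y d} = Y ` {..<d}"
      using i'(1) by (auto simp: lessThan_Suc inj_on_def)
    then show False using i'(2) s unfolding cfun.dependent_def
      by (metis imageI lessThan_iff lessI)
  qed
qed

text \<open>On the graph, \<open>U d\<close> contains \<open>x + f x\<close> for \<open>x\<close> in \<open>Lminus d\<close>. Membership of a polynomial vector in the span of
  a frame is a closed condition, because its failure is the independence of a family of \<open>d + 1\<close> vectors.\<close>

lemma graph_closure_image:
  assumes "(l, U) \<in> graph_closure n" "w \<in> l" "d \<in> {1..n-1}" "x \<in> Lminus d"
  shows "fscale (w None) x + fblock n (mat w) d x \<in> U d"
proof -
  define Q where "Q = (\<lambda>(l, U). \<forall>w\<in>l. \<forall>d\<in>{1..n-1}. \<forall>x\<in>Lminus d.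
      fscale (w None) x + fblock n (mat w) d x \<in> (U :: nat \<Rightarrow> cvec set) d)"
  have "Q (l, U)"
  proof (rule graph_closure_closed_condition[OF _ _ assms(1)])
    fix f assume "f \<in> nminus n"
    have "fscale (w None) x + fblock n (mat w) d x \<in> iota n f d"
      if w: "w \<in> line (V n) (v_plus f)" and d: "d \<in> {1..n-1}" and x: "x \<in> Lminus d" for w d x
    proof -
      obtain c where c: "w None = c" "mat w = fscale c f" using line_v_plus[OF w] by blast
      have "fscale c x \<in> Lminus d" using x subspace_L cfun.subspace_scale by blast
      then show ?thesis unfolding mem_iota[OF d]
        by (intro bexI[of _ "fscale c x"]) (simp add: c fblock_scale_matrix fblock_scale)
    qed
    then show "Q (line (V n) (v_plus f), iota n f)" unfolding Q_def by blast
  next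
    fix c assume c: "c \<in> cover (ambient n)" and nQ: "\<not> Q (quo (ambient n) c)"
    obtain w B where cwB: "c = (w, B)" by (cases c)
    have "\<exists>w'\<in>line (V n) w. \<exists>d\<in>{1..n-1}. \<exists>x\<in>Lminus d.
        fscale (w' None) x + fblock n (mat w') d x \<notin> cfun.span (B d ` {1..d})"
      using nQ unfolding cwB quo_ambient Q_def by simp
    then obtain w' d x where 1: "w' \<in> line (V n) w" "d \<in> {1..n-1}" "x \<in> Lminus d"
        "fscale (w' None) x + fblock n (mat w') d x \<notin> cfun.span (B d ` {1..d})"
      by blast
    note d = 1(2)
    obtain s where s: "w' = fscale s w" using 1(1) unfolding line_V by blast
    let ?y = "\<lambda>w x. fscale (w None) x + fblock n (mat w) d x"
    have "mat w' = fscale s (mat w)" unfolding s by (simp add: fscale_def)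
    then have "?y w' x = fscale s (?y w x)"
      by (simp add: s fscale_apply fblock_scale_matrix cfun.scale_right_distrib)
    then have ne: "?y w x \<notin> cfun.span (B d ` {1..d})" using 1(4) cfun.span_scale by metis
    have "\<exists>a\<in>{1..d}. ?y w (ell a) \<notin> cfun.span (B d ` {1..d})"
    proof (rule ccontr)
      assume a: "\<not> ?thesis"
      let ?S = "{x. ?y w x \<in> cfun.span (B d ` {1..d})}"
      have "lin (?y w)"
        by (rule linI) (auto simp: fun_eq_iff fblock_add fblock_scale fscale_apply algebra_simps)
      then have "cfun.subspace ?S"
        using cpair.linear_subspace_vimage[of "?y w" "cfun.span (B d ` {1..d})"]
        by (simp add: vimage_def cfun.subspace_span)
      moreover have "ell ` {1..d} \<subseteq> ?S" using a by blast
      ultimately show False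
        using cfun.span_minimal[of "ell ` {1..d}" ?S] 1(3) ne unfolding Lminus_def by blast
    qed
    then obtain a where a: "a \<in> {1..d}" "?y w (ell a) \<notin> cfun.span (B d ` {1..d})" by blast
    \<comment> \<open>The frame followed by the vector in question. Entries outside \<open>{1..n}\<close> are set to \<open>0\<close>, which agrees with
      the frame on admissible coordinates and keeps every entry polynomial.\<close>
    define Y where "Y k = (\<lambda>(w, B) i. if k < d then if i \<in> {1..n} then B d (Suc k) i else 0
        else w None * ell a i + (if i \<in> {d+1..n} then w (Some (i, a)) else 0))"
      for k :: nat and c :: "((nat \<times> nat) option \<Rightarrow> complex) \<times> (nat \<Rightarrow> nat \<Rightarrow> cvec)"
    have Yk: "Y k (w, B) = B d (Suc k)" if "(w, B) \<in> cover (ambient n)" "k < d" for k w B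
    proof -
      have "B d \<in> frames n d" using that(1) d unfolding cover_ambient by blast
      then have "B d (Suc k) \<in> L n" using that(2) unfolding frames_def by auto
      then show ?thesis using that(2) by (auto simp: Y_def mem_L fun_eq_iff)
    qed
    have Yd: "Y d (w, B) = ?y w (ell a)" for w B
      using fblock_ell[OF a(1)] by (simp add: Y_def fun_eq_iff fscale_apply)
    have ind: "indep_fam (Suc d) (\<lambda>k. Y k (w, B)) \<longleftrightarrow> ?y w (ell a) \<notin> cfun.span (B d ` {1..d})"
      if "(w, B) \<in> cover (ambient n)" for w B
    proof -
      have "B d \<in> frames n d" using that d unfolding cover_ambient by blast
      then have "indep_fam d (\<lambda>k. B d (Suc k))" unfolding frames_def by blast
      then have "indep_fam d (\<lambda>k. Y k (w, B))" using Yk[OF that] by (simp add: indep_fam_def)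
      moreover have "(\<lambda>k. Y k (w, B)) ` {..<d} = B d ` {1..d}"
      proof -
        have "(\<lambda>k. Y k (w, B)) ` {..<d} = (\<lambda>k. B d (Suc k)) ` {..<d}"
          using Yk[OF that] by (intro image_cong) simp_all
        also have "\<dots> = B d ` Suc ` {..<d}" by (simp only: image_image)
        finally show ?thesis by (simp only: Suc_image_lessThan)
      qed
      ultimately show ?thesis using indep_fam_snoc[of d "\<lambda>k. Y k (w, B)"] Yd by simp
    qed
    have "\<exists>p\<in>polyfun (coords (ambient n)). p c \<noteq> 0 \<and>
        (\<forall>c. p c \<noteq> 0 \<longrightarrow> indep_fam (Suc d) (\<lambda>k. Y k c))"
    proof (rule independence_open)
      show "indep_fam (Suc d) (\<lambda>k. Y k c)" using ind a(2) c unfolding cwB by blast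
      fix k i assume "k < Suc d"
      then consider "k < d" "i \<in> {1..n}" | "k < d" "i \<notin> {1..n}" | "k = d" by linarith
      then show "(\<lambda>c. Y k c i) \<in> polyfun (coords (ambient n))"
      proof cases
        case 1
        then have "(\<lambda>c. Y k c i) = (\<lambda>(w, B). B d (Suc k) i)" by (auto simp: Y_def)
        then show ?thesis using polyfun_entry[OF d, of "Suc k" i] 1 by auto
      next
        case 2
        then have "(\<lambda>c. Y k c i) = (\<lambda>_. 0)" by (auto simp: Y_def)
        then show ?thesis using polyfun.const by metis
      next
        case 3
        have 1: "(\<lambda>c. (case c of (w, B) \<Rightarrow> w None) * ell a i) \<in> polyfun (coords (ambient n))"
          by (intro polyfun.mult polyfun.const polyfun_form linear_form_component)
        show ?thesis
        proof (cases "i \<in> {d+1..n}")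
          case True
          then have "(\<lambda>c. Y k c i) = (\<lambda>c. (case c of (w, B) \<Rightarrow> w None) * ell a i +
              (case c of (w, B) \<Rightarrow> w (Some (i, a))))" using 3 by (auto simp: Y_def)
          then show ?thesis
            using polyfun.add[OF 1 polyfun_form[OF linear_form_component[of n "Some (i, a)"]]] by simp
        next
          case False
          then have "(\<lambda>c. Y k c i) = (\<lambda>c. (case c of (w, B) \<Rightarrow> w None) * ell a i)"
            using 3 by (auto simp: Y_def)
          then show ?thesis using 1 by simp
        qed
      qed
    qed
    then obtain p where p: "p \<in> polyfun (coords (ambient n))" "p c \<noteq> 0"
      "\<And>c. p c \<noteq> 0 \<Longrightarrow> indep_fam (Suc d) (\<lambda>k. Y k c)" by blast
    moreover have "p c' = 0" if c': "c' \<in> cover (ambient n)" "Q (quo (ambient n) c')" for c'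
    proof (rule ccontr)
      assume "p c' \<noteq> 0"
      then have i: "indep_fam (Suc d) (\<lambda>k. Y k c')" by (rule p(3))
      obtain v C where e: "c' = (v, C)" by (cases c')
      have "ell a \<in> Lminus d" using a(1) unfolding Lminus_def by (intro cfun.span_base) blast
      then have "?y v (ell a) \<in> cfun.span (C d ` {1..d})"
        using c'(2) d line_self[of v n] unfolding e quo_ambient Q_def by simp
      then show False using i ind c'(1) unfolding e by blast
    qed
    ultimately show "\<exists>p\<in>polyfun (coords (ambient n)). p c \<noteq> 0 \<and>
        (\<forall>c'\<in>cover (ambient n). Q (quo (ambient n) c') \<longrightarrow> p c' = 0)" by blast
  qed
  then show ?thesis using assms(2-) unfolding Q_def by blast
qed

text \<open>The solutions of the two previous families of equations with vanishing coefficient of \<open>v\<close>: the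
  homomorphisms \<open>P \<rightarrow> I\<close> that vanish on \<open>N_P\<close> and take values in \<open>N_I\<close>.\<close>

definition fiber_space :: "nat \<Rightarrow> (nat \<Rightarrow> cvec set) \<Rightarrow> ((nat \<times> nat) option \<Rightarrow> complex) set" where
  "fiber_space n U = {w. mat w \<in> nminus n \<and> w None = 0 \<and> (\<forall>d\<in>{1..n-1}.
     (\<forall>x\<in>NP n U d. fblock n (mat w) d x = 0) \<and> (\<forall>x\<in>Lminus d. fblock n (mat w) d x \<in> NI n U d))}"

text \<open>A point over the complement of the cell lies on the hyperplane at infinity: otherwise normalise the
  coefficient of \<open>v\<close> to \<open>1\<close>, and \<open>U d\<close> contains the graph of the matrix, so \<open>U\<close> lies in the cell.\<close>

lemma graph_closure_imp_fiber_space: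
  assumes "(l, U) \<in> graph_closure n" "U \<notin> iota n ` nminus n"
  shows "\<exists>w\<in>fiber_space n U. w \<noteq> 0 \<and> l = line (V n) w"
proof -
  have "l \<in> points (proj_space (V n))" and U: "U \<in> flag_variety n"
    using assms(1) unfolding graph_closure_iff by blast+
  then obtain w where w: "mat w \<in> nminus n" "w \<noteq> 0" "l = line (V n) w" using points_proj_V by blast
  have wl: "w \<in> l" unfolding w(3) by (rule line_self)
  note ker = graph_closure_kernel[OF assms(1) wl] and img = graph_closure_image[OF assms(1) wl]
  have Us: "cfun.subspace (U d)" "U d \<subseteq> L n" if "d \<in> {1..n-1}" for d
    using flag_Gr[OF U that] by (auto simp: Gr_def)
  have w0: "w None = 0"
  proof (rule ccontr)
    assume nz: "w None \<noteq> 0"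
    let ?f = "fscale (inverse (w None)) (mat w)"
    have f: "?f \<in> nminus n" using w(1) by (auto simp: nminus_def fscale_apply)
    have "iota n ?f = U"
    proof (rule flag_eqI_subset[OF iota_flag U])
      fix d assume d: "d \<in> {1..n-1}"
      show "iota n ?f d \<subseteq> U d"
      proof
        fix u assume "u \<in> iota n ?f d"
        then obtain x where x: "x \<in> Lminus d" "u = x + fblock n ?f d x" using mem_iota[OF d] by blast
        have "u = fscale (inverse (w None)) (fscale (w None) x + fblock n (mat w) d x)"
          unfolding x(2) fblock_scale_matrix using nz
          by (auto simp: fun_eq_iff fscale_apply field_simps)
        then show "u \<in> U d" using img[OF d x(1)] Us(1)[OF d] cfun.subspace_scale by metis
      qed
    qed
    then show False using assms(2) f by blast
  qed
  have "fblock n (mat w) d x = 0" if d: "d \<in> {1..n-1}" and x: "x \<in> NP n U d" for d x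
  proof
    fix i
    obtain y where y: "y \<in> Lplus n d" "x + y \<in> U d" using x mem_NP[OF d] by blast
    have "fblock n (mat w) d (x + y) = fblock n (mat w) d x"
      using fblock_Lplus_0[OF y(1)] by (simp add: fblock_add)
    then have "i \<in> {d+1..n} \<Longrightarrow> fblock n (mat w) d x i = 0" using ker[OF d y(2)] w0 by simp
    then show "fblock n (mat w) d x i = 0 i" by (auto simp: fblock_def)
  qed
  moreover have "fblock n (mat w) d x \<in> NI n U d" if d: "d \<in> {1..n-1}" and x: "x \<in> Lminus d" for d x
    unfolding mem_NI[OF d] using img[OF d x] w0 fblock_Lplus by simp
  ultimately have "w \<in> fiber_space n U" unfolding fiber_space_def using w(1) w0 by blast
  then show ?thesis using w by blast
qed

text \<open>Keep \<open>[w]\<close> fixed and consider the set of flags \<open>G\<close> that lie over it. It contains all partial graphs over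
  the kernel and the image of \<open>w\<close>, as limits of \<open>iota n (f + w/s)\<close>, whose first component
  \<open>[v + f + w/s] = [w + s (v + f)]\<close> tends to \<open>[w]\<close>. These degenerate to \<open>U\<close>.\<close>

lemma fiber_space_imp_graph_closure:
  assumes U: "U \<in> flag_variety n" and w: "w \<in> fiber_space n U" "w \<noteq> 0"
  shows "(line (V n) w, U) \<in> graph_closure n"
proof -
  let ?h = "mat w"
  have h: "?h \<in> nminus n" and w0: "w None = 0" using w(1) unfolding fiber_space_def by auto
  let ?K = "next_kernel n ?h Lminus (\<lambda>d. {0})" and ?J = "next_image n ?h Lminus (\<lambda>d. {0})"
  define G where "G = {U \<in> flag_variety n. (line (V n) w, U) \<in> graph_closure n}"
  have z: "mat (0 :: (nat \<times> nat) option \<Rightarrow> complex) \<in> nminus n" by (simp add: nminus_def)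
  have closed: "line_closed n G" unfolding line_closed_def
  proof (intro allI impI)
    fix U0 Us
    assume U0: "U0 \<in> flag_variety n" and Us: "\<forall>s. s \<noteq> 0 \<longrightarrow> Us s \<in> G"
      and lim: "\<forall>d\<in>{1..n-1}. \<forall>u\<in>U0 d. \<exists>u1. \<forall>s. s \<noteq> 0 \<longrightarrow> u + fscale s u1 \<in> Us s d"
    have "(line (V n) w, U0) \<in> graph_closure n"
    proof (rule graph_closure_limit[OF h z w(2) U0, of Us])
      show "Us s \<in> flag_variety n" if "s \<noteq> 0" for s using Us that unfolding G_def by blast
      show "(line (V n) (w + fscale s 0), Us s) \<in> graph_closure n" if "s \<noteq> 0" for s
        using Us that unfolding G_def by simp
    qed (use lim in blast)
    then show "U0 \<in> G" unfolding G_def using U0 by blast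
  qed
  have graphs: "partial_graph n ?K ?J f \<in> G" if f: "f \<in> nminus n" for f
  proof -
    have fl: "partial_graph n ?K ?J f \<in> flag_variety n"
      by (rule partial_graph_flag[OF sub_pair_next[OF sub_pair_full]])
    have m: "mat (v_plus f) \<in> nminus n" using f by (simp add: v_plus_def)
    have "(line (V n) w, partial_graph n ?K ?J f) \<in> graph_closure n"
    proof (rule graph_closure_limit[OF h m w(2) fl, of "\<lambda>s. iota n (f + fscale (inverse s) ?h)"])
      show "iota n (f + fscale (inverse s) ?h) \<in> flag_variety n" for s by (rule iota_flag)
      show "(line (V n) (w + fscale s (v_plus f)), iota n (f + fscale (inverse s) ?h)) \<in> graph_closure n"
        if s: "s \<noteq> 0" for s
      proof -
        have "w + fscale s (v_plus f) = fscale s (v_plus (f + fscale (inverse s) ?h))"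
        proof
          fix t show "(w + fscale s (v_plus f)) t = fscale s (v_plus (f + fscale (inverse s) ?h)) t"
            using s w0 by (cases t) (simp_all add: v_plus_def fscale_apply field_simps)
        qed
        then show ?thesis
          using graph_subset_closure[OF nminus_add_scale[OF f h, of "inverse s"]] line_scale[OF s] by simp
      qed
      show "\<exists>u1. \<forall>s. s \<noteq> 0 \<longrightarrow> u + fscale s u1 \<in> iota n (f + fscale (inverse s) ?h) d"
        if "d \<in> {1..n-1}" "u \<in> partial_graph n ?K ?J f d" for d u
        using partial_graph_approach[OF sub_pair_full that] unfolding iota_eq_partial_graph .
    qed
    then show ?thesis using fl unfolding G_def by blast
  qed
  have JU: "?J d \<subseteq> U d" if d: "d \<in> {1..n-1}" for d
  proof -
    have "\<forall>x\<in>Lminus d. fblock n ?h d x \<in> U d"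
      using w(1) d mem_NI[OF d] unfolding fiber_space_def by blast
    then show ?thesis unfolding next_image_def by auto
  qed
  have UK: "NP n U d \<subseteq> ?K d" if d: "d \<in> {1..n-1}" for d
  proof -
    have "\<forall>x\<in>NP n U d. fblock n ?h d x = 0" using w(1) d unfolding fiber_space_def by blast
    then show ?thesis unfolding next_kernel_def using mem_NP[OF d] by blast
  qed
  have "U \<in> G"
    by (rule partial_graphs_dense[OF closed U sub_pair_next[OF sub_pair_full] JU UK graphs])
  then show ?thesis unfolding G_def by blast
qed

lemma phi_fiber_eq:
  assumes "U \<in> flag_variety n" "U \<notin> iota n ` nminus n"
  shows "phi_fiber n U = {(line (V n) w, U) | w. w \<in> fiber_space n U \<and> w \<noteq> 0}"
proof (intro set_eqI iffI)
  fix x assume "x \<in> phi_fiber n U"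
  then obtain l where "x = (l, U)" "(l, U) \<in> graph_closure n" unfolding phi_fiber_def by (cases x) auto
  then show "x \<in> {(line (V n) w, U) | w. w \<in> fiber_space n U \<and> w \<noteq> 0}"
    using graph_closure_imp_fiber_space[OF _ assms(2)] by blast
next
  fix x assume "x \<in> {(line (V n) w, U) | w. w \<in> fiber_space n U \<and> w \<noteq> 0}"
  then show "x \<in> phi_fiber n U"
    unfolding phi_fiber_def using fiber_space_imp_graph_closure[OF assms(1)] by auto
qed

section \<open>Morphisms given by homogeneous coordinates\<close>

lemma polyfun_compose:
  assumes "p \<in> polyfun G" "\<And>g. g \<in> G \<Longrightarrow> (\<lambda>c. g (\<theta> c)) \<in> polyfun G'"
  shows "(\<lambda>c. p (\<theta> c)) \<in> polyfun G'"
  using assms(1) by induction (auto intro: polyfun.const polyfun.add polyfun.mult assms(2))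

text \<open>A map is a morphism if it is induced by a polynomial map \<open>\<theta>\<close> between homogeneous coordinates. It is
  convenient to have \<open>\<theta>\<close> descend to points on the neighbourhood \<open>D\<close> of \<open>X\<close> and not just on \<open>X\<close>: the preimage
  of an open set is then cut out by polynomials whose nonvanishing locus does not depend on the choice
  of coordinates.\<close>

lemma morphism_of_lift:
  assumes cov: "\<And>c. c \<in> cover A \<Longrightarrow> D c \<Longrightarrow> \<theta> c \<in> cover B"
    and R: "R \<subseteq> polyfun (coords A)" "\<And>c. c \<in> cover A \<Longrightarrow> D c \<longleftrightarrow> (\<exists>r\<in>R. r c \<noteq> 0)"
    and sat: "\<And>c c'. c \<in> cover A \<Longrightarrow> c' \<in> cover A \<Longrightarrow> quo A c = quo A c' \<Longrightarrow> D c \<Longrightarrow>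
      D c' \<and> quo B (\<theta> c) = quo B (\<theta> c')"
    and \<Phi>: "\<And>c. c \<in> cover A \<Longrightarrow> quo A c \<in> X \<Longrightarrow> D c \<and> \<Phi> (quo A c) = quo B (\<theta> c)"
    and poly: "\<And>g. g \<in> coords B \<Longrightarrow> (\<lambda>c. g (\<theta> c)) \<in> polyfun (coords A)"
    and X: "X \<subseteq> points A" "\<Phi> ` X \<subseteq> Y"
  shows "morphism A X B Y \<Phi>"
  unfolding morphism_def
proof (intro conjI allI impI)
  have pb: "(\<lambda>c. p (\<theta> c)) \<in> polyfun (coords A)" if "p \<in> polyfun (coords B)" for p
    using polyfun_compose[OF that poly] .
  have topX: "topspace (subtopology (zariski A) X) = X"
    using X(1) by (simp add: topspace_zariski Int_absorb1)
  show "continuous_map (subtopology (zariski A) X) (subtopology (zariski B) Y) \<Phi>"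
    unfolding continuous_map topX
  proof (intro conjI allI impI)
    show "\<Phi> ` X \<subseteq> topspace (subtopology (zariski B) Y)"
    proof
      fix y assume "y \<in> \<Phi> ` X"
      then obtain x where x: "x \<in> X" "y = \<Phi> x" by blast
      then obtain c where c: "c \<in> cover A" "quo A c = x" using X(1) unfolding points_def by blast
      then have "y = quo B (\<theta> c)" "\<theta> c \<in> cover B" using \<Phi>[of c] cov[of c] x by auto
      then have "y \<in> points B" unfolding points_def by blast
      then show "y \<in> topspace (subtopology (zariski B) Y)" using X(2) x by (auto simp: topspace_zariski)
    qed
    fix T assume "openin (subtopology (zariski B) Y) T"
    then obtain T' where T': "zariski_open B T'" "T = T' \<inter> Y"
      unfolding openin_subtopology openin_zariski by blast
    obtain S where S: "S \<subseteq> polyfun (coords B)" "\<forall>c\<in>cover B. quo B c \<in> T' \<longleftrightarrow> (\<exists>p\<in>S. p c \<noteq> 0)"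
      using T'(1) unfolding zariski_open_def by (elim conjE exE)
    \<comment> \<open>Multiplication by the equations of \<open>D\<close> removes the coordinate vectors at which \<open>\<theta>\<close> is not admissible.\<close>
    let ?S = "(\<lambda>(r, p) c. r c * p (\<theta> c)) ` (R \<times> S)"
    let ?T = "{quo A c | c. c \<in> cover A \<and> D c \<and> quo B (\<theta> c) \<in> T'}"
    have "zariski_open A ?T" unfolding zariski_open_def
    proof (intro conjI exI[of _ ?S] ballI)
      show "?T \<subseteq> points A" unfolding points_def by blast
      show "?S \<subseteq> polyfun (coords A)"
      proof
        fix f assume "f \<in> ?S"
        then obtain r p where rp: "r \<in> R" "p \<in> S" "f = (\<lambda>c. r c * p (\<theta> c))" by auto
        show "f \<in> polyfun (coords A)" unfolding rp(3)
          using rp S(1) R(1) by (intro polyfun.mult pb) blast+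
      qed
      fix c assume c: "c \<in> cover A"
      have "quo A c \<in> ?T \<longleftrightarrow> D c \<and> quo B (\<theta> c) \<in> T'"
      proof
        assume "quo A c \<in> ?T"
        then obtain c' where "quo A c = quo A c'" "c' \<in> cover A" "D c'" "quo B (\<theta> c') \<in> T'" by blast
        then show "D c \<and> quo B (\<theta> c) \<in> T'" using sat[of c' c] c by metis
      qed (use c in blast)
      also have "\<dots> \<longleftrightarrow> (\<exists>r\<in>R. r c \<noteq> 0) \<and> (\<exists>p\<in>S. p (\<theta> c) \<noteq> 0)"
        using R(2)[OF c] S(2) cov[OF c] by blast
      also have "\<dots> \<longleftrightarrow> (\<exists>p\<in>?S. p c \<noteq> 0)" by auto
      finally show "quo A c \<in> ?T \<longleftrightarrow> (\<exists>p\<in>?S. p c \<noteq> 0)" .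
    qed
    moreover have "{x \<in> X. \<Phi> x \<in> T} = ?T \<inter> X"
    proof (intro set_eqI iffI)
      fix x assume "x \<in> {x \<in> X. \<Phi> x \<in> T}"
      then have x: "x \<in> X" "\<Phi> x \<in> T'" using T'(2) by auto
      then obtain c where c: "c \<in> cover A" "quo A c = x" using X(1) unfolding points_def by blast
      then show "x \<in> ?T \<inter> X" using \<Phi>[OF c(1)] x by auto
    next
      fix x assume x: "x \<in> ?T \<inter> X"
      then obtain c where "c \<in> cover A" "quo A c = x" "quo B (\<theta> c) \<in> T'" by blast
      then show "x \<in> {x \<in> X. \<Phi> x \<in> T}" using \<Phi>[of c] x T'(2) X(2) by auto
    qed
    ultimately show "openin (subtopology (zariski A) X) {x \<in> X. \<Phi> x \<in> T}"
      unfolding openin_subtopology openin_zariski by blast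
  qed
  fix T f assume Tf: "openin (subtopology (zariski B) Y) T \<and> regular B T f"
  show "regular A {x \<in> X. \<Phi> x \<in> T} (f \<circ> \<Phi>)"
    unfolding regular_def
  proof (intro ballI impI)
    fix c assume c: "c \<in> cover A" "quo A c \<in> {x \<in> X. \<Phi> x \<in> T}"
    then have "\<theta> c \<in> cover B" "quo B (\<theta> c) \<in> T" using cov \<Phi>[OF c(1)] by auto
    then obtain p r where pr: "p \<in> polyfun (coords B)" "r \<in> polyfun (coords B)" "r (\<theta> c) \<noteq> 0"
        "\<forall>c'\<in>cover B. quo B c' \<in> T \<and> r c' \<noteq> 0 \<longrightarrow> f (quo B c') = p c' / r c'"
      using conjunct2[OF Tf] unfolding regular_def by blast
    show "\<exists>p\<in>polyfun (coords A). \<exists>r\<in>polyfun (coords A). r c \<noteq> 0 \<and>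
        (\<forall>c'\<in>cover A. quo A c' \<in> {x \<in> X. \<Phi> x \<in> T} \<and> r c' \<noteq> 0 \<longrightarrow> (f \<circ> \<Phi>) (quo A c') = p c' / r c')"
    proof (rule bexI[of _ "\<lambda>c. p (\<theta> c)"], rule bexI[of _ "\<lambda>c. r (\<theta> c)"], rule conjI,
        rule pr(3), intro ballI impI)
      fix c' assume c': "c' \<in> cover A" "quo A c' \<in> {x \<in> X. \<Phi> x \<in> T} \<and> r (\<theta> c') \<noteq> 0"
      then have "\<theta> c' \<in> cover B" "\<Phi> (quo A c') = quo B (\<theta> c')" using cov \<Phi>[OF c'(1)] by auto
      then show "(f \<circ> \<Phi>) (quo A c') = p (\<theta> c') / r (\<theta> c')" using pr(4) c'(2) by simp
    qed (rule pb[OF pr(2)] pb[OF pr(1)])+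
  qed
qed

section \<open>Homomorphisms as matrices\<close>

context
  fixes n :: nat and U :: "nat \<Rightarrow> cvec set"
  assumes U: "U \<in> flag_variety n"
begin

abbreviation (input) "P_mod_NP \<equiv> quot_rep (Prep n) (NP n U)"
abbreviation (input) "NI_rep \<equiv> sub_rep (Irep n) (NI n U)"
definition Hom_space :: "(nat \<Rightarrow> cvec set \<Rightarrow> cvec) vspace" where
  "Hom_space = Hom_Q (n-1) P_mod_NP NI_rep"

text \<open>The elements of \<open>P/N_P\<close> at vertex \<open>d\<close>.\<close>

definition cls :: "nat \<Rightarrow> cvec \<Rightarrow> cvec set" where
  "cls d x = {x + u | u. u \<in> NP n U d}"

lemma flag_subspace: "d \<in> {1..n-1} \<Longrightarrow> cfun.subspace (U d)" "d \<in> {1..n-1} \<Longrightarrow> U d \<subseteq> L n"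
  using flag_Gr[OF U] by (auto simp: Gr_def)

lemma subspace_NP_flag: "d \<in> {1..n-1} \<Longrightarrow> cfun.subspace (NP n U d)"
  using subspace_NP[of d n U] flag_subspace[of d] by blast

lemma NP_subset_Lminus: "d \<in> {1..n-1} \<Longrightarrow> NP n U d \<subseteq> Lminus d"
  using mem_NP by blast

lemma subspace_NI_flag: "d \<in> {1..n-1} \<Longrightarrow> cfun.subspace (NI n U d)"
  using subspace_NI[of d n U] flag_subspace[of d] by blast

lemma cls_eq:
  assumes "d \<in> {1..n-1}"
  shows "cls d x = cls d y \<longleftrightarrow> x - y \<in> NP n U d"
proof
  note S = subspace_NP_flag[OF assms]
  assume "cls d x = cls d y"
  moreover have "x + 0 \<in> cls d x" unfolding cls_def using cfun.subspace_0[OF S] by blast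
  ultimately have "x \<in> cls d y" by simp
  then obtain u where "u \<in> NP n U d" "x = y + u" unfolding cls_def by blast
  then show "x - y \<in> NP n U d" by simp
next
  note S = subspace_NP_flag[OF assms]
  assume xy: "x - y \<in> NP n U d"
  have "x + u = y + ((x - y) + u)" "y + u = x + (u - (x - y))" for u by simp_all
  then show "cls d x = cls d y" unfolding cls_def
    using cfun.subspace_add[OF S xy] cfun.subspace_diff[OF S _ xy] by blast
qed

lemma mem_cls: "d \<in> {1..n-1} \<Longrightarrow> a \<in> cls d x \<longleftrightarrow> a - x \<in> NP n U d"
  unfolding cls_def by (auto intro!: exI[of _ "a - x"])

lemma cls_self: "d \<in> {1..n-1} \<Longrightarrow> x \<in> cls d x"
  using mem_cls cfun.subspace_0[OF subspace_NP_flag] by simp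

lemma sp_Prep: "vadd (sp (Prep n) d) = (+)" "vscl (sp (Prep n) d) = fscale"
  and sp_Irep: "vadd (sp (Irep n) d) = (+)" "vscl (sp (Irep n) d) = fscale" "vzero (sp (Irep n) d) = 0"
  by (simp_all add: Prep_def Irep_def dsum_def fspace_def)

lemma coset_cls: "coset (sp (Prep n) d) (NP n U d) x = cls d x"
  by (simp add: coset_def cls_def sp_Prep)

lemma P_mod_NP_car: "d \<in> {1..n-1} \<Longrightarrow> car (sp P_mod_NP d) = cls d ` Lminus d"
  by (simp add: quot_rep_def quot_space_def car_Prep coset_cls image_def)

lemma P_mod_NP_add:
  assumes "d \<in> {1..n-1}"
  shows "vadd (sp P_mod_NP d) (cls d x) (cls d y) = cls d (x + y)"
proof -
  have "cls d (a + b) = cls d (x + y)" if "a \<in> cls d x" "b \<in> cls d y" for a b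
  proof -
    have "(a - x) + (b - y) \<in> NP n U d"
      using that mem_cls[OF assms] cfun.subspace_add[OF subspace_NP_flag[OF assms]] by blast
    then show ?thesis unfolding cls_eq[OF assms] by (simp add: algebra_simps)
  qed
  moreover have "vadd (sp P_mod_NP d) (cls d x) (cls d y) = (\<Union>a\<in>cls d x. \<Union>b\<in>cls d y. cls d (a + b))"
    by (simp add: quot_rep_def quot_space_def coset_cls sp_Prep)
  ultimately show ?thesis using cls_self[OF assms] by blast
qed

lemma P_mod_NP_scale:
  assumes "d \<in> {1..n-1}"
  shows "vscl (sp P_mod_NP d) c (cls d x) = cls d (fscale c x)"
proof -
  have "cls d (fscale c a) = cls d (fscale c x)" if "a \<in> cls d x" for a
  proof -
    have "fscale c (a - x) \<in> NP n U d"
      using that mem_cls[OF assms] cfun.subspace_scale[OF subspace_NP_flag[OF assms]] by blast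
    then show ?thesis unfolding cls_eq[OF assms] by (simp add: cfun.scale_right_diff_distrib)
  qed
  moreover have "vscl (sp P_mod_NP d) c (cls d x) = (\<Union>a\<in>cls d x. cls d (fscale c a))"
    by (simp add: quot_rep_def quot_space_def coset_cls sp_Prep)
  ultimately show ?thesis using cls_self[OF assms] by blast
qed

lemma arr_Prep: "d \<in> {1..n-2} \<Longrightarrow> p \<in> Lminus d \<Longrightarrow> arr (Prep n) d p = p"
  by (auto simp: Prep_def dsum_def Mrep_def fun_eq_iff mem_Lminus)

lemma arr_Irep:
  assumes "d \<in> {1..n-2}" "y \<in> Lplus n d"
  shows "arr (Irep n) d y = pr (d+1) y"
proof -
  have *: "Suc ` {1..n-1} = {2..n}" using assms by (auto simp: image_Suc_atLeastAtMost)
  show ?thesis unfolding Irep_def * using assms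
    by (auto simp: dsum_def Mrep_def fun_eq_iff mem_Lplus pr_def)
qed

lemma P_mod_NP_arr:
  assumes d: "d \<in> {1..n-2}" and x: "x \<in> Lminus d"
  shows "arr P_mod_NP d (cls d x) = cls (d+1) x"
proof -
  have d1: "d \<in> {1..n-1}" and d2: "d + 1 \<in> {1..n-1}" using d by auto
  have "cls (d+1) (arr (Prep n) d a) = cls (d+1) x" if a: "a \<in> cls d x" for a
  proof -
    have ax: "a - x \<in> NP n U d" using a mem_cls[OF d1] by blast
    then have "(a - x) + x \<in> Lminus d" using NP_subset_Lminus[OF d1] x subspace_L cfun.subspace_add by blast
    then have "arr (Prep n) d a = a" using arr_Prep[OF d] by simp
    moreover have "a - x \<in> NP n U (d+1)" using ax NP_mono[OF flag_sub_chain[OF U] d] by blast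
    ultimately show ?thesis unfolding cls_eq[OF d2] by simp
  qed
  moreover have "arr P_mod_NP d (cls d x) = (\<Union>a\<in>cls d x. cls (d+1) (arr (Prep n) d a))"
    using coset_cls[of "d+1"] by (simp add: quot_rep_def)
  ultimately show ?thesis using cls_self[OF d1] by blast
qed

lemma NI_rep_simps: "car (sp NI_rep d) = NI n U d" "vadd (sp NI_rep d) = (+)" "vscl (sp NI_rep d) = fscale"
    "vzero (sp NI_rep d) = 0" "arr NI_rep d = arr (Irep n) d"
  by (simp_all add: sub_rep_def sp_Irep)

text \<open>The two maps are inverse linear isomorphisms between the matrices in \<open>fiber_space n U\<close> and the
  homomorphisms \<open>P/N_P \<rightarrow> N_I\<close>. Column \<open>j\<close> of a homomorphism is the value at the class of \<open>ell j\<close> at vertex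
  \<open>j\<close>, where \<open>ell j\<close> occurs first and all entries below the diagonal are still visible.\<close>

definition to_hom :: "((nat \<times> nat) option \<Rightarrow> complex) \<Rightarrow> nat \<Rightarrow> cvec set \<Rightarrow> cvec" where
  "to_hom w = (\<lambda>d\<in>{1..n-1}. \<lambda>A\<in>car (sp P_mod_NP d). fblock n (mat w) d (SOME a. a \<in> A))"

definition of_hom :: "(nat \<Rightarrow> cvec set \<Rightarrow> cvec) \<Rightarrow> (nat \<times> nat) option \<Rightarrow> complex" where
  "of_hom \<eta> = case_option 0 (\<lambda>(i, j). if 1 \<le> j \<and> j < i \<and> i \<le> n then \<eta> j (cls j (ell j)) i else 0)"

lemma to_hom_cls:
  assumes w: "w \<in> fiber_space n U" and d: "d \<in> {1..n-1}" and x: "x \<in> Lminus d"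
  shows "to_hom w d (cls d x) = fblock n (mat w) d x"
proof -
  let ?a = "SOME a. a \<in> cls d x"
  have "?a \<in> cls d x" by (rule someI[of "\<lambda>a. a \<in> cls d x", OF cls_self[OF d]])
  then have "?a - x \<in> NP n U d" using mem_cls[OF d] by blast
  then have "fblock n (mat w) d (?a - x) = 0" using w d unfolding fiber_space_def by blast
  then have "fblock n (mat w) d ?a = fblock n (mat w) d x" by (simp add: fblock_diff)
  moreover have "cls d x \<in> car (sp P_mod_NP d)" using P_mod_NP_car[OF d] x by blast
  ultimately show ?thesis using d by (simp add: to_hom_def)
qed

lemma mem_Hom_space: "\<eta> \<in> car Hom_space \<longleftrightarrow> \<eta> \<in> (\<Pi>\<^sub>E d\<in>{1..n-1}. linear_maps (sp P_mod_NP d) (sp NI_rep d)) \<and>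
    (\<forall>d\<in>{1..n-2}. \<forall>x\<in>car (sp P_mod_NP d). \<eta> (d+1) (arr P_mod_NP d x) = arr NI_rep d (\<eta> d x))"
proof -
  have "n - 1 - 1 = n - 2" by simp
  then show ?thesis unfolding Hom_space_def Hom_Q_def by simp
qed

lemma Hom_space_eqI:
  assumes "\<eta> \<in> car Hom_space" "\<zeta> \<in> car Hom_space"
    "\<And>d x. d \<in> {1..n-1} \<Longrightarrow> x \<in> Lminus d \<Longrightarrow> \<eta> d (cls d x) = \<zeta> d (cls d x)"
  shows "\<eta> = \<zeta>"
proof (rule PiE_ext)
  show "\<eta> \<in> (\<Pi>\<^sub>E d\<in>{1..n-1}. linear_maps (sp P_mod_NP d) (sp NI_rep d))" using assms mem_Hom_space by blast
  show "\<zeta> \<in> (\<Pi>\<^sub>E d\<in>{1..n-1}. linear_maps (sp P_mod_NP d) (sp NI_rep d))" using assms mem_Hom_space by blast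
  fix d assume d: "d \<in> {1..n-1}"
  have 1: "\<eta> d \<in> linear_maps (sp P_mod_NP d) (sp NI_rep d)" "\<zeta> d \<in> linear_maps (sp P_mod_NP d) (sp NI_rep d)"
    using assms mem_Hom_space d by blast+
  show "\<eta> d = \<zeta> d"
  proof (rule PiE_ext)
    show "\<eta> d \<in> car (sp P_mod_NP d) \<rightarrow>\<^sub>E car (sp NI_rep d)" "\<zeta> d \<in> car (sp P_mod_NP d) \<rightarrow>\<^sub>E car (sp NI_rep d)"
      using 1 unfolding linear_maps_def by blast+
    fix A assume "A \<in> car (sp P_mod_NP d)"
    then show "\<eta> d A = \<zeta> d A" using P_mod_NP_car[OF d] assms(3)[OF d] by auto
  qed
qed

lemma to_hom_in_Hom_space:
  assumes w: "w \<in> fiber_space n U"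
  shows "to_hom w \<in> car Hom_space"
  unfolding mem_Hom_space
proof (intro conjI ballI)
  show "to_hom w \<in> (\<Pi>\<^sub>E d\<in>{1..n-1}. linear_maps (sp P_mod_NP d) (sp NI_rep d))"
  proof (rule PiE_I)
    fix d assume d: "d \<in> {1..n-1}"
    note S = subspace_L(2)[of d]
    show "to_hom w d \<in> linear_maps (sp P_mod_NP d) (sp NI_rep d)"
      unfolding linear_maps_def
    proof (intro CollectI conjI allI ballI)
      show "to_hom w d \<in> car (sp P_mod_NP d) \<rightarrow>\<^sub>E car (sp NI_rep d)"
      proof (rule PiE_I)
        fix A assume "A \<in> car (sp P_mod_NP d)"
        then obtain x where x: "x \<in> Lminus d" "A = cls d x" using P_mod_NP_car[OF d] by blast
        then show "to_hom w d A \<in> car (sp NI_rep d)"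
          using to_hom_cls[OF w d x(1)] w d unfolding NI_rep_simps fiber_space_def by auto
      qed (use d in \<open>simp add: to_hom_def\<close>)
    next
      fix A B assume "A \<in> car (sp P_mod_NP d)" "B \<in> car (sp P_mod_NP d)"
      then have AB: "A \<in> cls d ` Lminus d" "B \<in> cls d ` Lminus d" unfolding P_mod_NP_car[OF d] .
      obtain x where xA: "x \<in> Lminus d" "A = cls d x" using AB(1) by blast
      obtain y where yB: "y \<in> Lminus d" "B = cls d y" using AB(2) by blast
      note x = xA yB
      show "to_hom w d (vadd (sp P_mod_NP d) A B) = vadd (sp NI_rep d) (to_hom w d A) (to_hom w d B)"
        using cfun.subspace_add[OF S x(1,3)]
        by (simp only: x P_mod_NP_add[OF d] to_hom_cls[OF w d] NI_rep_simps fblock_add)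
    next
      fix c A assume "A \<in> car (sp P_mod_NP d)"
      then obtain x where x: "x \<in> Lminus d" "A = cls d x" using P_mod_NP_car[OF d] by blast
      then show "to_hom w d (vscl (sp P_mod_NP d) c A) = vscl (sp NI_rep d) c (to_hom w d A)"
        using cfun.subspace_scale[OF S x(1)]
        by (simp only: x P_mod_NP_scale[OF d] to_hom_cls[OF w d] NI_rep_simps fblock_scale)
    qed
  next
    fix d assume "d \<notin> {1..n-1}"
    then show "to_hom w d = undefined" unfolding to_hom_def restrict_apply by (rule if_not_P)
  qed
next
  fix d A assume d: "d \<in> {1..n-2}" and A: "A \<in> car (sp P_mod_NP d)"
  have d1: "d \<in> {1..n-1}" and d2: "d + 1 \<in> {1..n-1}" using d by auto
  obtain x where x: "x \<in> Lminus d" "A = cls d x" using A P_mod_NP_car[OF d1] by blast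
  have x2: "x \<in> Lminus (d+1)" using x(1) by (auto simp: mem_Lminus)
  show "to_hom w (d+1) (arr P_mod_NP d A) = arr NI_rep d (to_hom w d A)"
    unfolding x(2) P_mod_NP_arr[OF d x(1)] to_hom_cls[OF w d2 x2] to_hom_cls[OF w d1 x(1)] NI_rep_simps
      arr_Irep[OF d fblock_Lplus] pr_fblock[OF x(1)] ..
qed

lemma Hom_space_values:
  assumes h: "\<eta> \<in> car Hom_space" and d: "d \<in> {1..n-1}"
  shows "x \<in> Lminus d \<Longrightarrow> \<eta> d (cls d x) \<in> NI n U d"
    and "x \<in> Lminus d \<Longrightarrow> y \<in> Lminus d \<Longrightarrow> \<eta> d (cls d (x + y)) = \<eta> d (cls d x) + \<eta> d (cls d y)"
    and "x \<in> Lminus d \<Longrightarrow> \<eta> d (cls d (fscale c x)) = fscale c (\<eta> d (cls d x))"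
proof -
  have 1: "\<eta> d \<in> linear_maps (sp P_mod_NP d) (sp NI_rep d)" using h mem_Hom_space d by blast
  have in1: "cls d x \<in> car (sp P_mod_NP d)" if "x \<in> Lminus d" for x using that P_mod_NP_car[OF d] by blast
  show "\<eta> d (cls d x) \<in> NI n U d" if "x \<in> Lminus d"
    using 1 in1[OF that] unfolding linear_maps_def NI_rep_simps by blast
  show "\<eta> d (cls d (x + y)) = \<eta> d (cls d x) + \<eta> d (cls d y)" if "x \<in> Lminus d" "y \<in> Lminus d"
    using 1 in1[OF that(1)] in1[OF that(2)] unfolding linear_maps_def NI_rep_simps P_mod_NP_add[OF d, symmetric] by blast
  show "\<eta> d (cls d (fscale c x)) = fscale c (\<eta> d (cls d x))" if "x \<in> Lminus d"
    using 1 in1[OF that] unfolding linear_maps_def NI_rep_simps P_mod_NP_scale[OF d, symmetric] by blast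
qed

lemma Hom_space_arr:
  assumes h: "\<eta> \<in> car Hom_space" and d: "d \<in> {1..n-2}" and x: "x \<in> Lminus d"
  shows "\<eta> (d+1) (cls (d+1) x) = pr (d+1) (\<eta> d (cls d x))"
proof -
  have d1: "d \<in> {1..n-1}" using d by auto
  have "cls d x \<in> car (sp P_mod_NP d)" using x P_mod_NP_car[OF d1] by blast
  then have "\<eta> (d+1) (arr P_mod_NP d (cls d x)) = arr NI_rep d (\<eta> d (cls d x))" using h d mem_Hom_space by blast
  moreover have "\<eta> d (cls d x) \<in> Lplus n d" using Hom_space_values(1)[OF h d1 x] mem_NI[OF d1] by blast
  ultimately show ?thesis unfolding P_mod_NP_arr[OF d x] NI_rep_simps using arr_Irep[OF d] by simp
qed

text \<open>The arrow \<open>d \<rightarrow> d + 1\<close> erases only the coordinate \<open>d + 1\<close>, so a homomorphism at vertex \<open>d\<close> is determined by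
  its values at the generators \<open>ell j\<close> at the vertices \<open>j \<le> d\<close>, restricted to the rows below \<open>d\<close>.\<close>

lemma fblock_of_hom:
  assumes h: "\<eta> \<in> car Hom_space" and d: "d \<in> {1..n-1}" and x: "x \<in> Lminus d"
  shows "fblock n (mat (of_hom \<eta>)) d x = \<eta> d (cls d x)"
proof -
  let ?f = "mat (of_hom \<eta>)"
  have entry: "\<eta> e (cls e (ell j)) i = \<eta> j (cls j (ell j)) i"
    if j: "1 \<le> j" "j \<le> e" "e \<le> n - 1" and i: "e < i" for e i j
    using j(2,3) i
  proof (induction e rule: dec_induct)
    case (step e)
    have e: "e \<in> {1..n-2}" using step j by auto
    have "ell j \<in> Lminus e" using j step by (auto simp: mem_Lminus ell_def)
    then have "\<eta> (e+1) (cls (e+1) (ell j)) = pr (e+1) (\<eta> e (cls e (ell j)))" by (rule Hom_space_arr[OF h e])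
    then have "\<eta> (Suc e) (cls (Suc e) (ell j)) i = \<eta> e (cls e (ell j)) i"
      using step.prems by (simp add: pr_def)
    then show ?case using step by simp
  qed simp
  let ?S = "{x \<in> Lminus d. fblock n ?f d x = \<eta> d (cls d x)}"
  have 0: "(0 :: cvec) \<in> Lminus d" by (simp add: mem_Lminus)
  have "\<eta> d (cls d 0) = 0" using Hom_space_values(3)[OF h d 0, of 0] by simp
  then have "cfun.subspace ?S"
    using 0 cfun.subspace_add[OF subspace_L(2)[of d]] cfun.subspace_scale[OF subspace_L(2)[of d]]
      Hom_space_values(2,3)[OF h d] unfolding cfun.subspace_def
    by (auto simp: fblock_0 fblock_add fblock_scale)
  moreover have "ell ` {1..d} \<subseteq> ?S"
  proof
    fix v assume "v \<in> ell ` {1..d}"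
    then obtain a where a: "a \<in> {1..d}" "v = ell a" by blast
    have v: "ell a \<in> Lminus d" using a by (auto simp: mem_Lminus ell_def)
    have "\<eta> d (cls d (ell a)) \<in> Lplus n d" using Hom_space_values(1)[OF h d v] mem_NI[OF d] by blast
    then have z: "\<eta> d (cls d (ell a)) i = 0" if "i \<notin> {d+1..n}" for i using that unfolding mem_Lplus by blast
    have "fblock n ?f d (ell a) = \<eta> d (cls d (ell a))"
    proof
      fix i
      show "fblock n ?f d (ell a) i = \<eta> d (cls d (ell a)) i"
      proof (cases "i \<in> {d+1..n}")
        case True
        then have "fblock n ?f d (ell a) i = \<eta> a (cls a (ell a)) i"
          using a(1) by (simp add: fblock_ell of_hom_def)
        also have "\<dots> = \<eta> d (cls d (ell a)) i"
          using entry[of a d i] a(1) d True by auto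
        finally show ?thesis .
      next
        case False
        then show ?thesis using z[OF False] fblock_ell[OF a(1), of n ?f i] by (simp only: if_False)
      qed
    qed
    then show "v \<in> ?S" using v a(2) by blast
  qed
  ultimately show ?thesis using cfun.span_minimal[of "ell ` {1..d}" ?S] x unfolding Lminus_def by blast
qed

lemma of_hom_fiber_space:
  assumes h: "\<eta> \<in> car Hom_space"
  shows "of_hom \<eta> \<in> fiber_space n U"
  unfolding fiber_space_def
proof (intro CollectI conjI ballI)
  show "mat (of_hom \<eta>) \<in> nminus n" by (auto simp: nminus_def of_hom_def)
  show "of_hom \<eta> None = 0" by (simp add: of_hom_def)
  fix d assume d: "d \<in> {1..n-1}"
  show "fblock n (mat (of_hom \<eta>)) d x = 0" if x: "x \<in> NP n U d" for x
  proof -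
    have 0: "(0 :: cvec) \<in> Lminus d" by (simp add: mem_Lminus)
    have "\<eta> d (cls d 0) = 0" using Hom_space_values(3)[OF h d 0, of 0] by simp
    moreover have "cls d x = cls d 0" unfolding cls_eq[OF d] using x by simp
    ultimately show ?thesis using fblock_of_hom[OF h d] NP_subset_Lminus[OF d] x by auto
  qed
  show "fblock n (mat (of_hom \<eta>)) d x \<in> NI n U d" if x: "x \<in> Lminus d" for x
    unfolding fblock_of_hom[OF h d x] by (rule Hom_space_values(1)[OF h d x])
qed

lemma to_of_hom:
  assumes h: "\<eta> \<in> car Hom_space"
  shows "to_hom (of_hom \<eta>) = \<eta>"
  using to_hom_cls[OF of_hom_fiber_space[OF h]] fblock_of_hom[OF h]
  by (intro Hom_space_eqI[OF to_hom_in_Hom_space[OF of_hom_fiber_space[OF h]] h]) simp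

lemma of_to_hom:
  assumes w: "w \<in> fiber_space n U"
  shows "of_hom (to_hom w) = w"
proof
  fix t
  show "of_hom (to_hom w) t = w t"
  proof (cases t)
    case None
    then show ?thesis using w by (simp add: of_hom_def fiber_space_def)
  next
    case (Some ij)
    obtain i j where ij: "ij = (i, j)" by (cases ij)
    show ?thesis
    proof (cases "1 \<le> j \<and> j < i \<and> i \<le> n")
      case True
      then have j: "j \<in> {1..n-1}" and v: "ell j \<in> Lminus j" by (auto simp: mem_Lminus ell_def)
      have "of_hom (to_hom w) t = fblock n (mat w) j (ell j) i"
        using True to_hom_cls[OF w j v] by (simp add: of_hom_def Some ij)
      then show ?thesis using True fblock_ell[of j j n "mat w" i] by (simp add: Some ij)
    next
      case False
      then have "w (Some (i, j)) = 0" using w unfolding fiber_space_def nminus_def by blast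
      then show ?thesis using False by (auto simp: of_hom_def Some ij)
    qed
  qed
qed

lemma subspace_fiber: "cfun.subspace (fiber_space n U)"
proof -
  have m: "mat (x + y) = mat x + mat y" "mat (fscale c x) = fscale c (mat x)"
    for x y :: "(nat \<times> nat) option \<Rightarrow> complex" and c by (auto simp: fscale_def fun_eq_iff)
  have z: "fblock n (mat 0) d x = 0" for d x by (auto simp: fblock_def fun_eq_iff)
  show ?thesis unfolding cfun.subspace_def
  proof (intro conjI allI ballI)
    show "0 \<in> fiber_space n U"
      unfolding fiber_space_def using z cfun.subspace_0[OF subspace_NI_flag] by (simp add: nminus_def)
  next
    fix x y assume xy: "x \<in> fiber_space n U" "y \<in> fiber_space n U"
    have "mat x + fscale 1 (mat y) \<in> nminus n"
      using xy unfolding fiber_space_def by (intro nminus_add_scale) auto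
    then have "mat x + mat y \<in> nminus n" by simp
    then show "x + y \<in> fiber_space n U"
      unfolding fiber_space_def mem_Collect_eq m fblock_add_matrix
      using xy cfun.subspace_add[OF subspace_NI_flag] unfolding fiber_space_def mem_Collect_eq by simp
  next
    fix c x assume x: "x \<in> fiber_space n U"
    have "fscale c (mat x) \<in> nminus n" using x unfolding fiber_space_def nminus_def by (auto simp: fscale_apply)
    then show "fscale c x \<in> fiber_space n U"
      unfolding fiber_space_def mem_Collect_eq m fblock_scale_matrix
      using x cfun.subspace_scale[OF subspace_NI_flag] unfolding fiber_space_def mem_Collect_eq
      by (simp add: fscale_apply)
  qed
qed

lemma Hom_space_ops:
  "vadd Hom_space \<eta> \<zeta> = (\<lambda>d\<in>{1..n-1}. \<lambda>x\<in>car (sp P_mod_NP d). \<eta> d x + \<zeta> d x)"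
  "vscl Hom_space c \<eta> = (\<lambda>d\<in>{1..n-1}. \<lambda>x\<in>car (sp P_mod_NP d). fscale c (\<eta> d x))"
  "vzero Hom_space = (\<lambda>d\<in>{1..n-1}. \<lambda>x\<in>car (sp P_mod_NP d). 0)"
  unfolding Hom_space_def Hom_Q_def by (simp_all add: NI_rep_simps)

lemma to_hom_ops:
  shows "to_hom (w + w') = vadd Hom_space (to_hom w) (to_hom w')"
    and "to_hom (fscale c w) = vscl Hom_space c (to_hom w)"
    and "to_hom 0 = vzero Hom_space"
proof -
  have m: "mat (x + y) = mat x + mat y" "mat (fscale c x) = fscale c (mat x)"
    for x y :: "(nat \<times> nat) option \<Rightarrow> complex" and c by (auto simp: fscale_def fun_eq_iff)
  have z: "fblock n (mat 0) d x = 0" for d x by (auto simp: fblock_def fun_eq_iff)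
  show "to_hom (w + w') = vadd Hom_space (to_hom w) (to_hom w')"
    unfolding Hom_space_ops to_hom_def m fblock_add_matrix by (intro restrict_ext) simp
  show "to_hom (fscale c w) = vscl Hom_space c (to_hom w)"
    unfolding Hom_space_ops to_hom_def m fblock_scale_matrix by (intro restrict_ext) simp
  show "to_hom 0 = vzero Hom_space"
    unfolding Hom_space_ops to_hom_def z by (rule refl)
qed

lemma of_hom_ops:
  assumes "\<eta> \<in> car Hom_space" "\<zeta> \<in> car Hom_space"
  shows "of_hom (vadd Hom_space \<eta> \<zeta>) = of_hom \<eta> + of_hom \<zeta>"
    and "of_hom (vscl Hom_space c \<eta>) = fscale c (of_hom \<eta>)"
proof -
  note F = of_hom_fiber_space[OF assms(1)] of_hom_fiber_space[OF assms(2)]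
  have "vadd Hom_space \<eta> \<zeta> = to_hom (of_hom \<eta> + of_hom \<zeta>)"
    using to_of_hom[OF assms(1)] to_of_hom[OF assms(2)] by (simp add: to_hom_ops)
  then show "of_hom (vadd Hom_space \<eta> \<zeta>) = of_hom \<eta> + of_hom \<zeta>"
    using of_to_hom[OF cfun.subspace_add[OF subspace_fiber F]] by simp
  have "vscl Hom_space c \<eta> = to_hom (fscale c (of_hom \<eta>))"
    using to_of_hom[OF assms(1)] by (simp add: to_hom_ops)
  then show "of_hom (vscl Hom_space c \<eta>) = fscale c (of_hom \<eta>)"
    using of_to_hom[OF cfun.subspace_scale[OF subspace_fiber F(1)]] by simp
qed

lemma line_Hom_space: "line Hom_space (to_hom w) = to_hom ` line (V n) w"
  unfolding line_V line_def[of Hom_space] image_image to_hom_ops ..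

lemma line_fiber: "w \<in> fiber_space n U \<Longrightarrow> line (V n) w \<subseteq> fiber_space n U"
  unfolding line_V using cfun.subspace_scale[OF subspace_fiber] by blast

lemma of_hom_line:
  assumes "w \<in> fiber_space n U"
  shows "of_hom ` to_hom ` line (V n) w = line (V n) w"
proof -
  have "of_hom (to_hom v) = v" if "v \<in> line (V n) w" for v
    using line_fiber[OF assms] that of_to_hom by blast
  then show ?thesis by (simp add: image_image)
qed

lemma to_hom_eq_0: "w \<in> fiber_space n U \<Longrightarrow> to_hom w = vzero Hom_space \<longleftrightarrow> w = 0"
  using of_to_hom cfun.subspace_0[OF subspace_fiber] to_hom_ops(3) by metis

lemma points_Hom_space: "points (proj_space Hom_space) = {line Hom_space (to_hom w) | w. w \<in> fiber_space n U \<and> w \<noteq> 0}"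
proof (intro set_eqI iffI)
  fix l assume "l \<in> points (proj_space Hom_space)"
  then obtain \<eta> where \<eta>: "\<eta> \<in> car Hom_space" "\<eta> \<noteq> vzero Hom_space" "l = line Hom_space \<eta>"
    unfolding points_def proj_space_def by auto
  then show "l \<in> {line Hom_space (to_hom w) | w. w \<in> fiber_space n U \<and> w \<noteq> 0}"
    using to_of_hom[OF \<eta>(1)] of_hom_fiber_space[OF \<eta>(1)] to_hom_ops(3)
    by (intro CollectI exI[of _ "of_hom \<eta>"]) auto
next
  fix l assume "l \<in> {line Hom_space (to_hom w) | w. w \<in> fiber_space n U \<and> w \<noteq> 0}"
  then show "l \<in> points (proj_space Hom_space)"
    unfolding points_def proj_space_def using to_hom_in_Hom_space to_hom_eq_0 by auto
qed

text \<open>The isomorphism sends the line spanned by \<open>w\<close> to the line spanned by the homomorphism of \<open>w\<close>. A linear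
  projection \<open>\<pi>\<close> onto \<open>fiber_space n U\<close> extends its lift to the matrices with \<open>\<pi> w \<noteq> 0\<close>, as needed for
  \<open>morphism_of_lift\<close>; in the opposite direction a fixed frame of \<open>U\<close> supplies the second component.\<close>

lemma fiber_isomorphic:
  assumes "U \<notin> iota n ` nminus n"
  shows "isomorphic_varieties (ambient n) (phi_fiber n U) (proj_space Hom_space) (points (proj_space Hom_space))"
proof -
  note fib = phi_fiber_eq[OF U assms]
  define \<Phi> :: "((nat \<times> nat) option \<Rightarrow> complex) set \<times> (nat \<Rightarrow> cvec set) \<Rightarrow> (nat \<Rightarrow> cvec set \<Rightarrow> cvec) set"
    where "\<Phi> = (\<lambda>x. to_hom ` fst x)"
  define \<Psi> :: "(nat \<Rightarrow> cvec set \<Rightarrow> cvec) set \<Rightarrow> ((nat \<times> nat) option \<Rightarrow> complex) set \<times> (nat \<Rightarrow> cvec set)"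
    where "\<Psi> = (\<lambda>l. (of_hom ` l, U))"
  obtain \<pi> :: "((nat \<times> nat) option \<Rightarrow> complex) \<Rightarrow> (nat \<times> nat) option \<Rightarrow> complex"
    where \<pi>: "lin \<pi>" "\<And>w. \<pi> w \<in> fiber_space n U" "\<And>w. w \<in> fiber_space n U \<Longrightarrow> \<pi> w = w"
    using exists_projection[OF subspace_fiber] by blast
  have \<Phi>Y: "\<Phi> ` phi_fiber n U \<subseteq> points (proj_space Hom_space)"
  proof
    fix l assume "l \<in> \<Phi> ` phi_fiber n U"
    then obtain w where "w \<in> fiber_space n U" "w \<noteq> 0" "l = to_hom ` line (V n) w"
      unfolding fib \<Phi>_def by auto
    then show "l \<in> points (proj_space Hom_space)" unfolding points_Hom_space line_Hom_space by blast
  qed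
  have \<Psi>X: "\<Psi> ` points (proj_space Hom_space) \<subseteq> phi_fiber n U"
  proof
    fix x assume "x \<in> \<Psi> ` points (proj_space Hom_space)"
    then obtain w where w: "w \<in> fiber_space n U" "w \<noteq> 0" "x = (of_hom ` to_hom ` line (V n) w, U)"
      unfolding points_Hom_space line_Hom_space \<Psi>_def by auto
    then show "x \<in> phi_fiber n U" unfolding fib of_hom_line[OF w(1)] by blast
  qed
  have fibpts: "phi_fiber n U \<subseteq> points (ambient n)"
  proof
    fix x assume "x \<in> phi_fiber n U"
    then have "(fst x, snd x) \<in> graph_closure n" unfolding phi_fiber_def prod.collapse by blast
    then have "(fst x, snd x) \<in> points (proj_space (V n)) \<times> flag_variety n"
      unfolding graph_closure_iff by blast
    from subsetD[OF flag_subset_points this] show "x \<in> points (ambient n)"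
      unfolding prod.collapse .
  qed
  have lineEq: "\<exists>s. s \<noteq> 0 \<and> w' = fscale s w" if "line (V n) w = line (V n) w'" "w \<noteq> 0" "w' \<noteq> 0" for w w'
  proof -
    have "w' \<in> line (V n) w" using line_self[of w' n] that(1) by simp
    then obtain s where s: "w' = fscale s w" unfolding line_V by blast
    then have "s \<noteq> 0" using that(3) by auto
    then show ?thesis using s by blast
  qed
  have mor1: "morphism (ambient n) (phi_fiber n U) (proj_space Hom_space) (points (proj_space Hom_space)) \<Phi>"
  proof (rule morphism_of_lift[where D = "\<lambda>(w, B). \<pi> w \<noteq> 0" and \<theta> = "\<lambda>(w, B). to_hom (\<pi> w)"
        and R = "range (\<lambda>t. \<lambda>(w, B). \<pi> w t)"])
    fix c assume "c \<in> cover (ambient n)" and D: "(\<lambda>(w, B). \<pi> w \<noteq> 0) c"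
    obtain w B where c: "c = (w, B)" by (cases c)
    show "(\<lambda>(w, B). to_hom (\<pi> w)) c \<in> cover (proj_space Hom_space)"
      using D to_hom_in_Hom_space[OF \<pi>(2)] to_hom_eq_0[OF \<pi>(2)] by (simp add: c proj_space_def)
  next
    show "range (\<lambda>t. \<lambda>(w, B). \<pi> w t) \<subseteq> polyfun (coords (ambient n))"
    proof
      fix f :: "((nat \<times> nat) option \<Rightarrow> complex) \<times> (nat \<Rightarrow> nat \<Rightarrow> cvec) \<Rightarrow> complex"
      assume "f \<in> range (\<lambda>t. \<lambda>(w, B). \<pi> w t)"
      then obtain t where t: "f = (\<lambda>(w, B). \<pi> w t)" by blast
      have "linear_form (V n) (\<lambda>w. \<pi> w t)"
        by (simp add: linear_form_def lin_add[OF \<pi>(1)] lin_scale[OF \<pi>(1)] fscale_apply)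
      then show "f \<in> polyfun (coords (ambient n))" unfolding t by (rule polyfun_form)
    qed
  next
    fix c :: "((nat \<times> nat) option \<Rightarrow> complex) \<times> (nat \<Rightarrow> nat \<Rightarrow> cvec)"
    obtain w B where c: "c = (w, B)" by (cases c)
    show "(\<lambda>(w, B). \<pi> w \<noteq> 0) c \<longleftrightarrow> (\<exists>r\<in>range (\<lambda>t. \<lambda>(w, B). \<pi> w t). r c \<noteq> 0)"
      by (auto simp: c fun_eq_iff)
  next
    fix c c' assume cc: "c \<in> cover (ambient n)" "c' \<in> cover (ambient n)" "quo (ambient n) c = quo (ambient n) c'"
      and D: "(\<lambda>(w, B). \<pi> w \<noteq> 0) c"
    obtain w B where c: "c = (w, B)" by (cases c)
    obtain w' B' where c': "c' = (w', B')" by (cases c')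
    obtain s where s: "s \<noteq> 0" "w' = fscale s w"
      using lineEq[of w w'] cc unfolding c c' cover_ambient quo_ambient by auto
    have \<pi>s: "\<pi> w' = fscale s (\<pi> w)" unfolding s(2) by (rule lin_scale[OF \<pi>(1)])
    then have "line Hom_space (to_hom (\<pi> w)) = line Hom_space (to_hom (\<pi> w'))"
      using line_scale[OF s(1)] by (simp add: line_Hom_space)
    then show "(\<lambda>(w, B). \<pi> w \<noteq> 0) c' \<and> quo (proj_space Hom_space) ((\<lambda>(w, B). to_hom (\<pi> w)) c) =
        quo (proj_space Hom_space) ((\<lambda>(w, B). to_hom (\<pi> w)) c')"
      using D s(1) \<pi>s by (simp add: c c' proj_space_def)
  next
    fix c assume cc: "c \<in> cover (ambient n)" "quo (ambient n) c \<in> phi_fiber n U"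
    obtain w B where c: "c = (w, B)" by (cases c)
    obtain v where v: "line (V n) w = line (V n) v" "v \<in> fiber_space n U"
      using cc(2) unfolding fib c quo_ambient by auto
    have w0: "w \<noteq> 0" using cc(1) unfolding c cover_ambient by blast
    have "w \<in> fiber_space n U" using line_self[of w n] v line_fiber[OF v(2)] by blast
    then show "(\<lambda>(w, B). \<pi> w \<noteq> 0) c \<and>
        \<Phi> (quo (ambient n) c) = quo (proj_space Hom_space) ((\<lambda>(w, B). to_hom (\<pi> w)) c)"
      using w0 \<pi>(3) by (simp add: c quo_ambient \<Phi>_def proj_space_def line_Hom_space)
  next
    fix g assume "g \<in> coords (proj_space Hom_space)"
    then have g: "linear_form Hom_space g" by (simp add: proj_space_def)
    have "linear_form (V n) (\<lambda>w. g (to_hom (\<pi> w)))"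
      using g to_hom_in_Hom_space[OF \<pi>(2)] unfolding linear_form_def
      by (simp add: lin_add[OF \<pi>(1)] lin_scale[OF \<pi>(1)] to_hom_ops)
    then have "(\<lambda>(w, B). g (to_hom (\<pi> w))) \<in> polyfun (coords (ambient n))" by (rule polyfun_form)
    then show "(\<lambda>c. g ((\<lambda>(w, B). to_hom (\<pi> w)) c)) \<in> polyfun (coords (ambient n))"
      by (simp add: case_prod_unfold)
  qed (rule fibpts \<Phi>Y)+
  obtain B0 where B0: "B0 \<in> (\<Pi>\<^sub>E d\<in>{1..n-1}. frames n d)"
      "(\<lambda>d\<in>{1..n-1}. cfun.span (B0 d ` {1..d})) = U"
    using exists_flag_frame[OF U] .
  have line_of: "line (V n) (of_hom \<eta>) = of_hom ` line Hom_space \<eta>" if "\<eta> \<in> car Hom_space" for \<eta>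
    using line_Hom_space[of "of_hom \<eta>"] of_hom_line[OF of_hom_fiber_space[OF that]] to_of_hom[OF that] by simp
  have mor2: "morphism (proj_space Hom_space) (points (proj_space Hom_space)) (ambient n) (phi_fiber n U) \<Psi>"
  proof (rule morphism_of_lift[where D = "\<lambda>_. True" and \<theta> = "\<lambda>\<eta>. (of_hom \<eta>, B0)" and R = "{\<lambda>_. 1}"])
    fix \<eta> assume "\<eta> \<in> cover (proj_space Hom_space)"
    then have \<eta>: "\<eta> \<in> car Hom_space" "\<eta> \<noteq> vzero Hom_space" by (simp_all add: proj_space_def)
    have F: "of_hom \<eta> \<in> fiber_space n U" by (rule of_hom_fiber_space[OF \<eta>(1)])
    have "of_hom \<eta> \<noteq> 0" using to_of_hom[OF \<eta>(1)] to_hom_ops(3) \<eta>(2) by auto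
    then show "(of_hom \<eta>, B0) \<in> cover (ambient n)"
      unfolding cover_ambient using F B0(1) by (simp add: fiber_space_def)
  next
    fix \<eta> \<eta>' assume h: "\<eta> \<in> cover (proj_space Hom_space)" "\<eta>' \<in> cover (proj_space Hom_space)"
      "quo (proj_space Hom_space) \<eta> = quo (proj_space Hom_space) \<eta>'"
    then have "line (V n) (of_hom \<eta>) = line (V n) (of_hom \<eta>')"
      using line_of by (simp add: proj_space_def)
    then show "True \<and> quo (ambient n) (of_hom \<eta>, B0) = quo (ambient n) (of_hom \<eta>', B0)"
      by (simp add: quo_ambient)
  next
    fix \<eta> assume "\<eta> \<in> cover (proj_space Hom_space)"
    then have "\<eta> \<in> car Hom_space" by (simp add: proj_space_def)
    then show "True \<and> \<Psi> (quo (proj_space Hom_space) \<eta>) = quo (ambient n) (of_hom \<eta>, B0)"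
      unfolding quo_ambient B0(2) using line_of by (simp add: \<Psi>_def proj_space_def)
  next
    fix g assume "g \<in> coords (ambient n)"
    then consider g' where "g = (\<lambda>(w, B). g' w)" "linear_form (V n) g'"
      | d k i where "g = (\<lambda>(w, B). B d k i)" unfolding coords_ambient by blast
    then show "(\<lambda>\<eta>. g (of_hom \<eta>, B0)) \<in> polyfun (coords (proj_space Hom_space))"
    proof cases
      case 1
      have "mat (of_hom \<eta>) \<in> nminus n" if "\<eta> \<in> car Hom_space" for \<eta>
        using of_hom_fiber_space[OF that] by (simp add: fiber_space_def)
      then have "linear_form Hom_space (\<lambda>\<eta>. g' (of_hom \<eta>))"
        using 1(2) of_hom_ops unfolding linear_form_def by simp
      then have "(\<lambda>\<eta>. g' (of_hom \<eta>)) \<in> coords (proj_space Hom_space)" by (simp add: proj_space_def)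
      then show ?thesis unfolding 1(1) by (simp add: polyfun.coord)
    next
      case 2
      then show ?thesis by (simp add: polyfun.const)
    qed
  qed (use \<Psi>X in \<open>auto intro: polyfun.const\<close>)
  have "\<Psi> (\<Phi> x) = x" if x: "x \<in> phi_fiber n U" for x
  proof -
    obtain w where w: "w \<in> fiber_space n U" "x = (line (V n) w, U)" using x unfolding fib by blast
    then show ?thesis using of_hom_line[OF w(1)] by (simp add: \<Phi>_def \<Psi>_def)
  qed
  moreover have "\<Phi> (\<Psi> y) = y" if y: "y \<in> points (proj_space Hom_space)" for y
  proof -
    obtain w where w: "w \<in> fiber_space n U" "y = to_hom ` line (V n) w"
      using y unfolding points_Hom_space line_Hom_space by blast
    then show ?thesis using of_hom_line[OF w(1)] by (simp add: \<Phi>_def \<Psi>_def)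
  qed
  ultimately show ?thesis unfolding isomorphic_varieties_def using mor1 mor2 by blast
qed

end

theorem theorem1:
  fixes n :: nat and U :: "nat \<Rightarrow> cvec set"
  assumes "n \<ge> 2"
    and "U \<in> flag_variety n"
    and "U \<notin> iota n ` nminus n"
  shows "isomorphic_varieties
           (ambient n) (phi_fiber n U)
           (proj_space (Hom_Q (n-1) (quot_rep (Prep n) (NP n U)) (sub_rep (Irep n) (NI n U))))
           (points (proj_space
              (Hom_Q (n-1) (quot_rep (Prep n) (NP n U)) (sub_rep (Irep n) (NI n U)))))"
  using fiber_isomorphic[OF assms(2,3)] unfolding Hom_space_def[OF assms(2)] .

end
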